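(* Let $n\ge3$, $s\in(0,1)$, and let $\Omega\subset\mathbb{R}^n$ be an open bounded domain. Suppose $u\in\mathcal{X}^{1,2}(\Omega)$ is a weak solution of $$-\Delta u+(-\Delta)^su+a(x)u=f(x,u)\quad\text{in }\Omega,$$ where $f:\bar\Omega\times\mathbb{R}\to\mathbb{R}$ is a Carathéodory function for which there exist $c_f>0$ and $q\in[2,2^*]$, $2^*=\frac{2n}{n-2}$, such that $$|f(x,t)|\le c_f(1+|t|^{q-1})\quad\text{for a.e. }x\in\Omega,\ t\in\mathbb{R}.$$ If either of the following conditions holds: (1) $0\le a(x)\in L^{l/2}(\Omega)$ for some $l\ge n$; (2) $a(x)\in L^\infty(\Omega)$, then $u\in L^\infty(\Omega)$. Moreover, there exists a constant $C_0>0$ such that $$\|u\|_{L^\infty(\Omega)}\le C_0\left(1+\int_\Omega|u|^{2^*\beta_1}dx\right)^{\frac{1}{2^*(\beta_1-1)}},$$ where $C_0=C_0(n,\Omega,c_f)$ and $\beta_1=\frac{2^*+1}{2}$ if (1) holds, and $C_0=C_0(n,\Omega,c_f,\|a\|_{L^\infty(\Omega)})$ and $\beta_1=\frac{2^*}{2}$ if (2) holds.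
   Context: $\mathcal{X}^{1,2}(\Omega)$ is the completion of $C_0^\infty(\Omega)$ with respect to the norm $\|u\|_{\mathcal{X}^{1,2}(\Omega)}=\big(\|\nabla u\|_{L^2(\mathbb{R}^n)}^2+[u]_s^2\big)^{1/2}$, where $[u]_s^2=\int_{\mathbb{R}^n}\int_{\mathbb{R}^n}\frac{(u(x)-u(y))^2}{|x-y|^{n+2s}}dx\,dy$. Its elements are functions on $\mathbb{R}^n$ vanishing a.e. outside $\Omega$. Put $$B_s(u,v)=\int_{\mathbb{R}^n}\nabla u\cdot\nabla v\,dx+\int_{\mathbb{R}^n}\int_{\mathbb{R}^n}\frac{(u(x)-u(y))(v(x)-v(y))}{|x-y|^{n+2s}}dx\,dy.$$ A weak solution of the equation is $u\in\mathcal{X}^{1,2}(\Omega)$ with $B_s(u,\phi)+\int_\Omega a u\phi\,dx=\int_\Omega f(x,u)\phi\,dx$ for all $\phi\in\mathcal{X}^{1,2}(\Omega)$ (the fractional Laplacian is normalized so that this is the weak form). The notation $C_0(\cdots)$ lists the quantities on which the constant depends. *)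

theory Defs
  imports "HOL-Analysis.Analysis" "HOL-Probability.Essential_Supremum"
begin

primrec C_k :: "nat \<Rightarrow> ('a::euclidean_space \<Rightarrow> real) \<Rightarrow> bool" where
  "C_k 0 \<phi> = continuous_on UNIV \<phi>"
| "C_k (Suc k) \<phi> =
     ((\<forall>x. \<phi> differentiable (at x)) \<and>
      (\<forall>b\<in>Basis. C_k k (\<lambda>x. frechet_derivative \<phi> (at x) b)))"

definition test_functions :: "'a::euclidean_space set \<Rightarrow> ('a \<Rightarrow> real) set" where
  "test_functions \<Omega> =
     {\<phi>. (\<forall>k. C_k k \<phi>) \<and> compact (closure {x. \<phi> x \<noteq> 0}) \<and> closure {x. \<phi> x \<noteq> 0} \<subseteq> \<Omega>}"

definition grad :: "('a::euclidean_space \<Rightarrow> real) \<Rightarrow> 'a \<Rightarrow> 'a" where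
  "grad \<phi> x = (THE D. GDERIV \<phi> x :> D)"

definition has_weak_grad :: "('a::euclidean_space \<Rightarrow> real) \<Rightarrow> ('a \<Rightarrow> 'a) \<Rightarrow> bool" where
  "has_weak_grad u G \<longleftrightarrow>
     (\<forall>K. compact K \<longrightarrow> u absolutely_integrable_on K \<and> G absolutely_integrable_on K) \<and>
     (\<forall>\<psi>\<in>test_functions UNIV.
        (LINT x|lebesgue. u x *\<^sub>R grad \<psi> x) = - (LINT x|lebesgue. \<psi> x *\<^sub>R G x))"

text \<open>A weak gradient is unique only up to null sets; \<open>weak_grad u\<close> is one representative.\<close>

definition weak_grad :: "('a::euclidean_space \<Rightarrow> real) \<Rightarrow> 'a \<Rightarrow> 'a" where
  "weak_grad u = (SOME G. has_weak_grad u G)"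

text \<open>The kernel is \<open>t / 0 = 0\<close> on the diagonal, which is a null set.\<close>

definition gagliardo_sq :: "real \<Rightarrow> ('a::euclidean_space \<Rightarrow> real) \<Rightarrow> ennreal" where
  "gagliardo_sq s u =
     (\<integral>\<^sup>+ y. (\<integral>\<^sup>+ x. ennreal ((u x - u y)\<^sup>2 / norm (x - y) powr (real DIM('a) + 2 * s))
        \<partial>lebesgue) \<partial>lebesgue)"

text \<open>The square of the norm of \<open>\<X>\<^sup>1\<^sup>,\<^sup>2\<close> on test functions, where
  the gradient is the classical one.\<close>

definition X_norm_sq :: "real \<Rightarrow> ('a::euclidean_space \<Rightarrow> real) \<Rightarrow> ennreal" where
  "X_norm_sq s \<phi> = (\<integral>\<^sup>+ x. ennreal ((norm (grad \<phi> x))\<^sup>2) \<partial>lebesgue) + gagliardo_sq s \<phi>"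

text \<open>The completion of the test functions, realised as a space of functions: for bounded
  \<open>\<Omega>\<close>, a sequence of test functions that is Cauchy for the norm is Cauchy in
  \<open>L\<^sup>2\<close> (Poincare), and the element of the completion that it represents is
  identified with its \<open>L\<^sup>2\<close> limit. Such a limit vanishes almost everywhere outside
  \<open>\<Omega>\<close>.\<close>

definition X_space :: "real \<Rightarrow> 'a::euclidean_space set \<Rightarrow> ('a \<Rightarrow> real) set" where
  "X_space s \<Omega> =
     {u. u \<in> borel_measurable lebesgue \<and>
         (\<exists>\<phi>::nat \<Rightarrow> 'a \<Rightarrow> real.
            (\<forall>k. \<phi> k \<in> test_functions \<Omega>) \<and>
            (\<forall>\<epsilon>>0. \<exists>N. \<forall>j\<ge>N. \<forall>k\<ge>N. X_norm_sq s (\<lambda>x. \<phi> j x - \<phi> k x) < ennreal (\<epsilon>\<^sup>2)) \<and>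
            (\<lambda>k. \<integral>\<^sup>+ x. ennreal ((\<phi> k x - u x)\<^sup>2) \<partial>lebesgue) \<longlonglongrightarrow> 0)}"

definition B_form :: "real \<Rightarrow> ('a::euclidean_space \<Rightarrow> real) \<Rightarrow> ('a \<Rightarrow> real) \<Rightarrow> real" where
  "B_form s u v =
     (LINT x|lebesgue. weak_grad u x \<bullet> weak_grad v x) +
     (LINT y|lebesgue. LINT x|lebesgue.
        (u x - u y) * (v x - v y) / norm (x - y) powr (real DIM('a) + 2 * s))"

definition weak_solution ::
  "real \<Rightarrow> 'a::euclidean_space set \<Rightarrow> ('a \<Rightarrow> real) \<Rightarrow> ('a \<Rightarrow> real \<Rightarrow> real) \<Rightarrow> ('a \<Rightarrow> real) \<Rightarrow> bool" where
  "weak_solution s \<Omega> a f u \<longleftrightarrow>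
     u \<in> X_space s \<Omega> \<and>
     (\<forall>\<phi>\<in>X_space s \<Omega>.
        B_form s u \<phi> + (LINT x:\<Omega>|lebesgue. a x * u x * \<phi> x) =
        (LINT x:\<Omega>|lebesgue. f x (u x) * \<phi> x))"

text \<open>Only the values of \<open>f\<close> on \<open>closure \<Omega> \<times> \<real>\<close> matter.\<close>

definition caratheodory :: "'a::euclidean_space set \<Rightarrow> ('a \<Rightarrow> real \<Rightarrow> real) \<Rightarrow> bool" where
  "caratheodory \<Omega> f \<longleftrightarrow>
     (\<forall>t. (\<lambda>x. f x t) \<in> borel_measurable (lebesgue_on (closure \<Omega>))) \<and>
     (AE x in lebesgue_on (closure \<Omega>). continuous_on UNIV (f x))"

definition in_Lp :: "'a::euclidean_space set \<Rightarrow> real \<Rightarrow> ('a \<Rightarrow> real) \<Rightarrow> bool" where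
  "in_Lp \<Omega> p g \<longleftrightarrow>
     g \<in> borel_measurable (lebesgue_on \<Omega>) \<and> integrable (lebesgue_on \<Omega>) (\<lambda>x. \<bar>g x\<bar> powr p)"

definition Linf_norm :: "'a::euclidean_space set \<Rightarrow> ('a \<Rightarrow> real) \<Rightarrow> ennreal" where
  "Linf_norm \<Omega> g = esssup (lebesgue_on \<Omega>) (\<lambda>x. ennreal \<bar>g x\<bar>)"

definition in_Linf :: "'a::euclidean_space set \<Rightarrow> ('a \<Rightarrow> real) \<Rightarrow> bool" where
  "in_Linf \<Omega> g \<longleftrightarrow> g \<in> borel_measurable (lebesgue_on \<Omega>) \<and> Linf_norm \<Omega> g < \<infinity>"

definition two_star :: "nat \<Rightarrow> real" where
  "two_star n = 2 * real n / (real n - 2)"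

definition Linf_bound :: "'a::euclidean_space set \<Rightarrow> real \<Rightarrow> real \<Rightarrow> ('a \<Rightarrow> real) \<Rightarrow> bool" where
  "Linf_bound \<Omega> C \<beta> u \<longleftrightarrow>
     Linf_norm \<Omega> u \<le>
       ennreal (C * (1 + (LINT x:\<Omega>|lebesgue. \<bar>u x\<bar> powr (two_star DIM('a) * \<beta>)))
                      powr (1 / (two_star DIM('a) * (\<beta> - 1))))"

end

theory Submission
  imports Defs "HOL-Real_Asymp.Real_Asymp"
begin

text \<open>
  Moser iteration with the critical exponent \<open>p = 2n / (n - 2)\<close>. For \<open>\<epsilon> > 0\<close> and
  \<open>r \<ge> 0\<close> let \<open>H(t) = \<epsilon> + t\<^sup>2 / (1 + \<epsilon> t\<^sup>2)\<close>, a bounded smooth substitute for \<open>t\<^sup>2\<close>,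
  and test the equation with \<open>T(\<phi>)\<close>, where \<open>T(t) = t H(t)\<^sup>r\<close> and \<open>\<phi>\<close> runs through test
  functions that converge to \<open>u\<close> in \<open>\<X>\<^sup>1\<^sup>,\<^sup>2\<close>. Since \<open>T\<close> is smooth, increasing and Lipschitz,
  \<open>T(\<phi>)\<close> is again a test function, and the nonlocal form contributes at least
  \<open>- Lip(T) / 4\<close> times the squared seminorm of \<open>u - \<phi>\<close>, which tends to \<open>0\<close>. With
  \<open>\<Gamma>(t) = t H(t)\<^bsup>r/2\<^esup>\<close>, so that \<open>\<Gamma>'\<^sup>2 \<le> (r + 1) T'\<close> and \<open>\<Gamma>\<^sup>2 = t T\<close>, the Sobolev
  inequality gives
  \<open>\<parallel>\<Gamma>(u)\<parallel>\<^sub>p\<^sup>2 \<le> K (r + 1) \<integral> (1 + \<bar>u\<bar>\<^bsup>p-1\<^esup>) \<bar>T(u)\<bar>\<close>.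
  Absorbing the part of the right-hand side where \<open>\<bar>u\<bar>\<close> is large (Brezis--Kato) and letting
  \<open>\<epsilon>\<close> tend to \<open>0\<close> shows that all moments of \<open>u\<close> are finite; the same inequality then bounds
  \<open>\<integral> \<bar>u\<bar>\<^bsup>p(1 + \<kappa>r)\<^esup>\<close> by \<open>\<integral> \<bar>u\<bar>\<^bsup>p(1 + r)\<^esup>\<close> with \<open>\<kappa> = p / 2 > 1\<close>, and the iteration in \<open>r\<close>
  yields the bound on the essential supremum. Here \<open>1 + r\<close> is the paper's \<open>\<beta>\<close>.
\<close>

section \<open>Powers of extended nonnegative reals and the Hoelder inequality\<close>

text \<open>Two obstacles shape the argument. Truncated powers of \<open>u\<close> itself are
  awkward test functions: their membership in \<open>X_space\<close> and the chain rule for weak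
  gradients would have to be proved first. Testing with \<open>T(\<phi>)\<close> needs only the
  classical chain rule, at the price of two error terms, one for the gradients and one for the
  seminorm. Both carry a Lipschitz constant of \<open>T\<close> that depends on
  \<open>\<epsilon>\<close>; hence \<open>\<phi>\<close> tends to \<open>u\<close> first, with
  \<open>\<epsilon>\<close> and \<open>r\<close> fixed, and \<open>\<epsilon>\<close> tends to 0
  afterwards. The second obstacle is the critical growth: the level at which the absorption starts
  depends on the tail of \<open>u\<close>, so its bound must not enter the final constant. It serves
  only to know that the moments are finite; the iteration then runs with constants free of
  \<open>u\<close>. The fractional term is only estimated from below and its error vanishes, so
  \<open>s\<close> leaves no trace in the constants. The potential enters either through its sign,
  or as part of the growth term because \<open>\<bar>u\<bar>\<close> is at most
  \<open>1 + \<bar>u\<bar> powr (p - 1)\<close>.\<close>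

text \<open>Unlike \<open>powr\<close>, this power has \<open>epow 0 0 = 1\<close>: at the critical parameter of the
  grid-lines inequality the exponent of \<open>f\<close> is \<open>0\<close>, and the factor must not vanish where
  \<open>f\<close> does.\<close>

definition epow :: "ennreal \<Rightarrow> real \<Rightarrow> ennreal" where
  "epow x r = (if r = 0 then 1 else if x = top then top else ennreal (enn2real x powr r))"

lemma epow_0 [simp]: "epow x 0 = 1"
  by (simp add: epow_def)

lemma epow_1 [simp]: "epow x 1 = x"
  by (auto simp: epow_def less_top)

lemma epow_zero_base: "r \<noteq> 0 \<Longrightarrow> epow 0 r = 0"
  by (simp add: epow_def)

lemma epow_top: "r \<noteq> 0 \<Longrightarrow> epow top r = top"
  by (simp add: epow_def)

lemma epow_ennreal: "0 \<le> x \<Longrightarrow> r \<noteq> 0 \<Longrightarrow> epow (ennreal x) r = ennreal (x powr r)"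
  by (simp add: epow_def)

lemma epow_eq_0_iff: "epow x r = 0 \<longleftrightarrow> x = 0 \<and> r \<noteq> 0"
  by (cases x) (auto simp: epow_def)

lemma epow_measurable [measurable]:
  assumes [measurable]: "f \<in> borel_measurable M"
  shows "(\<lambda>x. epow (f x) r) \<in> borel_measurable M"
  unfolding epow_def by measurable

lemma epow_mono: "a \<le> b \<Longrightarrow> 0 \<le> r \<Longrightarrow> epow a r \<le> epow b r"
  by (cases a; cases b) (auto simp: epow_def powr_mono2 top_unique)

lemma epow_add: "0 \<le> r \<Longrightarrow> 0 \<le> t \<Longrightarrow> epow a (r + t) = epow a r * epow a t"
  by (cases a) (auto simp: epow_def powr_add ennreal_mult'[symmetric] ennreal_top_mult)

lemma epow_epow: "epow (epow a r) t = epow a (r * t)"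
  by (cases a) (auto simp: epow_def powr_powr)

text \<open>Jensen's inequality for \<open>exp\<close> at the points \<open>ln (a j)\<close>. A
  vanishing \<open>a j\<close> is split off because the product is then \<open>0\<close> and the
  logarithm carries no information.\<close>

lemma weighted_AM_GM:
  fixes w a :: "'j \<Rightarrow> real"
  assumes "finite J" and w: "\<And>j. j \<in> J \<Longrightarrow> 0 < w j" and "sum w J = 1"
    and a: "\<And>j. j \<in> J \<Longrightarrow> 0 \<le> a j"
  shows "(\<Prod>j\<in>J. a j powr w j) \<le> (\<Sum>j\<in>J. w j * a j)"
proof (cases "\<exists>j\<in>J. a j = 0")
  case True
  then have "(\<Prod>j\<in>J. a j powr w j) = 0"
    using assms(1) by (auto intro!: prod_zero)
  moreover have "0 \<le> (\<Sum>j\<in>J. w j * a j)"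
    using w a by (intro sum_nonneg mult_nonneg_nonneg) (auto simp: less_imp_le)
  ultimately show ?thesis by simp
next
  case False
  then have pos: "0 < a j" if "j \<in> J" for j
    using a that by (metis less_eq_real_def)
  have "(\<Prod>j\<in>J. a j powr w j) = exp (\<Sum>j\<in>J. w j *\<^sub>R ln (a j))"
    using assms(1) less_imp_neq[OF pos] by (subst exp_sum) (force intro!: prod.cong simp: powr_def)+
  also have "\<dots> \<le> (\<Sum>j\<in>J. w j * exp (ln (a j)))"
  proof -
    have "J \<noteq> {}" using assms(3) by auto
    moreover have "convex_on UNIV (exp :: real \<Rightarrow> real)"
      by (rule exp_convex)
    ultimately show ?thesis
      using assms(1,3) w by (intro convex_on_sum) (auto simp: less_imp_le)
  qed
  also have "\<dots> = (\<Sum>j\<in>J. w j * a j)"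
    using pos by (intro sum.cong) auto
  finally show ?thesis .
qed

lemma prod_ennreal_eq_top:
  fixes f :: "'j \<Rightarrow> ennreal"
  assumes "finite J" "j \<in> J" "f j = top" "\<And>i. i \<in> J \<Longrightarrow> f i \<noteq> 0"
  shows "prod f J = top"
proof -
  have "prod f (J - {j}) \<noteq> 0"
    using assms by auto
  then show ?thesis
    using assms by (simp add: prod.remove ennreal_top_mult)
qed

text \<open>After division by its integral every \<open>g j\<close> has integral 1, and weighted
  AM-GM bounds the product by a combination whose weights sum to 1. Zero integrals are treated
  before infinite ones, because \<open>0 * top = 0\<close> on the right-hand side.\<close>

lemma nn_integral_Hoelder_pos:
  fixes w :: "'j \<Rightarrow> real" and g :: "'j \<Rightarrow> 'a \<Rightarrow> ennreal"
  assumes "finite J" and w: "\<And>j. j \<in> J \<Longrightarrow> 0 < w j" and "sum w J = 1"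
    and g [measurable]: "\<And>j. j \<in> J \<Longrightarrow> g j \<in> borel_measurable M"
  shows "(\<integral>\<^sup>+x. (\<Prod>j\<in>J. epow (g j x) (w j)) \<partial>M) \<le> (\<Prod>j\<in>J. epow (\<integral>\<^sup>+x. g j x \<partial>M) (w j))"
proof -
  define A where "A j = (\<integral>\<^sup>+x. g j x \<partial>M)" for j
  consider (zero) j where "j \<in> J" "A j = 0"
    | (top) j where "j \<in> J" "A j = top" "\<And>i. i \<in> J \<Longrightarrow> A i \<noteq> 0"
    | (fin) "\<And>j. j \<in> J \<Longrightarrow> A j \<noteq> 0 \<and> A j \<noteq> top"
    by blast
  then have "(\<integral>\<^sup>+x. (\<Prod>j\<in>J. epow (g j x) (w j)) \<partial>M) \<le> (\<Prod>j\<in>J. epow (A j) (w j))"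
  proof cases
    case zero
    then have "AE x in M. g j x = 0"
      unfolding A_def by (subst (asm) nn_integral_0_iff_AE) auto
    then have "AE x in M. (\<Prod>j\<in>J. epow (g j x) (w j)) = 0"
    proof (rule AE_mp, intro AE_I2 impI)
      fix x assume "g j x = 0"
      then show "(\<Prod>j\<in>J. epow (g j x) (w j)) = 0"
        using zero(1) w[OF zero(1)] assms(1) by (intro prod_zero) (auto simp: epow_eq_0_iff intro!: bexI[of _ j])
    qed
    then have "(\<integral>\<^sup>+x. (\<Prod>j\<in>J. epow (g j x) (w j)) \<partial>M) = (\<integral>\<^sup>+x. 0 \<partial>M)"
      by (rule nn_integral_cong_AE)
    then show ?thesis by simp
  next
    case top
    then have "(\<Prod>j\<in>J. epow (A j) (w j)) = top"
      using w assms(1) by (intro prod_ennreal_eq_top[of J j]) (auto simp: epow_eq_0_iff epow_top less_imp_neq[THEN not_sym])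
    then show ?thesis by simp
  next
    case fin
    define c where "c j = enn2real (A j)" for j
    have c: "0 < c j" "A j = ennreal (c j)" if "j \<in> J" for j
      using fin[OF that] unfolding c_def
      by (auto simp: enn2real_positive_iff less_top zero_less_iff_neq_zero)
    have "AE x in M. \<forall>j\<in>J. g j x \<noteq> \<infinity>"
    proof (rule AE_finite_allI[OF assms(1)])
      fix j assume "j \<in> J"
      with fin[of j] g[of j] show "AE x in M. g j x \<noteq> \<infinity>"
        by (intro nn_integral_noteq_infinite) (auto simp: A_def)
    qed
    then have "(\<integral>\<^sup>+x. (\<Prod>j\<in>J. epow (g j x) (w j)) \<partial>M)
      \<le> (\<integral>\<^sup>+x. (\<Prod>j\<in>J. epow (A j) (w j)) * (\<Sum>j\<in>J. ennreal (w j / c j) * g j x) \<partial>M)"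
    proof (intro nn_integral_mono_AE, elim eventually_mono)
      fix x assume fi: "\<forall>j\<in>J. g j x \<noteq> \<infinity>"
      define r where "r j = enn2real (g j x)" for j
      have r: "0 \<le> r j" "g j x = ennreal (r j)" if "j \<in> J" for j
        using fi that unfolding r_def by (auto simp: less_top)
      have "(\<Prod>j\<in>J. r j powr w j) = (\<Prod>j\<in>J. c j powr w j * (r j / c j) powr w j)"
        using c r by (intro prod.cong refl) (auto simp: powr_divide less_imp_le less_imp_neq[THEN not_sym])
      also have "\<dots> = (\<Prod>j\<in>J. c j powr w j) * (\<Prod>j\<in>J. (r j / c j) powr w j)"
        by (rule prod.distrib)
      also have "\<dots> \<le> (\<Prod>j\<in>J. c j powr w j) * (\<Sum>j\<in>J. w j * (r j / c j))"
        using assms(1,3) w c(1) r(1)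
        by (intro mult_left_mono weighted_AM_GM prod_nonneg) (auto simp: less_imp_le)
      finally have *: "(\<Prod>j\<in>J. r j powr w j) \<le> (\<Prod>j\<in>J. c j powr w j) * (\<Sum>j\<in>J. w j / c j * r j)"
        by simp
      have "(\<Prod>j\<in>J. epow (g j x) (w j)) = ennreal (\<Prod>j\<in>J. r j powr w j)"
        using r w by (subst prod_ennreal[symmetric]) (auto intro!: prod.cong simp: epow_ennreal less_imp_neq[THEN not_sym])
      also have "\<dots> \<le> ennreal ((\<Prod>j\<in>J. c j powr w j) * (\<Sum>j\<in>J. w j / c j * r j))"
        by (rule ennreal_leI[OF *])
      also have "\<dots> = ennreal (\<Prod>j\<in>J. c j powr w j) * ennreal (\<Sum>j\<in>J. w j / c j * r j)"
        by (intro ennreal_mult' prod_nonneg) auto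
      also have "ennreal (\<Prod>j\<in>J. c j powr w j) = (\<Prod>j\<in>J. epow (A j) (w j))"
        using c w by (subst prod_ennreal[symmetric]) (auto intro!: prod.cong simp: epow_ennreal less_imp_le less_imp_neq[THEN not_sym])
      also have "ennreal (\<Sum>j\<in>J. w j / c j * r j) = (\<Sum>j\<in>J. ennreal (w j / c j * r j))"
        using c(1) w r(1) by (intro sum_ennreal[symmetric]) (auto simp: less_imp_le)
      also have "\<dots> = (\<Sum>j\<in>J. ennreal (w j / c j) * g j x)"
        by (intro sum.cong refl) (simp add: r ennreal_mult''[OF r(1), symmetric])
      finally show "(\<Prod>j\<in>J. epow (g j x) (w j)) \<le> (\<Prod>j\<in>J. epow (A j) (w j)) * (\<Sum>j\<in>J. ennreal (w j / c j) * g j x)" .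
    qed
    also have "\<dots> = (\<Prod>j\<in>J. epow (A j) (w j)) * (\<Sum>j\<in>J. ennreal (w j / c j) * A j)"
      using g by (simp add: nn_integral_cmult nn_integral_sum A_def)
    also have "(\<Sum>j\<in>J. ennreal (w j / c j) * A j) = (\<Sum>j\<in>J. ennreal (w j))"
    proof (intro sum.cong refl)
      fix j assume "j \<in> J"
      then show "ennreal (w j / c j) * A j = ennreal (w j)"
        using c[of j] w[of j] by (simp add: ennreal_mult[symmetric])
    qed
    also have "\<dots> = 1"
      using w assms(3) by (subst sum_ennreal) (auto simp: less_imp_le)
    finally show ?thesis by simp
  qed
  then show ?thesis by (simp add: A_def)
qed

text \<open>A factor of weight 0 equals \<open>1\<close> on both sides, whatever its integral is,
  and drops out. This occurs at the critical parameter of \<open>grid_lines\<close>.\<close>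

lemma nn_integral_Hoelder:
  fixes w :: "'j \<Rightarrow> real" and g :: "'j \<Rightarrow> 'a \<Rightarrow> ennreal"
  assumes "finite J" and w: "\<And>j. j \<in> J \<Longrightarrow> 0 \<le> w j" and "sum w J = 1"
    and g: "\<And>j. j \<in> J \<Longrightarrow> g j \<in> borel_measurable M"
  shows "(\<integral>\<^sup>+x. (\<Prod>j\<in>J. epow (g j x) (w j)) \<partial>M) \<le> (\<Prod>j\<in>J. epow (\<integral>\<^sup>+x. g j x \<partial>M) (w j))"
proof -
  define I where "I = {j \<in> J. 0 < w j}"
  have I: "finite I" "I \<subseteq> J" "\<And>j. j \<in> J - I \<Longrightarrow> w j = 0"
    using assms(1) w by (auto simp: I_def intro: antisym simp: not_less)
  have red: "(\<Prod>j\<in>J. epow (h j) (w j)) = (\<Prod>j\<in>I. epow (h j) (w j))" for h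
    using assms(1) I by (intro prod.mono_neutral_right) auto
  have "sum w J = sum w I"
    using assms(1) I by (intro sum.mono_neutral_right) auto
  with assms(3) have "sum w I = 1" by simp
  then show ?thesis
    unfolding red using I(1,2) g by (intro nn_integral_Hoelder_pos) (auto simp: I_def)
qed

section \<open>The grid-lines inequality\<close>

text \<open>Loomis--Whitney in the form used for Gagliardo--Nirenberg: the coordinates are integrated out
  one at a time, each by one application of the Hoelder inequality, with \<open>f\<close> replaced by its
  marginal. The choice \<open>p = 1 / (n - 1)\<close> makes the first exponent vanish.\<close>

lemma grid_lines:
  fixes f :: "('i \<Rightarrow> real) \<Rightarrow> ennreal" and p :: real
  assumes "finite I" and p: "0 \<le> p" "(real (card I) - 1) * p \<le> 1"
    and "f \<in> borel_measurable (PiM I (\<lambda>_. lborel))"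
  shows "(\<integral>\<^sup>+x. epow (f x) (1 - (real (card I) - 1) * p) *
            (\<Prod>i\<in>I. epow (\<integral>\<^sup>+z. f (x(i := z)) \<partial>lborel) p) \<partial>PiM I (\<lambda>_. lborel))
         \<le> epow (\<integral>\<^sup>+x. f x \<partial>PiM I (\<lambda>_. lborel)) (1 + p)"
  using assms(1) p(2) assms(4)
proof (induction I arbitrary: f rule: finite_induct)
  case empty
  interpret product_sigma_finite "\<lambda>_::'i. lborel :: real measure" ..
  show ?case by (simp add: nn_integral_empty)
next
  case (insert j I)
  interpret product_sigma_finite "\<lambda>_::'i. lborel :: real measure" ..
  note [measurable] = insert.prems(2)
  define m where "m = real (card I)"
  have mp: "m * p \<le> 1" "(m - 1) * p \<le> 1"
    using insert p(1) by (auto simp: m_def algebra_simps)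
  have upd: "(\<lambda>(x, z). x(i := z)) \<in> measurable (PiM (insert j I) (\<lambda>_. lborel) \<Otimes>\<^sub>M lborel) (PiM (insert j I) (\<lambda>_. lborel :: real measure))"
    if "i \<in> insert j I" for i
  proof -
    have "insert i (insert j I) = insert j I" using that by auto
    with measurable_add_dim[of i "insert j I" "\<lambda>_. lborel :: real measure"] show ?thesis by simp
  qed
  have updj: "(\<lambda>(x, z). x(j := z)) \<in> measurable (PiM I (\<lambda>_. lborel) \<Otimes>\<^sub>M lborel) (PiM (insert j I) (\<lambda>_. lborel :: real measure))"
    using measurable_add_dim[of j I "\<lambda>_. lborel :: real measure"] by simp
  have updI: "(\<lambda>(x, z). x(i := z)) \<in> measurable (PiM I (\<lambda>_. lborel) \<Otimes>\<^sub>M lborel) (PiM I (\<lambda>_. lborel :: real measure))"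
    if "i \<in> I" for i
  proof -
    have "insert i I = I" using that by auto
    with measurable_add_dim[of i I "\<lambda>_. lborel :: real measure"] show ?thesis by simp
  qed
  have fj: "(\<lambda>(x, z). f (x(j := z))) \<in> borel_measurable (PiM I (\<lambda>_. lborel) \<Otimes>\<^sub>M lborel)"
    using measurable_compose[OF updj insert.prems(2)] by (simp add: case_prod_beta' fun_upd_def)
  have fi: "(\<lambda>(x, z). f (x(i := z))) \<in> borel_measurable (PiM (insert j I) (\<lambda>_. lborel) \<Otimes>\<^sub>M lborel)"
    if "i \<in> insert j I" for i
    using measurable_compose[OF upd[OF that] insert.prems(2)] by (simp add: case_prod_beta' fun_upd_def)
  define H where "H x = (\<integral>\<^sup>+z. f (x(j := z)) \<partial>lborel)" for x
  have H [measurable]: "H \<in> borel_measurable (PiM I (\<lambda>_. lborel))"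
    unfolding H_def using lborel.borel_measurable_nn_integral[OF fj] by simp
  have Gi: "(\<lambda>x. \<integral>\<^sup>+z. f (x(i := z)) \<partial>lborel) \<in> borel_measurable (PiM (insert j I) (\<lambda>_. lborel))"
    if "i \<in> insert j I" for i
    using lborel.borel_measurable_nn_integral[OF fi[OF that]] by simp
  have fx: "(\<lambda>y. f (x(j := y))) \<in> borel_measurable lborel" if "x \<in> space (PiM I (\<lambda>_. lborel :: real measure))" for x
    using measurable_compose[OF measurable_Pair1' fj[unfolded measurable_lborel2], of x] that by simp
  have fxi: "(\<lambda>(y, z). f (x(j := y, i := z))) \<in> borel_measurable (lborel \<Otimes>\<^sub>M lborel)"
    if "x \<in> space (PiM I (\<lambda>_. lborel :: real measure))" "i \<in> I" for x i
  proof -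
    have "(\<lambda>w. (x(j := fst w), snd w)) \<in> measurable (lborel \<Otimes>\<^sub>M lborel) (PiM (insert j I) (\<lambda>_. lborel) \<Otimes>\<^sub>M (lborel :: real measure))"
    proof (rule measurable_Pair)
      have "(\<lambda>y. x(j := y)) \<in> measurable lborel (PiM (insert j I) (\<lambda>_. lborel :: real measure))"
        using measurable_compose[OF measurable_Pair1'[OF that(1)] updj] by simp
      then show "(\<lambda>w. x(j := fst w)) \<in> measurable (lborel \<Otimes>\<^sub>M lborel) (PiM (insert j I) (\<lambda>_. lborel :: real measure))"
        by (rule measurable_compose[OF measurable_fst])
    qed simp
    from measurable_compose[OF this fi[OF insertI2[OF that(2)]]] show ?thesis
      by (simp only: case_prod_beta' fst_conv snd_conv)
  qed
  have card: "real (card (insert j I)) - 1 = m"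
    using insert.hyps by (simp add: m_def)
  have ne: "i \<noteq> j" if "i \<in> I" for i using insert.hyps that by auto
  \<comment> \<open>For fixed \<open>x\<close> the factor of direction \<open>j\<close> does not
    depend on \<open>y\<close> and comes out as \<open>epow (H x) p\<close>. The remaining weights,
    \<open>1 - m * p\<close> for \<open>f\<close> and \<open>p\<close> for each of the
    \<open>m\<close> other directions, sum to 1, so Hoelder applies. Collecting powers of
    \<open>H x\<close> gives the exponent \<open>p + (1 - m * p) = 1 - (m - 1) * p\<close>, the one
    that the induction hypothesis expects for the marginal.\<close>
  have inner: "(\<integral>\<^sup>+y. epow (f (x(j := y))) (1 - m * p) *
            (\<Prod>i\<in>insert j I. epow (\<integral>\<^sup>+z. f (x(j := y, i := z)) \<partial>lborel) p) \<partial>lborel)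
       \<le> epow (H x) (1 - (m - 1) * p) * (\<Prod>i\<in>I. epow (\<integral>\<^sup>+z. H (x(i := z)) \<partial>lborel) p)"
    (is "?L \<le> _") if x: "x \<in> space (PiM I (\<lambda>_. lborel :: real measure))" for x
  proof -
    define g where "g i y = (if i = j then f (x(j := y)) else \<integral>\<^sup>+z. f (x(j := y, i := z)) \<partial>lborel)" for i y
    define w where "w i = (if i = j then 1 - m * p else p)" for i
    have gm: "g i \<in> borel_measurable lborel" if "i \<in> insert j I" for i
    proof (cases "i = j")
      case True
      then show ?thesis using fx[OF x] by (simp add: g_def[abs_def])
    next
      case False
      then have "i \<in> I" using that by auto
      from lborel.borel_measurable_nn_integral[OF fxi[OF x this]] False show ?thesis
        by (simp add: g_def[abs_def])
    qed
    have prj: "(\<Prod>i\<in>insert j I. epow (h i) (w i)) = epow (h j) (1 - m * p) * (\<Prod>i\<in>I. epow (h i) p)" for h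
      using insert.hyps ne by (auto simp: w_def intro!: arg_cong2[where f="(*)"] prod.cong)
    have "?L = (\<integral>\<^sup>+y. epow (H x) p * (\<Prod>i\<in>insert j I. epow (g i y) (w i)) \<partial>lborel)"
    proof (rule nn_integral_cong)
      fix y
      have "(\<Prod>i\<in>I. epow (g i y) p) = (\<Prod>i\<in>I. epow (\<integral>\<^sup>+z. f (x(j := y, i := z)) \<partial>lborel) p)"
        using ne by (intro prod.cong) (auto simp: g_def)
      then show "epow (f (x(j := y))) (1 - m * p) * (\<Prod>i\<in>insert j I. epow (\<integral>\<^sup>+z. f (x(j := y, i := z)) \<partial>lborel) p)
         = epow (H x) p * (\<Prod>i\<in>insert j I. epow (g i y) (w i))"
        unfolding prj using insert.hyps by (simp add: H_def g_def ac_simps)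
    qed
    also have "\<dots> = epow (H x) p * (\<integral>\<^sup>+y. (\<Prod>i\<in>insert j I. epow (g i y) (w i)) \<partial>lborel)"
      using gm by (intro nn_integral_cmult borel_measurable_prod_ennreal epow_measurable) auto
    also have "\<dots> \<le> epow (H x) p * (\<Prod>i\<in>insert j I. epow (\<integral>\<^sup>+y. g i y \<partial>lborel) (w i))"
    proof (intro mult_left_mono nn_integral_Hoelder gm)
      have "sum w (insert j I) = (1 - m * p) + (\<Sum>i\<in>I. p)"
        using insert.hyps ne by (auto simp: w_def intro!: arg_cong2[where f="(+)"] sum.cong)
      then show "sum w (insert j I) = 1" by (simp add: m_def)
    qed (use insert.hyps mp p in \<open>auto simp: w_def\<close>)
    also have "\<dots> = epow (H x) p * (epow (H x) (1 - m * p) * (\<Prod>i\<in>I. epow (\<integral>\<^sup>+y. g i y \<partial>lborel) p))"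
    proof -
      have "(\<integral>\<^sup>+y. g j y \<partial>lborel) = H x" by (simp add: g_def H_def)
      then show ?thesis unfolding prj by simp
    qed
    also have "(\<Prod>i\<in>I. epow (\<integral>\<^sup>+y. g i y \<partial>lborel) p) = (\<Prod>i\<in>I. epow (\<integral>\<^sup>+z. H (x(i := z)) \<partial>lborel) p)"
    proof (intro prod.cong refl arg_cong2[where f=epow])
      fix i assume i: "i \<in> I"
      have "(\<integral>\<^sup>+y. g i y \<partial>lborel) = (\<integral>\<^sup>+y. \<integral>\<^sup>+z. f (x(j := y, i := z)) \<partial>lborel \<partial>lborel)"
        using ne[OF i] by (simp add: g_def)
      also have "\<dots> = (\<integral>\<^sup>+z. \<integral>\<^sup>+y. f (x(j := y, i := z)) \<partial>lborel \<partial>lborel)"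
        using fxi[OF x i] by (rule lborel_pair.Fubini'[symmetric])
      also have "\<dots> = (\<integral>\<^sup>+z. H (x(i := z)) \<partial>lborel)"
        unfolding H_def using ne[OF i] by (simp add: fun_upd_twist)
      finally show "(\<integral>\<^sup>+y. g i y \<partial>lborel) = (\<integral>\<^sup>+z. H (x(i := z)) \<partial>lborel)" .
    qed
    also have "epow (H x) p * (epow (H x) (1 - m * p) * (\<Prod>i\<in>I. epow (\<integral>\<^sup>+z. H (x(i := z)) \<partial>lborel) p))
       = epow (H x) (p + (1 - m * p)) * (\<Prod>i\<in>I. epow (\<integral>\<^sup>+z. H (x(i := z)) \<partial>lborel) p)"
      using mp p by (subst epow_add) (auto simp: ac_simps)
    also have "p + (1 - m * p) = 1 - (m - 1) * p"
      by (simp add: algebra_simps)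
    finally show ?thesis .
  qed
  have "(\<integral>\<^sup>+x. epow (f x) (1 - m * p) *
            (\<Prod>i\<in>insert j I. epow (\<integral>\<^sup>+z. f (x(i := z)) \<partial>lborel) p) \<partial>PiM (insert j I) (\<lambda>_. lborel))
     = (\<integral>\<^sup>+x. (\<integral>\<^sup>+y. epow (f (x(j := y))) (1 - m * p) *
            (\<Prod>i\<in>insert j I. epow (\<integral>\<^sup>+z. f (x(j := y, i := z)) \<partial>lborel) p) \<partial>lborel) \<partial>PiM I (\<lambda>_. lborel))"
    using insert.hyps insert.prems(2) Gi
    by (intro product_nn_integral_insert borel_measurable_times epow_measurable borel_measurable_prod_ennreal) auto
  also have "\<dots> \<le> (\<integral>\<^sup>+x. epow (H x) (1 - (m - 1) * p) * (\<Prod>i\<in>I. epow (\<integral>\<^sup>+z. H (x(i := z)) \<partial>lborel) p) \<partial>PiM I (\<lambda>_. lborel))"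
    by (intro nn_integral_mono inner)
  also have "\<dots> \<le> epow (\<integral>\<^sup>+x. H x \<partial>PiM I (\<lambda>_. lborel)) (1 + p)"
    unfolding m_def using mp(2) by (intro insert.IH H) (auto simp: m_def)
  also have "(\<integral>\<^sup>+x. H x \<partial>PiM I (\<lambda>_. lborel)) = (\<integral>\<^sup>+x. f x \<partial>PiM (insert j I) (\<lambda>_. lborel))"
    unfolding H_def using insert.hyps by (intro product_nn_integral_insert[symmetric] insert.prems(2)) auto
  finally show ?case unfolding card .
qed

section \<open>Calculus of test functions\<close>

lemma C_k_SucI:
  assumes "\<And>x. (\<phi> has_derivative D x) (at x)" and "\<And>b. b \<in> Basis \<Longrightarrow> C_k k (\<lambda>x. D x b)"
  shows "C_k (Suc k) \<phi>"
proof -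
  have "frechet_derivative \<phi> (at x) = D x" for x
    using frechet_derivative_at[OF assms(1)] by simp
  then show ?thesis
    using assms by (auto simp: differentiable_def)
qed

lemma C_k_has_derivative:
  "C_k (Suc k) \<phi> \<Longrightarrow> (\<phi> has_derivative frechet_derivative \<phi> (at x)) (at x)"
  by (simp add: frechet_derivative_works[symmetric])

lemma C_k_SucD: "C_k (Suc k) \<phi> \<Longrightarrow> C_k k \<phi>"
proof (induction k arbitrary: \<phi>)
  case 0
  then show ?case
    by (auto intro!: continuous_at_imp_continuous_on differentiable_imp_continuous_within)
next
  case (Suc k)
  then show ?case by (metis C_k.simps(2))
qed

lemma C_k_const: "C_k k (\<lambda>x. c)"
proof (induction k arbitrary: c)
  case 0 then show ?case by simp
next
  case (Suc k)
  show ?case by (rule C_k_SucI[where D="\<lambda>_ _. 0"]) (auto intro: Suc)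
qed

lemma C_k_inner: "C_k k (\<lambda>x. x \<bullet> b)"
proof (cases k)
  case 0 then show ?thesis by (auto intro!: continuous_intros)
next
  case (Suc m)
  show ?thesis unfolding Suc
    by (rule C_k_SucI[where D="\<lambda>_ h. h \<bullet> b"]) (auto intro!: derivative_eq_intros C_k_const)
qed

lemma C_k_add: "C_k k \<phi> \<Longrightarrow> C_k k \<psi> \<Longrightarrow> C_k k (\<lambda>x. \<phi> x + \<psi> x)"
proof (induction k arbitrary: \<phi> \<psi>)
  case 0 then show ?case by (auto intro!: continuous_intros)
next
  case (Suc k)
  show ?case
    by (rule C_k_SucI[where D="\<lambda>x h. frechet_derivative \<phi> (at x) h + frechet_derivative \<psi> (at x) h"])
       (use Suc in \<open>auto intro!: has_derivative_add C_k_has_derivative\<close>)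
qed

lemma C_k_mult: "C_k k \<phi> \<Longrightarrow> C_k k \<psi> \<Longrightarrow> C_k k (\<lambda>x. \<phi> x * \<psi> x)"
proof (induction k arbitrary: \<phi> \<psi>)
  case 0 then show ?case by (auto intro!: continuous_intros)
next
  case (Suc k)
  show ?case
    by (rule C_k_SucI[where D="\<lambda>x h. \<phi> x * frechet_derivative \<psi> (at x) h + frechet_derivative \<phi> (at x) h * \<psi> x"])
       (use Suc C_k_SucD in \<open>auto intro!: has_derivative_mult C_k_has_derivative C_k_add Suc.IH\<close>)
qed

lemma C_k_diff: "C_k k \<phi> \<Longrightarrow> C_k k \<psi> \<Longrightarrow> C_k k (\<lambda>x. \<phi> x - \<psi> x)"
  using C_k_add[OF _ C_k_mult[OF C_k_const[of k "-1"]], of \<phi> \<psi>] by simp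

lemma C_k_prod:
  "(\<And>i. i \<in> I \<Longrightarrow> C_k k (f i)) \<Longrightarrow> C_k k (\<lambda>x. \<Prod>i\<in>I. f i x)"
  by (induction I rule: infinite_finite_induct) (auto intro!: C_k_const C_k_mult)

lemma real_frechet_derivative:
  assumes "(g :: real \<Rightarrow> real) differentiable (at t)"
  shows "(g has_real_derivative frechet_derivative g (at t) 1) (at t)"
proof -
  have d: "(g has_derivative frechet_derivative g (at t)) (at t)"
    using assms by (simp add: frechet_derivative_works)
  have "frechet_derivative g (at t) = (*) (frechet_derivative g (at t) 1)"
  proof
    fix h
    have "frechet_derivative g (at t) h = frechet_derivative g (at t) (h *\<^sub>R 1)" by simp
    also have "\<dots> = h *\<^sub>R frechet_derivative g (at t) 1"
      by (rule linear.scaleR[OF has_derivative_linear[OF d]])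
    finally show "frechet_derivative g (at t) h = frechet_derivative g (at t) 1 * h" by simp
  qed
  then show ?thesis
    using d by (simp add: has_field_derivative_def)
qed

lemma C_k_deriv:
  fixes g :: "real \<Rightarrow> real"
  assumes "\<And>t. (g has_real_derivative g' t) (at t)"
  shows "C_k (Suc k) g \<longleftrightarrow> C_k k g'"
proof -
  have "frechet_derivative g (at t) = (*) (g' t)" for t
    using frechet_derivative_at[of g _ t] assms[of t] by (simp add: has_field_derivative_def)
  moreover have "g differentiable (at t)" for t
    using assms[of t] by (auto simp: differentiable_def has_field_derivative_def)
  ultimately show ?thesis by simp
qed

text \<open>The induction generalises \<open>g\<close> alone: differentiating brings in
  \<open>g'\<close> at the same inner function, and the derivative of \<open>\<phi>\<close> is a
  separate factor.\<close>

lemma C_k_compose: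
  fixes g :: "real \<Rightarrow> real"
  shows "C_k k g \<Longrightarrow> C_k k \<phi> \<Longrightarrow> C_k k (\<lambda>x. g (\<phi> x))"
proof (induction k arbitrary: g)
  case 0 then show ?case by (auto intro: continuous_on_compose2)
next
  case (Suc k)
  define g' where "g' t = frechet_derivative g (at t) 1" for t
  have g': "(g has_real_derivative g' t) (at t)" for t
    unfolding g'_def using Suc.prems(1) by (intro real_frechet_derivative) simp
  then have "C_k k g'"
    using Suc.prems(1) C_k_deriv by blast
  show ?case
  proof (rule C_k_SucI[where D="\<lambda>x h. g' (\<phi> x) * frechet_derivative \<phi> (at x) h"])
    fix x show "((\<lambda>x. g (\<phi> x)) has_derivative (\<lambda>h. g' (\<phi> x) * frechet_derivative \<phi> (at x) h)) (at x)"
      using has_derivative_compose[OF C_k_has_derivative[OF Suc.prems(2)] g'[unfolded has_field_derivative_def]]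
      by simp
  next
    fix b :: 'a assume "b \<in> Basis"
    then show "C_k k (\<lambda>x. g' (\<phi> x) * frechet_derivative \<phi> (at x) b)"
      using Suc \<open>C_k k g'\<close> C_k_SucD by (intro C_k_mult) auto
  qed
qed

text \<open>Not an instance of \<open>C_k_compose\<close>, since real powers are smooth on the
  positive half-line only. The exponent stays general because differentiation lowers it by
  1.\<close>

lemma C_k_powr:
  assumes "C_k k F" and pos: "\<And>x. 0 < F x"
  shows "C_k k (\<lambda>x. F x powr r)"
  using assms(1)
proof (induction k arbitrary: r)
  case 0 then show ?case using pos by (auto intro!: continuous_intros simp: less_imp_neq[THEN not_sym])
next
  case (Suc k)
  show ?case
  proof (rule C_k_SucI[where D="\<lambda>x h. (r * F x powr (r - 1)) * frechet_derivative F (at x) h"])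
    fix x
    have "((\<lambda>t. t powr r) has_real_derivative r * F x powr (r - 1)) (at (F x))"
      using pos by (rule has_real_derivative_powr)
    from has_derivative_compose[OF C_k_has_derivative[OF Suc.prems] this[unfolded has_field_derivative_def]]
    show "((\<lambda>x. F x powr r) has_derivative (\<lambda>h. (r * F x powr (r - 1)) * frechet_derivative F (at x) h)) (at x)"
      by simp
  next
    fix b :: 'a assume "b \<in> Basis"
    then show "C_k k (\<lambda>x. (r * F x powr (r - 1)) * frechet_derivative F (at x) b)"
      using Suc C_k_SucD by (intro C_k_mult C_k_const) auto
  qed
qed

section \<open>Classical gradients and closure properties of test functions\<close>

lemma grad_eqI:
  assumes "GDERIV \<phi> x :> D"
  shows "grad \<phi> x = D"
proof -
  have "E = D" if "GDERIV \<phi> x :> E" for E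
  proof -
    have "(\<lambda>h. h \<bullet> E) = (\<lambda>h. h \<bullet> D)"
      using assms that unfolding gderiv_def by (intro has_derivative_unique)
    then have "(E - D) \<bullet> E = (E - D) \<bullet> D" by metis
    then have "(E - D) \<bullet> (E - D) = 0" by (simp add: inner_diff_right)
    then show ?thesis by simp
  qed
  with assms show ?thesis unfolding grad_def by (rule the_equality)
qed

lemma C_k_GDERIV:
  assumes "C_k (Suc k) \<phi>"
  shows "GDERIV \<phi> x :> grad \<phi> x"
    and "grad \<phi> x = (\<Sum>b\<in>Basis. frechet_derivative \<phi> (at x) b *\<^sub>R b)"
proof -
  let ?D = "\<Sum>b\<in>Basis. frechet_derivative \<phi> (at x) b *\<^sub>R b"
  have d: "(\<phi> has_derivative frechet_derivative \<phi> (at x)) (at x)"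
    using assms by (rule C_k_has_derivative)
  have "frechet_derivative \<phi> (at x) h = h \<bullet> ?D" for h
  proof -
    have "frechet_derivative \<phi> (at x) h = frechet_derivative \<phi> (at x) (\<Sum>b\<in>Basis. (h \<bullet> b) *\<^sub>R b)"
      by (simp add: euclidean_representation)
    also have "\<dots> = (\<Sum>b\<in>Basis. (h \<bullet> b) * frechet_derivative \<phi> (at x) b)"
      using has_derivative_linear[OF d] by (simp add: linear_sum linear.scaleR)
    also have "\<dots> = h \<bullet> ?D"
      by (simp add: inner_sum_right mult.commute)
    finally show ?thesis .
  qed
  then have "frechet_derivative \<phi> (at x) = (\<lambda>h. h \<bullet> ?D)" by (rule ext)
  with d have *: "GDERIV \<phi> x :> ?D" unfolding gderiv_def by metis
  then show "grad \<phi> x = ?D" by (rule grad_eqI)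
  with * show "GDERIV \<phi> x :> grad \<phi> x" by simp
qed

lemma continuous_on_grad:
  assumes "C_k (Suc k) \<phi>"
  shows "continuous_on UNIV (grad \<phi>)"
proof -
  have "C_k (Suc 0) \<phi>"
    using assms by (induction k) (simp, metis C_k_SucD)
  then show ?thesis
    unfolding C_k_GDERIV(2)[OF assms, abs_def] by (auto intro!: continuous_intros)
qed

lemma
  assumes "\<phi> \<in> test_functions \<Omega>"
  shows test_C_k: "C_k k \<phi>" and test_continuous: "continuous_on UNIV \<phi>"
    and test_continuous_grad: "continuous_on UNIV (grad \<phi>)"
    and test_GDERIV: "GDERIV \<phi> x :> grad \<phi> x"
    and test_UNIV: "\<phi> \<in> test_functions UNIV"
proof -
  have C: "C_k k \<phi>" for k using assms by (simp add: test_functions_def)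
  then show "C_k k \<phi>" .
  show "continuous_on UNIV \<phi>" using C[of 0] by simp
  show "continuous_on UNIV (grad \<phi>)" using C by (rule continuous_on_grad)
  show "GDERIV \<phi> x :> grad \<phi> x" using C by (rule C_k_GDERIV)
  show "\<phi> \<in> test_functions UNIV" using assms by (simp add: test_functions_def)
qed

lemma test_measurable:
  assumes "\<phi> \<in> test_functions \<Omega>"
  shows "\<phi> \<in> borel_measurable borel" "grad \<phi> \<in> borel_measurable borel"
    "\<phi> \<in> borel_measurable lebesgue" "grad \<phi> \<in> borel_measurable lebesgue"
proof -
  show *: "\<phi> \<in> borel_measurable borel" "grad \<phi> \<in> borel_measurable borel"
    using assms by (auto intro: borel_measurable_continuous_onI test_continuous test_continuous_grad)
  then show "\<phi> \<in> borel_measurable lebesgue" "grad \<phi> \<in> borel_measurable lebesgue"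
    by (auto intro: measurable_completion)
qed

lemma test_support:
  assumes "\<phi> \<in> test_functions \<Omega>"
  obtains R where "0 < R" "\<And>x. norm x \<ge> R \<Longrightarrow> \<phi> x = 0" "\<And>x. norm x \<ge> R \<Longrightarrow> grad \<phi> x = 0"
proof -
  have "bounded {x. \<phi> x \<noteq> 0}"
    using assms by (auto simp: test_functions_def intro: bounded_subset[OF compact_imp_bounded closure_subset])
  then obtain R where R: "0 < R" "\<And>x. \<phi> x \<noteq> 0 \<Longrightarrow> norm x \<le> R"
    unfolding bounded_pos by auto
  then have z: "\<phi> x = 0" if "norm x > R" for x using that by force
  have "grad \<phi> x = 0" if "norm x > R" for x
  proof (rule grad_eqI)
    have "((\<lambda>_. 0) has_derivative (\<lambda>h. h \<bullet> (0::'a))) (at x)" by simp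
    moreover have "open {x::'a. norm x > R}"
      by (intro open_Collect_less continuous_intros)
    ultimately show "GDERIV \<phi> x :> 0"
      unfolding gderiv_def using that z
      by - (rule has_derivative_transform_within_open[where f="\<lambda>_. 0", of _ _ _ "{x. norm x > R}"], auto)
  qed
  \<comment> \<open>Vanishing is known on the open exterior \<open>norm x > R\<close>; the larger
    radius \<open>R + 1\<close> allows the non-strict condition.\<close>
  with z R show thesis by (intro that[of "R + 1"]) auto
qed

lemma test_bounded:
  fixes \<phi> :: "'a::euclidean_space \<Rightarrow> real"
  assumes "\<phi> \<in> test_functions \<Omega>"
  obtains B where "0 \<le> B" "\<And>x. \<bar>\<phi> x\<bar> \<le> B" "\<And>x. norm (grad \<phi> x) \<le> B"
proof -
  obtain R where R: "0 < R" "\<And>x. norm x \<ge> R \<Longrightarrow> \<phi> x = 0" "\<And>x. norm x \<ge> R \<Longrightarrow> grad \<phi> x = 0"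
    using test_support[OF assms] by blast
  have "bounded (\<phi> ` cball 0 R)"
    by (intro compact_imp_bounded compact_continuous_image
        continuous_on_subset[OF test_continuous[OF assms]]) auto
  then obtain B1 where B1: "\<forall>y\<in>\<phi> ` cball 0 R. norm y \<le> B1"
    unfolding bounded_iff by blast
  have "bounded (grad \<phi> ` cball 0 R)"
    by (intro compact_imp_bounded compact_continuous_image
        continuous_on_subset[OF test_continuous_grad[OF assms]]) auto
  then obtain B2 where B2: "\<forall>y\<in>grad \<phi> ` cball 0 R. norm y \<le> B2"
    unfolding bounded_iff by blast
  show thesis
  proof (rule that[of "\<bar>B1\<bar> + \<bar>B2\<bar>"])
    fix x
    show "\<bar>\<phi> x\<bar> \<le> \<bar>B1\<bar> + \<bar>B2\<bar>" using bspec[OF B1, of "\<phi> x"] R(2)[of x] by (cases "norm x \<le> R") auto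
    show "norm (grad \<phi> x) \<le> \<bar>B1\<bar> + \<bar>B2\<bar>" using bspec[OF B2, of "grad \<phi> x"] R(3)[of x] by (cases "norm x \<le> R") auto
  qed auto
qed

lemma test_compose:
  assumes "\<phi> \<in> test_functions \<Omega>" and g: "\<And>k. C_k k g" "g 0 = 0"
  shows "(\<lambda>x. g (\<phi> x)) \<in> test_functions \<Omega>"
proof -
  have "{x. g (\<phi> x) \<noteq> 0} \<subseteq> {x. \<phi> x \<noteq> 0}" using g by auto
  then have "bounded {x. \<phi> x \<noteq> 0} \<Longrightarrow> bounded {x. g (\<phi> x) \<noteq> 0}"
      "closure {x. g (\<phi> x) \<noteq> 0} \<subseteq> closure {x. \<phi> x \<noteq> 0}"
    using bounded_subset closure_mono by metis+
  then show ?thesis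
    using assms C_k_compose[OF g(1) test_C_k[OF assms(1)]]
    by (auto simp: test_functions_def)
qed

lemma test_diff:
  assumes "\<phi> \<in> test_functions \<Omega>" "\<psi> \<in> test_functions \<Omega>"
  shows "(\<lambda>x. \<phi> x - \<psi> x) \<in> test_functions \<Omega>"
proof -
  have *: "{x. \<phi> x - \<psi> x \<noteq> 0} \<subseteq> {x. \<phi> x \<noteq> 0} \<union> {x. \<psi> x \<noteq> 0}"
    by auto
  have "closure {x. \<phi> x - \<psi> x \<noteq> 0} \<subseteq> closure {x. \<phi> x \<noteq> 0} \<union> closure {x. \<psi> x \<noteq> 0}"
    using closure_mono[OF *] by (simp only: closure_Un)
  also have "\<dots> \<subseteq> \<Omega>"
    using assms by (simp add: test_functions_def)
  finally have sub: "closure {x. \<phi> x - \<psi> x \<noteq> 0} \<subseteq> \<Omega>" .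
  have bd: "bounded {x. \<phi> x - \<psi> x \<noteq> 0}"
    using assms by (intro bounded_subset[OF _ *]) (auto simp: test_functions_def)
  show ?thesis
    unfolding test_functions_def mem_Collect_eq compact_closure
    by (intro conjI allI sub bd C_k_diff test_C_k[OF assms(1)] test_C_k[OF assms(2)])
qed

lemma grad_test_diff:
  assumes "\<phi> \<in> test_functions \<Omega>" "\<psi> \<in> test_functions \<Omega>"
  shows "grad (\<lambda>x. \<phi> x - \<psi> x) x = grad \<phi> x - grad \<psi> x"
  by (intro grad_eqI GDERIV_diff test_GDERIV[OF assms(1)] test_GDERIV[OF assms(2)])

lemma grad_test_compose:
  assumes "\<phi> \<in> test_functions \<Omega>" "\<And>t. (g has_real_derivative g' t) (at t)"
  shows "grad (\<lambda>x. g (\<phi> x)) x = g' (\<phi> x) *\<^sub>R grad \<phi> x"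
  by (intro grad_eqI GDERIV_DERIV_compose test_GDERIV[OF assms(1)] assms(2))

section \<open>The Sobolev inequality for test functions\<close>

lemma epow_power: "0 \<le> r \<Longrightarrow> epow x r ^ m = epow x (real m * r)"
  by (induction m) (auto simp: epow_add[symmetric] algebra_simps)

lemma nn_integral_Hoelder2:
  assumes "f \<in> borel_measurable M" "g \<in> borel_measurable M" "0 \<le> s" "0 \<le> t" "s + t = 1"
  shows "(\<integral>\<^sup>+x. epow (f x) s * epow (g x) t \<partial>M) \<le> epow (\<integral>\<^sup>+x. f x \<partial>M) s * epow (\<integral>\<^sup>+x. g x \<partial>M) t"
  using nn_integral_Hoelder[of "UNIV :: bool set" "\<lambda>b. if b then s else t" "\<lambda>b. if b then f else g" M] assms
  by (simp add: UNIV_bool ac_simps)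

lemma nn_integral_lborel_PiM:
  fixes F :: "'a::euclidean_space \<Rightarrow> ennreal"
  assumes "F \<in> borel_measurable borel"
  shows "(\<integral>\<^sup>+x. F x \<partial>lborel) = (\<integral>\<^sup>+g. F (\<Sum>b\<in>Basis. g b *\<^sub>R b) \<partial>PiM Basis (\<lambda>_. lborel))"
  by (subst lborel_eq, subst nn_integral_distr) (use assms in \<open>auto\<close>)

text \<open>The bound \<open>line\<close> holds in all n coordinate directions at once. Multiplying
  the n bounds, each raised to the power 1/(n-1), bounds the power n/(n-1) of \<open>w\<close> by
  the integrand of \<open>grid_lines\<close> at its critical parameter.\<close>

lemma Loomis_Whitney_Sobolev:
  fixes w f :: "'a::euclidean_space \<Rightarrow> ennreal"
  assumes n: "2 \<le> DIM('a)"
    and f: "f \<in> borel_measurable borel" and w: "w \<in> borel_measurable borel"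
    and line: "\<And>x b. b \<in> Basis \<Longrightarrow> w x \<le> (\<integral>\<^sup>+z. f (x + (z - x \<bullet> b) *\<^sub>R b) \<partial>lborel)"
  shows "(\<integral>\<^sup>+x. epow (w x) (real DIM('a) / (real DIM('a) - 1)) \<partial>lborel)
      \<le> epow (\<integral>\<^sup>+x. f x \<partial>lborel) (real DIM('a) / (real DIM('a) - 1))"
proof -
  define p where "p = 1 / (real DIM('a) - 1)"
  define T where "T g = (\<Sum>b\<in>Basis. g b *\<^sub>R b)" for g :: "'a \<Rightarrow> real"
  have p: "0 \<le> p" "(real DIM('a) - 1) * p = 1"
    using n by (auto simp: p_def)
  have np: "real DIM('a) * p = 1 + p" "real DIM('a) / (real DIM('a) - 1) = 1 + p"
    using n by (auto simp: p_def field_simps)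
  have T: "T \<in> measurable (PiM Basis (\<lambda>_. lborel)) borel"
    unfolding T_def by measurable
  have Tb: "T g \<bullet> b = g b" if "b \<in> Basis" for g b
    using that by (simp add: T_def inner_sum_left inner_Basis if_distrib cong: if_cong)
  have Tupd: "T (g(b := z)) = T g + (z - g b) *\<^sub>R b" if "b \<in> Basis" for g b z
  proof -
    have "(\<Sum>c\<in>Basis. (g(b := z)) c *\<^sub>R c) = z *\<^sub>R b + (\<Sum>c\<in>Basis - {b}. (g(b := z)) c *\<^sub>R c)"
      using that by (subst sum.remove[of _ b]) auto
    also have "(\<Sum>c\<in>Basis - {b}. (g(b := z)) c *\<^sub>R c) = (\<Sum>c\<in>Basis - {b}. g c *\<^sub>R c)"
      by (intro sum.cong) auto
    also have "\<dots> = (\<Sum>c\<in>Basis. g c *\<^sub>R c) - g b *\<^sub>R b"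
      using that by (subst sum.remove[of Basis b]) auto
    finally show ?thesis by (simp add: T_def algebra_simps)
  qed
  have "(\<integral>\<^sup>+x. epow (w x) (1 + p) \<partial>lborel) = (\<integral>\<^sup>+g. epow (w (T g)) (1 + p) \<partial>PiM Basis (\<lambda>_. lborel))"
    unfolding T_def by (intro nn_integral_lborel_PiM epow_measurable w)
  also have "\<dots> \<le> (\<integral>\<^sup>+g. epow (f (T g)) (1 - (real DIM('a) - 1) * p) *
      (\<Prod>b\<in>Basis. epow (\<integral>\<^sup>+z. f (T (g(b := z))) \<partial>lborel) p) \<partial>PiM Basis (\<lambda>_. lborel))"
  proof (rule nn_integral_mono)
    fix g
    have "epow (w (T g)) (1 + p) = (\<Prod>b\<in>(Basis :: 'a set). epow (w (T g)) p)"
      using p np by (simp add: epow_power)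
    also have "\<dots> \<le> (\<Prod>b\<in>Basis. epow (\<integral>\<^sup>+z. f (T (g(b := z))) \<partial>lborel) p)"
    proof (intro prod_mono_ennreal epow_mono p)
      fix b :: 'a assume b: "b \<in> Basis"
      show "w (T g) \<le> (\<integral>\<^sup>+z. f (T (g(b := z))) \<partial>lborel)"
        using line[OF b, of "T g"] by (simp add: Tb[OF b] Tupd[OF b])
    qed
    finally show "epow (w (T g)) (1 + p) \<le> epow (f (T g)) (1 - (real DIM('a) - 1) * p) *
      (\<Prod>b\<in>Basis. epow (\<integral>\<^sup>+z. f (T (g(b := z))) \<partial>lborel) p)"
      by (simp add: p)
  qed
  also have "\<dots> \<le> epow (\<integral>\<^sup>+g. f (T g) \<partial>PiM Basis (\<lambda>_. lborel)) (1 + p)"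
    using p by (intro grid_lines measurable_compose[OF T f]) auto
  also have "(\<integral>\<^sup>+g. f (T g) \<partial>PiM Basis (\<lambda>_. lborel)) = (\<integral>\<^sup>+x. f x \<partial>lborel)"
    unfolding T_def by (intro nn_integral_lborel_PiM[symmetric] f)
  finally show ?thesis unfolding np .
qed

text \<open>An exponent above 1 makes the power differentiable at 0 as well, so that the Sobolev
  argument can use a power of \<open>\<bar>\<phi>\<bar>\<close> without smoothing the
  modulus.\<close>

lemma DERIV_abs_powr:
  fixes g :: real
  assumes "1 < g"
  shows "((\<lambda>t. \<bar>t\<bar> powr g) has_real_derivative g * \<bar>t\<bar> powr (g - 1) * sgn t) (at t)"
proof (cases t "0::real" rule: linorder_cases)
  case greater
  have "((\<lambda>t. t powr g) has_real_derivative g * t powr (g - 1)) (at t)"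
    using greater by (rule has_real_derivative_powr)
  then have "((\<lambda>t. \<bar>t\<bar> powr g) has_real_derivative g * t powr (g - 1)) (at t)"
    by (rule has_field_derivative_transform_within_open[where S="{0<..}"]) (use greater in auto)
  with greater show ?thesis by simp
next
  case less
  have "((\<lambda>t. (- t) powr g) has_real_derivative g * (- t) powr (g - 1) * (- 1)) (at t)"
    using less by (auto intro!: derivative_eq_intros)
  then have "((\<lambda>t. \<bar>t\<bar> powr g) has_real_derivative g * (- t) powr (g - 1) * (- 1)) (at t)"
    by (rule has_field_derivative_transform_within_open[where S="{..<0}"]) (use less in auto)
  with less show ?thesis by simp
next
  case equal
  have "((\<lambda>h::real. \<bar>h\<bar> powr (g - 1)) \<longlongrightarrow> 0) (at 0)"
    using assms by (auto intro!: tendsto_eq_intros)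
  then have "((\<lambda>h::real. \<bar>\<bar>h\<bar> powr g / h\<bar>) \<longlongrightarrow> 0) (at 0)"
  proof (rule Lim_transform_eventually)
    show "\<forall>\<^sub>F h in at 0. \<bar>h\<bar> powr (g - 1) = \<bar>\<bar>h\<bar> powr g / h\<bar>"
      unfolding eventually_at_filter
      by (rule always_eventually) (auto simp: powr_diff abs_mult)
  qed
  then have "((\<lambda>h::real. \<bar>h\<bar> powr g / h) \<longlongrightarrow> 0) (at 0)"
    by (rule tendsto_rabs_zero_cancel)
  with equal assms show ?thesis
    unfolding DERIV_def by simp
qed

lemma isCont_abs_powr_sgn:
  fixes g :: real
  assumes "1 < g"
  shows "isCont (\<lambda>t. g * \<bar>t\<bar> powr (g - 1) * sgn t) t"
proof (cases "t = 0")
  case True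
  have "((\<lambda>t::real. \<bar>t\<bar> powr (g - 1)) \<longlongrightarrow> 0) (at 0)"
    using assms by (auto intro!: tendsto_eq_intros)
  then have "((\<lambda>t::real. g * \<bar>t\<bar> powr (g - 1)) \<longlongrightarrow> 0) (at 0)"
    by (rule tendsto_mult_right_zero)
  then have "((\<lambda>t::real. g * \<bar>t\<bar> powr (g - 1) * sgn t) \<longlongrightarrow> 0) (at 0)"
    by (rule Lim_null_comparison[rotated])
       (use assms in \<open>auto intro!: always_eventually simp: abs_mult sgn_if\<close>)
  with True show ?thesis by (simp add: isCont_def)
next
  case False
  then show ?thesis by (auto intro!: continuous_intros)
qed

lemma abs_le_nn_integral_deriv:
  fixes \<psi> \<psi>' :: "real \<Rightarrow> real"
  assumes d: "\<And>z. (\<psi> has_real_derivative \<psi>' z) (at z)" and c: "\<And>z. isCont \<psi>' z"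
    and z: "a \<le> t" "\<psi> a = 0"
  shows "ennreal \<bar>\<psi> t\<bar> \<le> (\<integral>\<^sup>+z. ennreal \<bar>\<psi>' z\<bar> \<partial>lborel)"
proof -
  have *: "has_bochner_integral lborel (\<lambda>x. \<psi>' x * indicator {a..t} x) (\<psi> t - \<psi> a)"
    using z(1) d c by (intro has_bochner_integral_FTC_Icc_real) auto
  have "ennreal \<bar>\<psi> t\<bar> = ennreal (norm (\<integral>x. \<psi>' x * indicator {a..t} x \<partial>lborel))"
    using * z by (simp add: has_bochner_integral_integral_eq)
  also have "\<dots> \<le> (\<integral>\<^sup>+x. ennreal (norm (\<psi>' x * indicator {a..t} x)) \<partial>lborel)"
    using * by (intro integral_norm_bound_ennreal) (auto simp: has_bochner_integral_iff)
  also have "\<dots> \<le> (\<integral>\<^sup>+x. ennreal \<bar>\<psi>' x\<bar> \<partial>lborel)"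
    by (intro nn_integral_mono ennreal_leI) (auto simp: indicator_def)
  finally show ?thesis .
qed


text \<open>Gagliardo--Nirenberg for the gradient in \<open>L\<^sup>1\<close>, applied to \<open>\<bar>\<phi>\<bar> powr \<gamma>\<close>.\<close>

lemma Sobolev_test:
  fixes \<phi> :: "'a::euclidean_space \<Rightarrow> real"
  assumes n: "3 \<le> DIM('a)" and \<phi>: "\<phi> \<in> test_functions \<Omega>"
  defines "p \<equiv> two_star DIM('a)"
  defines "\<gamma> \<equiv> 2 * (real DIM('a) - 1) / (real DIM('a) - 2)"
  shows "epow (\<integral>\<^sup>+x. ennreal (\<bar>\<phi> x\<bar> powr p) \<partial>lebesgue) (2 / p)
      \<le> ennreal (\<gamma>\<^sup>2) * (\<integral>\<^sup>+x. ennreal ((norm (grad \<phi> x))\<^sup>2) \<partial>lebesgue)"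
proof -
  define \<sigma> where "\<sigma> = real DIM('a) / (real DIM('a) - 1)"
  \<comment> \<open>\<open>\<gamma>\<close> is tuned so that a single integral \<open>J\<close>
    appears: \<open>\<gamma> * \<sigma> = p\<close> identifies the left-hand side with
    \<open>J\<close>, and \<open>2 * (\<gamma> - 1) = p\<close> makes Cauchy-Schwarz on the gradient
    of the power produce \<open>J\<close> again. Dividing by \<open>J\<close> then leaves the
    exponent \<open>2 / \<sigma> - 1 = 2 / p\<close>.\<close>
  have g1: "1 < \<gamma>" and s0: "0 < \<sigma>" and p0: "0 < p"
    and gs: "\<gamma> * \<sigma> = p" and g2: "2 * (\<gamma> - 1) = p" and sp: "2 / \<sigma> - 1 = 2 / p"
  proof -
    define N where "N = real DIM('a)"
    have N: "3 \<le> N" using n by (simp add: N_def)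
    note defs = \<gamma>_def \<sigma>_def p_def two_star_def N_def[symmetric]
    show "1 < \<gamma>" "0 < \<sigma>" "0 < p"
      using N unfolding defs by (simp_all add: field_simps)
    have "2 * (N - 1) / (N - 2) * (N / (N - 1)) = 2 * N / (N - 2)"
      using N by (simp only: times_divide_times_eq, subst frac_eq_eq) auto
    then show "\<gamma> * \<sigma> = p"
      unfolding defs .
    show "2 * (\<gamma> - 1) = p"
      using N unfolding defs by (simp add: field_simps)
    show "2 / \<sigma> - 1 = 2 / p"
      using N unfolding defs by (simp add: field_simps)
  qed
  note [measurable] = test_measurable(1,2)[OF \<phi>]
  obtain R where R: "0 < R" "\<And>x. norm x \<ge> R \<Longrightarrow> \<phi> x = 0"
    using test_support[OF \<phi>] by metis
  obtain B where B: "0 \<le> B" "\<And>x. \<bar>\<phi> x\<bar> \<le> B"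
    using test_bounded[OF \<phi>] by metis
  define w where "w x = ennreal (\<bar>\<phi> x\<bar> powr \<gamma>)" for x
  define f where "f x = ennreal (\<gamma> * \<bar>\<phi> x\<bar> powr (\<gamma> - 1) * norm (grad \<phi> x))" for x
  have wf [measurable]: "w \<in> borel_measurable borel" "f \<in> borel_measurable borel"
    unfolding w_def f_def by measurable
  define J where "J = (\<integral>\<^sup>+x. ennreal (\<bar>\<phi> x\<bar> powr p) \<partial>lborel)"
  define D where "D = (\<integral>\<^sup>+x. ennreal ((norm (grad \<phi> x))\<^sup>2) \<partial>lborel)"
  have line: "w x \<le> (\<integral>\<^sup>+z. f (x + (z - x \<bullet> b) *\<^sub>R b) \<partial>lborel)" if b: "b \<in> Basis" for x b
  proof -
    define l where "l z = x + (z - x \<bullet> b) *\<^sub>R b" for z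
    define \<psi> where "\<psi> z = \<bar>\<phi> (l z)\<bar> powr \<gamma>" for z
    define \<psi>' where "\<psi>' z = (\<gamma> * \<bar>\<phi> (l z)\<bar> powr (\<gamma> - 1) * sgn (\<phi> (l z))) * (b \<bullet> grad \<phi> (l z))" for z
    \<comment> \<open>A starting point outside the support and not to the right of the evaluation
      point.\<close>
    define a where "a = min (x \<bullet> b) (- R)"
    have lb: "l z \<bullet> b = z" for z
      using b by (simp add: l_def inner_add_left)
    have "((\<lambda>z. \<phi> (l z)) has_real_derivative b \<bullet> grad \<phi> (l z)) (at z)" for z
    proof -
      have "(l has_derivative (\<lambda>h. h *\<^sub>R b)) (at z)"
        unfolding l_def by (auto intro!: derivative_eq_intros)
      from has_derivative_compose[OF this test_GDERIV[OF \<phi>, unfolded gderiv_def]]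
      show ?thesis by (simp add: has_field_derivative_def mult_commute_abs)
    qed
    from DERIV_chain2[OF DERIV_abs_powr[OF g1] this]
    have d: "(\<psi> has_real_derivative \<psi>' z) (at z)" for z
      unfolding \<psi>_def \<psi>'_def .
    have cl: "isCont l z" for z unfolding l_def by (intro continuous_intros)
    have c: "isCont \<psi>' z" for z
    proof -
      have "isCont \<phi> y" "isCont (grad \<phi>) y" for y
        using test_continuous[OF \<phi>] test_continuous_grad[OF \<phi>]
        by (auto simp: continuous_on_eq_continuous_at)
      then have "isCont (\<lambda>z. \<phi> (l z)) z" "isCont (\<lambda>z. grad \<phi> (l z)) z"
        using cl by (auto intro: isCont_o2)
      then show ?thesis
        unfolding \<psi>'_def
        by (intro continuous_mult continuous_inner continuous_const isCont_o2[OF _ isCont_abs_powr_sgn[OF g1]])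
    qed
    have "R \<le> \<bar>l a \<bullet> b\<bar>" using R(1) by (auto simp: lb a_def)
    also have "\<dots> \<le> norm (l a)" using Basis_le_norm[OF b] .
    finally have "\<psi> a = 0" using R(2) by (simp add: \<psi>_def)
    then have "ennreal \<bar>\<psi> (x \<bullet> b)\<bar> \<le> (\<integral>\<^sup>+z. ennreal \<bar>\<psi>' z\<bar> \<partial>lborel)"
      by (intro abs_le_nn_integral_deriv[OF d c, of a]) (auto simp: a_def)
    also have "\<dots> \<le> (\<integral>\<^sup>+z. f (l z) \<partial>lborel)"
    proof (intro nn_integral_mono)
      fix z
      have "\<bar>b \<bullet> grad \<phi> (l z)\<bar> \<le> norm (grad \<phi> (l z))"
        using Basis_le_norm[OF b, of "grad \<phi> (l z)"] by (simp add: inner_commute)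
      moreover have "\<bar>sgn (\<phi> (l z))\<bar> \<le> 1" by (simp add: sgn_if)
      ultimately have "\<gamma> * \<bar>\<phi> (l z)\<bar> powr (\<gamma> - 1) * \<bar>sgn (\<phi> (l z))\<bar> * \<bar>b \<bullet> grad \<phi> (l z)\<bar>
          \<le> \<gamma> * \<bar>\<phi> (l z)\<bar> powr (\<gamma> - 1) * 1 * norm (grad \<phi> (l z))"
        using g1 by (intro mult_mono) auto
      then show "ennreal \<bar>\<psi>' z\<bar> \<le> f (l z)"
        unfolding \<psi>'_def f_def using g1 by (intro ennreal_leI) (simp add: abs_mult)
    qed
    finally show ?thesis
      by (simp add: w_def \<psi>_def l_def)
  qed
  have "J = (\<integral>\<^sup>+x. epow (w x) \<sigma> \<partial>lborel)"
    unfolding J_def w_def using s0 by (simp add: epow_ennreal powr_powr gs)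
  also have "\<dots> \<le> epow (\<integral>\<^sup>+x. f x \<partial>lborel) \<sigma>"
    unfolding \<sigma>_def using n line by (intro Loomis_Whitney_Sobolev) auto
  finally have 1: "J \<le> epow (\<integral>\<^sup>+x. f x \<partial>lborel) \<sigma>" .
  have 2: "(\<integral>\<^sup>+x. f x \<partial>lborel) \<le> ennreal \<gamma> * (epow J (1/2) * epow D (1/2))"
  proof -
    have "f x = ennreal \<gamma> * (epow (ennreal (\<bar>\<phi> x\<bar> powr p)) (1/2) * epow (ennreal ((norm (grad \<phi> x))\<^sup>2)) (1/2))" for x
    proof -
      have "(\<bar>\<phi> x\<bar> powr p) powr (1/2) = \<bar>\<phi> x\<bar> powr (\<gamma> - 1)"
        unfolding powr_powr using g2 by (intro arg_cong2[where f="(powr)"]) auto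
      moreover have "((norm (grad \<phi> x))\<^sup>2) powr (1/2) = norm (grad \<phi> x)"
        by (simp add: powr_half_sqrt)
      ultimately show ?thesis
        unfolding f_def using g1 by (simp add: epow_ennreal ennreal_mult mult.assoc)
    qed
    then have "(\<integral>\<^sup>+x. f x \<partial>lborel) = ennreal \<gamma> *
        (\<integral>\<^sup>+x. epow (ennreal (\<bar>\<phi> x\<bar> powr p)) (1/2) * epow (ennreal ((norm (grad \<phi> x))\<^sup>2)) (1/2) \<partial>lborel)"
      by (simp add: nn_integral_cmult)
    also have "\<dots> \<le> ennreal \<gamma> * (epow J (1/2) * epow D (1/2))"
      unfolding J_def D_def by (intro mult_left_mono nn_integral_Hoelder2) auto
    finally show ?thesis .
  qed
  have main: "J \<le> epow (ennreal \<gamma> * (epow J (1/2) * epow D (1/2))) \<sigma>"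
    using order_trans[OF 1 epow_mono[OF 2]] s0 by simp
  \<comment> \<open>The conclusion is reached by dividing by \<open>J\<close>, which therefore has
    to be finite; boundedness and compact support of \<open>\<phi>\<close> ensure this.\<close>
  have "J \<le> (\<integral>\<^sup>+x. ennreal (B powr p) * indicator (cball (0::'a) R) x \<partial>lborel)"
    unfolding J_def
  proof (intro nn_integral_mono)
    fix x
    show "ennreal (\<bar>\<phi> x\<bar> powr p) \<le> ennreal (B powr p) * indicator (cball (0::'a) R) x"
      using B(2)[of x] R(2)[of x] p0 by (cases "norm x \<le> R") (auto intro!: ennreal_leI powr_mono2)
  qed
  also have "\<dots> = ennreal (B powr p) * emeasure lborel (cball (0::'a) R)"
    by (rule nn_integral_cmult_indicator) simp
  also have "\<dots> < top"
    using emeasure_lborel_cball_finite[of "0::'a" R] by (simp add: ennreal_mult_less_top)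
  finally have J: "J < top" .
  have "epow J (2 / p) \<le> ennreal (\<gamma>\<^sup>2) * D"
  proof (cases "D = top \<or> J = 0")
    case True
    then show ?thesis using g1 p0 by (auto simp: ennreal_mult_top epow_zero_base)
  next
    case False
    define j where "j = enn2real J"
    define d where "d = enn2real D"
    have j: "J = ennreal j" "0 < j" and d: "D = ennreal d" "0 \<le> d"
      using False J by (auto simp: j_def d_def less_top enn2real_positive_iff zero_less_iff_neq_zero)
    have "ennreal j \<le> ennreal ((\<gamma> * (j powr (1/2) * d powr (1/2))) powr \<sigma>)"
      using main j d g1 s0 by (simp add: epow_ennreal ennreal_mult'[symmetric])
    then have le: "j \<le> (\<gamma> * (j powr (1/2) * d powr (1/2))) powr \<sigma>"
      by (simp add: ennreal_le_iff)
    then have "j powr (2 / \<sigma>) \<le> ((\<gamma> * (j powr (1/2) * d powr (1/2))) powr \<sigma>) powr (2 / \<sigma>)"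
      using j s0 by (intro powr_mono2) auto
    also have "\<dots> = (\<gamma> * (j powr (1/2) * d powr (1/2))) powr 2"
      using s0 by (simp add: powr_powr)
    also have "\<dots> = \<gamma>\<^sup>2 * (j * d)"
      using j d g1 by (simp add: powr_mult powr_powr)
    finally have "j powr (2 / \<sigma>) / j \<le> \<gamma>\<^sup>2 * d"
      using j by (simp add: field_simps)
    then have "j powr (2 / p) \<le> \<gamma>\<^sup>2 * d"
      using j by (simp add: sp[symmetric] powr_diff)
    then show ?thesis
      using j d g1 p0 by (simp add: epow_ennreal ennreal_mult'[symmetric] ennreal_leI)
  qed
  then show ?thesis
    by (simp add: J_def D_def nn_integral_completion)
qed

section \<open>Smooth bump functions and the fundamental lemma\<close>

text \<open>The parameter \<open>m\<close> makes the family closed under differentiation up to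
  linear combinations, so that smoothness is one induction over all \<open>m\<close>. The cut-off
  itself is \<open>bump 0\<close>.\<close>

definition bump :: "nat \<Rightarrow> real \<Rightarrow> real" where
  "bump m t = (if 0 < t then exp (- (1 / t)) / t ^ m else 0)"

lemma bump_tendsto_0: "(bump m \<longlongrightarrow> 0) (at 0)"
proof (rule filterlim_split_at)
  show "(bump m \<longlongrightarrow> 0) (at_left 0)"
    by (rule Lim_transform_eventually[of "\<lambda>_. 0"])
       (auto simp: bump_def eventually_at_filter intro!: always_eventually)
  have "((\<lambda>t. (inverse t) ^ m / exp (inverse t)) \<longlongrightarrow> (0::real)) (at_right 0)"
    by (rule filterlim_compose[OF tendsto_power_div_exp_0 filterlim_inverse_at_top_right])
  then show "(bump m \<longlongrightarrow> 0) (at_right 0)"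
    by (rule Lim_transform_eventually)
       (auto simp: bump_def eventually_at_filter exp_minus field_simps power_inverse intro!: always_eventually)
qed

lemma DERIV_bump: "(bump m has_real_derivative bump (m + 2) t - real m * bump (m + 1) t) (at t)"
proof (cases t "0::real" rule: linorder_cases)
  case greater
  have "((\<lambda>t. exp (- (1 / t)) / t ^ m) has_real_derivative bump (m + 2) t - real m * bump (m + 1) t) (at t)"
  proof (cases m)
    case 0
    with greater show ?thesis
      by (auto intro!: derivative_eq_intros simp: bump_def power2_eq_square field_simps)
  next
    case (Suc k)
    have "exp (- (1 / t)) * (1 / (t * t)) * t ^ m - exp (- (1 / t)) * (real m * t ^ (m - 1))
        = (bump (m + 2) t - real m * bump (m + 1) t) * (t ^ m * t ^ m)"
      using greater Suc by (simp add: bump_def field_simps power2_eq_square)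
    then show ?thesis
      using greater by (auto intro!: derivative_eq_intros simp: field_simps)
  qed
  then show ?thesis
    by (rule has_field_derivative_transform_within_open[where S="{0<..}"]) (use greater in \<open>auto simp: bump_def\<close>)
next
  case less
  have "((\<lambda>_. 0) has_real_derivative 0) (at t)" by simp
  then have "(bump m has_real_derivative 0) (at t)"
    by (rule has_field_derivative_transform_within_open[where S="{..<0}"]) (use less in \<open>auto simp: bump_def\<close>)
  with less show ?thesis by (simp add: bump_def)
next
  case equal
  \<comment> \<open>The difference quotient at 0 is \<open>bump (Suc m)\<close>, whose limit is
    already known.\<close>
  have "((\<lambda>h. (bump m (0 + h) - bump m 0) / h) \<longlongrightarrow> 0) (at 0)"
    by (rule Lim_transform_eventually[OF bump_tendsto_0[of "Suc m"]])
       (auto simp: bump_def eventually_at_filter intro!: always_eventually)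
  then show ?thesis
    unfolding equal DERIV_def by (simp add: bump_def)
qed

lemma C_k_bump: "C_k k (bump m)"
proof (induction k arbitrary: m)
  case 0
  show ?case
    using DERIV_bump by (auto intro!: continuous_at_imp_continuous_on DERIV_isCont)
next
  case (Suc k)
  show ?case
    unfolding C_k_deriv[of "bump m", OF DERIV_bump]
    by (intro C_k_diff C_k_mult C_k_const Suc)
qed

lemma bump_bounds: "0 \<le> bump 0 t" "bump 0 t \<le> 1"
  by (auto simp: bump_def)

text \<open>The factor \<open>j\<close> steepens the flanks: \<open>bump 0 (real j * t)\<close>
  tends to \<open>1\<close> for positive \<open>t\<close> and stays \<open>0\<close> otherwise. The
  support stays inside one fixed box while the functions converge to its indicator.\<close>

definition box_bump :: "nat \<Rightarrow> 'a::euclidean_space \<Rightarrow> 'a \<Rightarrow> 'a \<Rightarrow> real" where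
  "box_bump j a d x = (\<Prod>b\<in>Basis. bump 0 (real j * (x \<bullet> b - a \<bullet> b)) * bump 0 (real j * (d \<bullet> b - x \<bullet> b)))"

lemma box_bump_eq_0: "x \<notin> box a d \<Longrightarrow> box_bump j a d x = 0"
  unfolding box_bump_def
  by (rule prod_zero) (auto simp: mem_box bump_def zero_less_mult_iff)

lemma box_bump_bounds: "0 \<le> box_bump j a d x" "box_bump j a d x \<le> 1"
  unfolding box_bump_def
  by (auto intro!: prod_nonneg prod_le_1 mult_le_one mult_nonneg_nonneg bump_bounds)

lemma box_bump_test: "box_bump j a d \<in> test_functions UNIV"
proof -
  have "bounded {x. box_bump j a d x \<noteq> 0}"
    by (rule bounded_subset[OF bounded_box[of a d]]) (use box_bump_eq_0 in blast)
  moreover have "C_k k (box_bump j a d)" for k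
    unfolding box_bump_def[abs_def]
    by (intro C_k_prod C_k_mult C_k_compose[OF C_k_bump] C_k_diff C_k_const C_k_inner)
  ultimately show ?thesis by (simp add: test_functions_def)
qed

lemma box_bump_tendsto: "(\<lambda>j. box_bump j a d x) \<longlonglongrightarrow> indicator (box a d) x"
proof (cases "x \<in> box a d")
  case True
  have "(\<lambda>j. bump 0 (real j * t)) \<longlonglongrightarrow> 1" if "0 < t" for t :: real
  proof -
    have "(\<lambda>j. exp (- (1 / (real j * t)))) \<longlonglongrightarrow> exp (- 0)"
      using that by (intro tendsto_intros tendsto_divide_0[OF tendsto_const]
          filterlim_at_top_imp_at_infinity filterlim_at_top_mult_tendsto_pos[OF tendsto_const]
          filterlim_tendsto_pos_mult_at_top[of "\<lambda>_. t" t] filterlim_real_sequentially)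
       (auto simp: mult.commute)
    then have "(\<lambda>j. exp (- (1 / (real j * t)))) \<longlonglongrightarrow> 1" by simp
    then show ?thesis
    proof (rule Lim_transform_eventually)
      show "\<forall>\<^sub>F j in sequentially. exp (- (1 / (real j * t))) = bump 0 (real j * t)"
        using eventually_gt_at_top[of 0] by eventually_elim (use that in \<open>simp add: bump_def\<close>)
    qed
  qed
  then have "(\<lambda>j. box_bump j a d x) \<longlonglongrightarrow> (\<Prod>b\<in>(Basis :: 'a set). 1 * 1)"
    unfolding box_bump_def using True by (intro tendsto_prod tendsto_mult) (auto simp: mem_box)
  with True show ?thesis by simp
next
  case False
  then show ?thesis by (simp add: box_bump_eq_0)
qed

section \<open>Functions with vanishing integrals over boxes\<close>

lemma sigma_finite_lebesgue: "sigma_finite_measure (lebesgue :: 'a::euclidean_space measure)"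
proof
  show "\<exists>A::'a set set. countable A \<and> A \<subseteq> sets lebesgue \<and> \<Union> A = space lebesgue \<and> (\<forall>a\<in>A. emeasure lebesgue a \<noteq> \<infinity>)"
  proof (intro exI[of _ "range (\<lambda>n::nat. cball (0::'a) (real n))"] conjI)
    have "\<exists>n::nat. norm x \<le> real n" for x :: 'a by (rule real_arch_simple)
    then show "\<Union> (range (\<lambda>n::nat. cball (0::'a) (real n))) = space lebesgue" by auto
    show "\<forall>a\<in>range (\<lambda>n::nat. cball (0::'a) (real n)). emeasure lebesgue a \<noteq> \<infinity>"
      using emeasure_lborel_cball_finite[of "0::'a"] by (auto simp: less_top[symmetric])
  qed auto
qed

lemma One_inner_Basis: "b \<in> Basis \<Longrightarrow> One \<bullet> b = 1"
  by (simp add: inner_sum_left inner_Basis)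

text \<open>Open boxes are an intersection-stable generator of the Borel sets, and integrability of
  \<open>f\<close> makes the sets with vanishing integral a Dynkin system. A Lebesgue set differs
  from a Borel set by a null set.\<close>

lemma AE_eq_0_if_box_integrals_0:
  fixes f :: "'a::euclidean_space \<Rightarrow> 'b::{banach, second_countable_topology}"
  assumes f: "integrable lebesgue f"
    and box: "\<And>a d. (LINT x:box a d|lebesgue. f x) = 0"
  shows "AE x in lebesgue. f x = 0"
proof -
  have fs: "set_integrable lebesgue A f" if "A \<in> sets lebesgue" for A
    unfolding set_integrable_def using that f by (rule integrable_mult_indicator)
  \<comment> \<open>Complements in the Dynkin argument require that the integral over the whole
    space vanishes; growing boxes exhaust it.\<close>
  have lim: "(\<lambda>n. LINT x:box (- real (Suc n) *\<^sub>R One) (real (Suc n) *\<^sub>R One)|lebesgue. f x) \<longlonglongrightarrow> (LINT x|lebesgue. f x)"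
    unfolding set_lebesgue_integral_def
  proof (rule integral_dominated_convergence[where w="\<lambda>x. norm (f x)"])
    show "integrable lebesgue (\<lambda>x. norm (f x))" using f by simp
    show "f \<in> borel_measurable lebesgue" using f by auto
    show "(\<lambda>x. indicat_real (box (- real (Suc n) *\<^sub>R One) (real (Suc n) *\<^sub>R One)) x *\<^sub>R f x) \<in> borel_measurable lebesgue" for n
      using f by (intro borel_measurable_scaleR borel_measurable_indicator) auto
    show "AE x in lebesgue. (\<lambda>n. indicat_real (box (- real (Suc n) *\<^sub>R One) (real (Suc n) *\<^sub>R One)) x *\<^sub>R f x) \<longlonglongrightarrow> f x"
    proof (rule AE_I2)
      fix x :: 'a
      have "\<forall>\<^sub>F n in sequentially. norm x < real (Suc n)"
        by real_asymp
      then have "\<forall>\<^sub>F n in sequentially. indicat_real (box (- real (Suc n) *\<^sub>R One) (real (Suc n) *\<^sub>R One)) x *\<^sub>R f x = f x"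
      proof eventually_elim
        case (elim n)
        have "x \<in> box (- real (Suc n) *\<^sub>R One) (real (Suc n) *\<^sub>R One)"
        proof (unfold mem_box, intro ballI)
          fix b :: 'a assume b: "b \<in> Basis"
          have "\<bar>x \<bullet> b\<bar> < real (Suc n)"
            using Basis_le_norm[OF b, of x] elim by linarith
          with b show "(- real (Suc n) *\<^sub>R One) \<bullet> b < x \<bullet> b \<and> x \<bullet> b < (real (Suc n) *\<^sub>R One) \<bullet> b"
            by (auto simp: One_inner_Basis)
        qed
        then show ?case by simp
      qed
      then show "(\<lambda>n. indicat_real (box (- real (Suc n) *\<^sub>R One) (real (Suc n) *\<^sub>R One)) x *\<^sub>R f x) \<longlonglongrightarrow> f x"
        by (rule tendsto_eventually)
    qed
    show "AE x in lebesgue. norm (indicat_real (box (- real (Suc n) *\<^sub>R One) (real (Suc n) *\<^sub>R One)) x *\<^sub>R f x) \<le> norm (f x)" for n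
      by (auto simp: indicator_def)
  qed
  have total: "(LINT x|lebesgue. f x) = 0"
    using LIMSEQ_unique[OF lim] by (simp add: box)
  have borel: "(LINT x:A|lebesgue. f x) = 0" if "A \<in> sets borel" for A
  proof -
    have "A \<in> sigma_sets UNIV (range (\<lambda>(a, b). box a b))"
      using that by (simp add: borel_eq_box)
    then show ?thesis
    proof (induction rule: sigma_sets_induct_disjoint[rotated 2, consumes 1, case_names basic empty compl union int pow])
      case (basic A)
      then show ?case using box by auto
    next
      case empty
      show ?case by (simp add: set_lebesgue_integral_def)
    next
      case (compl A)
      then have A: "A \<in> sets lebesgue"
        by (metis borel_eq_box sets_completionI_sets sets_lborel sets_measure_of top_greatest Pow_UNIV)
      have "(LINT x:A \<union> (UNIV - A)|lebesgue. f x) = (LINT x:A|lebesgue. f x) + (LINT x:UNIV - A|lebesgue. f x)"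
        using A by (intro set_integral_Un fs) auto
      then show ?case using compl total by (simp add: set_lebesgue_integral_def)
    next
      case (union A)
      then have A: "A i \<in> sets lebesgue" for i
        by (metis borel_eq_box sets_completionI_sets sets_lborel sets_measure_of top_greatest Pow_UNIV range_subsetD)
      have "(LINT x:(\<Union>i. A i)|lebesgue. f x) = (\<Sum>i. (LINT x:A i|lebesgue. f x))"
        using A union by (intro lebesgue_integral_countable_add fs) (auto simp: disjoint_family_on_def)
      then show ?case using union by simp
    next
      case int
      show ?case
        by (auto simp: Int_stable_def box_Int_box)
    next
      case pow
      show ?case by simp
    qed
  qed
  show ?thesis
  proof (rule sigma_finite_measure.density_zero[OF sigma_finite_lebesgue f])
    fix A :: "'a set" assume "A \<in> sets lebesgue"
    then obtain S N N' where A: "A = S \<union> N" "N \<subseteq> N'" "N' \<in> null_sets lborel" "S \<in> sets lborel"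
      by (rule sets_completionE)
    have "AE x in lebesgue. x \<notin> N'"
      using A(3) by (intro AE_not_in) (auto intro: null_sets_completionI)
    then have "(LINT x:A|lebesgue. f x) = (LINT x:S|lebesgue. f x)"
      unfolding set_lebesgue_integral_def
    proof (intro integral_cong_AE)
      show "(\<lambda>x. indicat_real A x *\<^sub>R f x) \<in> borel_measurable lebesgue"
        using fs[OF \<open>A \<in> sets lebesgue\<close>] by (auto simp: set_integrable_def)
      show "(\<lambda>x. indicat_real S x *\<^sub>R f x) \<in> borel_measurable lebesgue"
        using fs[of S] A(4) by (auto simp: set_integrable_def)
      show "AE x in lebesgue. x \<notin> N' \<Longrightarrow> AE x in lebesgue. indicat_real A x *\<^sub>R f x = indicat_real S x *\<^sub>R f x"
        by (erule AE_mp) (use A in \<open>auto simp: indicator_def intro!: AE_I2\<close>)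
    qed
    also have "\<dots> = 0" using borel A(4) by simp
    finally show "(LINT x:A|lebesgue. f x) = 0" .
  qed
qed

text \<open>Box bumps are admissible in \<open>zero\<close> and converge boundedly to the indicator
  of an open box, so the integrals of \<open>D\<close> over all boxes vanish.\<close>

lemma fundamental_lemma:
  fixes D :: "'a::euclidean_space \<Rightarrow> 'b::{banach, second_countable_topology}"
  assumes loc: "\<And>K. compact K \<Longrightarrow> set_integrable lebesgue K D"
    and zero: "\<And>\<psi>. \<psi> \<in> test_functions UNIV \<Longrightarrow> (LINT x|lebesgue. \<psi> x *\<^sub>R D x) = 0"
  shows "AE x in lebesgue. D x = 0"
proof -
  have box: "(LINT x:box a d|lebesgue. D x) = 0" for a d :: 'a
  proof -
    have cb: "set_integrable lebesgue (cbox a d) D" by (rule loc) simp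
    have "(\<lambda>j. LINT x|lebesgue. box_bump j a d x *\<^sub>R (indicator (cbox a d) x *\<^sub>R D x)) \<longlonglongrightarrow>
        (LINT x|lebesgue. indicator (box a d) x *\<^sub>R (indicator (cbox a d) x *\<^sub>R D x))"
    proof (rule integral_dominated_convergence[where w="\<lambda>x. norm (indicat_real (cbox a d) x *\<^sub>R D x)"])
      have m: "(\<lambda>x. indicat_real (cbox a d) x *\<^sub>R D x) \<in> borel_measurable lebesgue"
        using cb by (auto simp: set_integrable_def)
      show "(\<lambda>x. indicat_real (box a d) x *\<^sub>R indicat_real (cbox a d) x *\<^sub>R D x) \<in> borel_measurable lebesgue"
        by (intro borel_measurable_scaleR[OF _ m] borel_measurable_indicator) auto
      show "(\<lambda>x. box_bump j a d x *\<^sub>R indicat_real (cbox a d) x *\<^sub>R D x) \<in> borel_measurable lebesgue" for j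
        by (intro borel_measurable_scaleR[OF _ m] test_measurable(3)[OF box_bump_test])
      show "integrable lebesgue (\<lambda>x. norm (indicat_real (cbox a d) x *\<^sub>R D x))"
        using cb by (intro integrable_norm) (auto simp: set_integrable_def)
      show "AE x in lebesgue. (\<lambda>j. box_bump j a d x *\<^sub>R indicat_real (cbox a d) x *\<^sub>R D x)
          \<longlonglongrightarrow> indicat_real (box a d) x *\<^sub>R indicat_real (cbox a d) x *\<^sub>R D x"
        by (intro AE_I2 tendsto_scaleR box_bump_tendsto tendsto_const)
      show "AE x in lebesgue. norm (box_bump j a d x *\<^sub>R indicat_real (cbox a d) x *\<^sub>R D x)
          \<le> norm (indicat_real (cbox a d) x *\<^sub>R D x)" for j
        using box_bump_bounds[of j a d] by (intro AE_I2) (auto intro: mult_left_le_one_le simp: indicator_def)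
    qed
    moreover have 1: "box_bump j a d x *\<^sub>R (indicator (cbox a d) x *\<^sub>R D x) = box_bump j a d x *\<^sub>R D x" for j x
      using box_bump_eq_0[of x a d j] box_subset_cbox[of a d] by (cases "x \<in> box a d") auto
    moreover have 2: "indicator (box a d) x *\<^sub>R (indicator (cbox a d) x *\<^sub>R D x) = indicat_real (box a d) x *\<^sub>R D x" for x
      using box_subset_cbox[of a d] by (auto simp: indicator_def)
    ultimately show ?thesis
      unfolding 1 2 zero[OF box_bump_test] set_lebesgue_integral_def by (simp only: LIMSEQ_const_iff)
  qed
  have "AE x in lebesgue. \<forall>n::nat. indicat_real (cball 0 (real n)) x *\<^sub>R D x = 0"
  proof (subst AE_all_countable, intro allI)
    fix n :: nat
    \<comment> \<open>\<open>D\<close> is integrable on bounded sets only, so the criterion for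
      boxes is applied to its restriction to a large box; a box intersected with \<open>C\<close> is
      again a box.\<close>
    define C where "C = box (- real (Suc n) *\<^sub>R One) (real (Suc n) *\<^sub>R (One::'a))"
    have "AE x in lebesgue. indicat_real C x *\<^sub>R D x = 0"
    proof (rule AE_eq_0_if_box_integrals_0)
      have "set_integrable lebesgue (closure C) D"
        by (rule loc) (simp add: C_def bounded_box)
      then have "set_integrable lebesgue C D"
        by (rule set_integrable_subset) (auto simp: C_def closure_subset intro: closure_subset[THEN subsetD])
      then show "integrable lebesgue (\<lambda>x. indicat_real C x *\<^sub>R D x)"
        by (simp add: set_integrable_def)
      fix a d :: 'a
      obtain a' d' where "box a d \<inter> C = box a' d'"
        unfolding C_def box_Int_box by blast
      moreover have "(LINT x:box a d|lebesgue. indicat_real C x *\<^sub>R D x) = (LINT x:box a d \<inter> C|lebesgue. D x)"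
        unfolding set_lebesgue_integral_def
        by (intro Bochner_Integration.integral_cong) (auto simp: indicator_def)
      ultimately show "(LINT x:box a d|lebesgue. indicat_real C x *\<^sub>R D x) = 0"
        using box by simp
    qed
    then show "AE x in lebesgue. indicat_real (cball 0 (real n)) x *\<^sub>R D x = 0"
    proof (rule AE_mp, intro AE_I2 impI)
      fix x assume 0: "indicat_real C x *\<^sub>R D x = 0"
      have "x \<in> C" if "norm x \<le> real n"
      proof (unfold C_def mem_box, intro ballI)
        fix b :: 'a assume b: "b \<in> Basis"
        have "\<bar>x \<bullet> b\<bar> < real (Suc n)"
          using Basis_le_norm[OF b, of x] that by linarith
        with b show "(- real (Suc n) *\<^sub>R One) \<bullet> b < x \<bullet> b \<and> x \<bullet> b < (real (Suc n) *\<^sub>R One) \<bullet> b"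
          by (auto simp: One_inner_Basis)
      qed
      with 0 show "indicat_real (cball 0 (real n)) x *\<^sub>R D x = 0"
        by (auto simp: indicator_def)
    qed
  qed
  then show ?thesis
  proof (rule AE_mp, intro AE_I2 impI)
    fix x assume *: "\<forall>n::nat. indicat_real (cball 0 (real n)) x *\<^sub>R D x = 0"
    obtain n :: nat where "norm x \<le> real n" using real_arch_simple by blast
    with *[rule_format, of n] show "D x = 0" by simp
  qed
qed

section \<open>Weak gradients\<close>

lemma test_mult:
  assumes "\<phi> \<in> test_functions \<Omega>" "\<psi> \<in> test_functions UNIV"
  shows "(\<lambda>x. \<phi> x * \<psi> x) \<in> test_functions \<Omega>"
proof -
  have *: "{x. \<phi> x * \<psi> x \<noteq> 0} \<subseteq> {x. \<phi> x \<noteq> 0}" by auto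
  have "closure {x. \<phi> x \<noteq> 0} \<subseteq> \<Omega>" "bounded {x. \<phi> x \<noteq> 0}"
    using assms by (auto simp: test_functions_def)
  then have sub: "closure {x. \<phi> x * \<psi> x \<noteq> 0} \<subseteq> \<Omega>" and bd: "bounded {x. \<phi> x * \<psi> x \<noteq> 0}"
    using closure_mono[OF *] bounded_subset[OF _ *] by (auto simp only:)
  show ?thesis
    unfolding test_functions_def mem_Collect_eq compact_closure
    by (intro conjI allI sub bd C_k_mult test_C_k[OF assms(1)] test_C_k[OF assms(2)])
qed

lemma grad_test_mult:
  assumes "\<phi> \<in> test_functions \<Omega>" "\<psi> \<in> test_functions \<Omega>'"
  shows "grad (\<lambda>x. \<phi> x * \<psi> x) x = \<phi> x *\<^sub>R grad \<psi> x + \<psi> x *\<^sub>R grad \<phi> x"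
proof (rule grad_eqI)
  have "((\<lambda>x. \<phi> x * \<psi> x) has_derivative (\<lambda>h. \<phi> x * (h \<bullet> grad \<psi> x) + (h \<bullet> grad \<phi> x) * \<psi> x)) (at x)"
    using test_GDERIV[OF assms(1)] test_GDERIV[OF assms(2)] unfolding gderiv_def
    by (intro has_derivative_mult)
  then show "GDERIV (\<lambda>x. \<phi> x * \<psi> x) x :> \<phi> x *\<^sub>R grad \<psi> x + \<psi> x *\<^sub>R grad \<phi> x"
    unfolding gderiv_def by (simp add: inner_add_right mult.commute)
qed

lemma integrable_continuous_support:
  fixes f :: "'a::euclidean_space \<Rightarrow> 'b::{banach, second_countable_topology}"
  assumes "continuous_on UNIV f" "\<And>x. norm x \<ge> R \<Longrightarrow> f x = 0"
  shows "integrable lborel f" "integrable lebesgue f"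
proof -
  have "integrable lborel (\<lambda>x. indicator (cball 0 R) x *\<^sub>R f x)"
    by (rule borel_integrable_compact) (auto intro: continuous_on_subset[OF assms(1)])
  also have "(\<lambda>x. indicator (cball 0 R) x *\<^sub>R f x) = f"
    using assms(2) by (auto simp: indicator_def fun_eq_iff)
  finally show *: "integrable lborel f" .
  then show "integrable lebesgue f"
    by (subst integrable_completion) auto
qed

text \<open>Difference quotients have integral 0 by translation invariance and converge to the
  partial derivative. They are bounded by the gradient bound and, since the steps are at most 1,
  supported in the ball of radius \<open>R + 1\<close>.\<close>

lemma integral_grad_test:
  assumes \<phi>: "(\<phi> :: 'a::euclidean_space \<Rightarrow> real) \<in> test_functions \<Omega>"
  shows "(LINT x|lborel. grad \<phi> x) = 0"
proof -
  obtain R where R: "0 < R" "\<And>x. norm x \<ge> R \<Longrightarrow> \<phi> x = 0" "\<And>x. norm x \<ge> R \<Longrightarrow> grad \<phi> x = 0"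
    using test_support[OF \<phi>] by metis
  obtain B where B: "0 \<le> B" "\<And>x. norm (grad \<phi> x) \<le> B"
    using test_bounded[OF \<phi>] by metis
  note meas [measurable] = test_measurable(1,2)[OF \<phi>]
  have int\<phi>: "integrable lborel \<phi>" and intg: "integrable lborel (grad \<phi>)"
    using R by (auto intro!: integrable_continuous_support test_continuous[OF \<phi>] test_continuous_grad[OF \<phi>])
  have "(LINT x|lborel. grad \<phi> x) \<bullet> b = 0" if b: "b \<in> Basis" for b
  proof -
    define t where "t j = 1 / real (Suc j)" for j
    define F where "F j x = (\<phi> (x + t j *\<^sub>R b) - \<phi> x) / t j" for j x
    have t: "0 < t j" "t j \<le> 1" for j by (auto simp: t_def)
    have t0: "t \<longlonglongrightarrow> 0" unfolding t_def by real_asymp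
    have shift: "integrable lborel (\<lambda>x. \<phi> (x + c))" "(LINT x|lborel. \<phi> (x + c)) = (LINT x|lborel. \<phi> x)" for c
    proof -
      have d: "distr lborel borel ((+) c) = (lborel :: 'a measure)" by (rule lborel_distr_plus)
      have "integrable (distr lborel borel ((+) c)) \<phi>" using int\<phi> by (simp add: d)
      then show "integrable lborel (\<lambda>x. \<phi> (x + c))"
        by (subst (asm) integrable_distr_eq) (auto simp: add.commute)
      have "(LINT x|distr lborel borel ((+) c). \<phi> x) = (LINT x|lborel. \<phi> (c + x))"
        by (rule integral_distr) auto
      then show "(LINT x|lborel. \<phi> (x + c)) = (LINT x|lborel. \<phi> x)"
        by (simp add: d add.commute)
    qed
    have F0: "(LINT x|lborel. F j x) = 0" for j
      unfolding F_def using int\<phi> shift[of "t j *\<^sub>R b"] by simp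
    have "(\<lambda>j. LINT x|lborel. F j x) \<longlonglongrightarrow> (LINT x|lborel. grad \<phi> x \<bullet> b)"
    proof (rule integral_dominated_convergence[where w="\<lambda>x. indicator (cball 0 (R + 1)) x *\<^sub>R B"])
      show "(\<lambda>x. grad \<phi> x \<bullet> b) \<in> borel_measurable lborel" by measurable
      show "F j \<in> borel_measurable lborel" for j unfolding F_def by measurable
      show "integrable lborel (\<lambda>x. indicator (cball (0::'a) (R + 1)) x *\<^sub>R B)"
        by (rule borel_integrable_compact) auto
      show "AE x in lborel. (\<lambda>j. F j x) \<longlonglongrightarrow> grad \<phi> x \<bullet> b"
      proof (rule AE_I2)
        fix x
        have "((\<lambda>h. x + h *\<^sub>R b) has_derivative (\<lambda>h. h *\<^sub>R b)) (at 0)"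
          by (auto intro!: derivative_eq_intros)
        moreover have "(\<phi> has_derivative (\<lambda>h. h \<bullet> grad \<phi> x)) (at (x + 0 *\<^sub>R b))"
          using test_GDERIV[OF \<phi>, of x] by (simp add: gderiv_def)
        ultimately have "((\<lambda>h. \<phi> (x + h *\<^sub>R b)) has_derivative (\<lambda>h. h *\<^sub>R b \<bullet> grad \<phi> x)) (at 0)"
          by (rule has_derivative_compose)
        then have "((\<lambda>h. \<phi> (x + h *\<^sub>R b)) has_real_derivative grad \<phi> x \<bullet> b) (at 0)"
          by (simp add: has_field_derivative_def inner_commute mult_commute_abs)
        then have "((\<lambda>h. (\<phi> (x + h *\<^sub>R b) - \<phi> x) / h) \<longlongrightarrow> grad \<phi> x \<bullet> b) (at 0)"
          by (simp add: DERIV_def)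
        moreover have "filterlim t (at 0) sequentially"
          using t0 t by (auto simp: filterlim_at intro!: always_eventually less_imp_neq[THEN not_sym])
        ultimately show "(\<lambda>j. F j x) \<longlonglongrightarrow> grad \<phi> x \<bullet> b"
          unfolding F_def by (rule filterlim_compose)
      qed
      show "AE x in lborel. norm (F j x) \<le> indicator (cball 0 (R + 1)) x *\<^sub>R B" for j
      proof (rule AE_I2)
        fix x
        show "norm (F j x) \<le> indicator (cball 0 (R + 1)) x *\<^sub>R B"
        proof (cases "norm x \<le> R + 1")
          case True
          have "norm (\<phi> (x + t j *\<^sub>R b) - \<phi> x) \<le> B * norm (x + t j *\<^sub>R b - x)"
          proof (rule differentiable_bound[of UNIV])
            fix y
            show "(\<phi> has_derivative (\<lambda>h. h \<bullet> grad \<phi> y)) (at y within UNIV)"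
              using test_GDERIV[OF \<phi>, of y] by (simp add: gderiv_def)
            show "onorm (\<lambda>h. h \<bullet> grad \<phi> y) \<le> B"
            proof (rule onorm_le)
              fix h
              have "norm (h \<bullet> grad \<phi> y) \<le> norm h * norm (grad \<phi> y)"
                using Cauchy_Schwarz_ineq2 by simp
              also have "\<dots> \<le> norm h * B" by (intro mult_left_mono B) auto
              finally show "norm (h \<bullet> grad \<phi> y) \<le> B * norm h" by (simp add: mult.commute)
            qed
          qed auto
          with True b t[of j] show ?thesis
            by (simp add: F_def abs_divide field_simps)
        next
          case False
          have "norm x \<le> norm (x + t j *\<^sub>R b) + norm (t j *\<^sub>R b)"
            by (metis add_diff_cancel_right' norm_triangle_ineq4)
          then have "R \<le> norm (x + t j *\<^sub>R b)" using False b t[of j] by simp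
          with False R show ?thesis by (simp add: F_def)
        qed
      qed
    qed
    then have "(LINT x|lborel. grad \<phi> x \<bullet> b) = 0"
      by (simp add: F0 LIMSEQ_const_iff)
    then show ?thesis using intg by simp
  qed
  then show ?thesis by - (rule euclidean_eqI, simp only: inner_zero_left)
qed

text \<open>Integration by parts is \<open>integral_grad_test\<close> for the product with the
  second test function.\<close>

lemma has_weak_grad_test:
  assumes \<phi>: "(\<phi> :: 'a::euclidean_space \<Rightarrow> real) \<in> test_functions \<Omega>"
  shows "has_weak_grad \<phi> (grad \<phi>)"
  unfolding has_weak_grad_def
proof (intro conjI allI impI ballI)
  obtain R where R: "\<And>x. norm x \<ge> R \<Longrightarrow> \<phi> x = 0" "\<And>x. norm x \<ge> R \<Longrightarrow> grad \<phi> x = 0"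
    using test_support[OF \<phi>] by metis
  note c = test_continuous[OF \<phi>] test_continuous_grad[OF \<phi>]
  fix K :: "'a set" assume "compact K"
  then have K: "K \<in> sets lebesgue" by (simp add: compact_imp_closed)
  have i: "integrable lebesgue \<phi>" "integrable lebesgue (grad \<phi>)"
    using integrable_continuous_support(2)[OF c(1), of R] integrable_continuous_support(2)[OF c(2), of R] R
    by blast+
  show "\<phi> absolutely_integrable_on K" "grad \<phi> absolutely_integrable_on K"
    unfolding set_integrable_def
    using integrable_mult_indicator[OF K i(1)] integrable_mult_indicator[OF K i(2)] .
next
  fix \<psi> :: "'a \<Rightarrow> real" assume \<psi>: "\<psi> \<in> test_functions UNIV"
  obtain R where R: "\<And>x. norm x \<ge> R \<Longrightarrow> \<phi> x = 0"
    using test_support[OF \<phi>] by metis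
  obtain R' where R': "\<And>x. norm x \<ge> R' \<Longrightarrow> \<psi> x = 0"
    using test_support[OF \<psi>] by metis
  note c = test_continuous[OF \<phi>] test_continuous_grad[OF \<phi>] test_continuous[OF \<psi>] test_continuous_grad[OF \<psi>]
  have i1: "integrable lborel (\<lambda>x. \<phi> x *\<^sub>R grad \<psi> x)"
    by (rule integrable_continuous_support(1)[where R=R]) (use R c in \<open>auto intro!: continuous_intros\<close>)
  have i2: "integrable lborel (\<lambda>x. \<psi> x *\<^sub>R grad \<phi> x)"
    by (rule integrable_continuous_support(1)[where R=R']) (use R' c in \<open>auto intro!: continuous_intros\<close>)
  have "(LINT x|lborel. \<phi> x *\<^sub>R grad \<psi> x) + (LINT x|lborel. \<psi> x *\<^sub>R grad \<phi> x) = 0"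
    using integral_grad_test[OF test_mult[OF \<phi> \<psi>]] i1 i2 by (simp add: grad_test_mult[OF \<phi> \<psi>])
  then show "(LINT x|lebesgue. \<phi> x *\<^sub>R grad \<psi> x) = - (LINT x|lebesgue. \<psi> x *\<^sub>R grad \<phi> x)"
    using i1 i2 by (simp add: integral_completion eq_neg_iff_add_eq_0)
qed

lemma has_weak_grad_unique:
  assumes "has_weak_grad u G" "has_weak_grad u H"
  shows "AE x in lebesgue. G x = H x"
proof -
  have "AE x in lebesgue. G x - H x = 0"
  proof (rule fundamental_lemma)
    show "set_integrable lebesgue K (\<lambda>x. G x - H x)" if "compact K" for K
      using assms that by (auto simp: has_weak_grad_def intro!: set_integral_diff)
    fix \<psi> :: "'a \<Rightarrow> real" assume \<psi>: "\<psi> \<in> test_functions UNIV"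
    obtain R where R: "\<And>x. norm x \<ge> R \<Longrightarrow> \<psi> x = 0"
      using test_support[OF \<psi>] by metis
    obtain B where B: "\<And>x. \<bar>\<psi> x\<bar> \<le> B"
      using test_bounded[OF \<psi>] by metis
    have int: "integrable lebesgue (\<lambda>x. \<psi> x *\<^sub>R E x)" if "has_weak_grad u E" for E
    proof (rule Bochner_Integration.integrable_bound)
      have i: "integrable lebesgue (\<lambda>x. indicat_real (cball 0 R) x *\<^sub>R E x)"
        using that by (simp add: has_weak_grad_def set_integrable_def)
      show "integrable lebesgue (\<lambda>x. B * norm (indicat_real (cball 0 R) x *\<^sub>R E x))"
        using integrable_norm[OF i] by (rule integrable_mult_right)
      have e: "\<psi> x *\<^sub>R E x = \<psi> x *\<^sub>R (indicat_real (cball 0 R) x *\<^sub>R E x)" for x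
        using R[of x] by (cases "norm x \<le> R") auto
      show "(\<lambda>x. \<psi> x *\<^sub>R E x) \<in> borel_measurable lebesgue"
        unfolding e by (intro borel_measurable_scaleR[OF _ borel_measurable_integrable[OF i]] test_measurable(3)[OF \<psi>])
      show "AE x in lebesgue. norm (\<psi> x *\<^sub>R E x) \<le> norm (B * norm (indicat_real (cball 0 R) x *\<^sub>R E x))"
      proof (rule AE_I2)
        fix x
        have "norm (\<psi> x *\<^sub>R E x) \<le> B * norm (indicat_real (cball 0 R) x *\<^sub>R E x)"
          unfolding e norm_scaleR by (intro mult_right_mono B) auto
        then show "norm (\<psi> x *\<^sub>R E x) \<le> norm (B * norm (indicat_real (cball 0 R) x *\<^sub>R E x))"
          by simp
      qed
    qed
    have "(LINT x|lebesgue. \<psi> x *\<^sub>R G x) = (LINT x|lebesgue. \<psi> x *\<^sub>R H x)"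
      using assms \<psi> unfolding has_weak_grad_def by (metis neg_equal_iff_equal)
    then show "(LINT x|lebesgue. \<psi> x *\<^sub>R (G x - H x)) = 0"
      using int[OF assms(1)] int[OF assms(2)] by (simp add: scaleR_diff_right)
  qed
  then show ?thesis by simp
qed

text \<open>\<open>B_form\<close> refers to the representative picked by \<open>SOME\<close>; this
  allows any explicitly constructed weak gradient to replace it under an integral.\<close>

lemma weak_grad_AE:
  assumes "has_weak_grad u G"
  shows "AE x in lebesgue. weak_grad u x = G x"
proof -
  have "has_weak_grad u (weak_grad u)"
    unfolding weak_grad_def using someI[where P="has_weak_grad u", OF assms] by simp
  then show ?thesis using assms by (rule has_weak_grad_unique)
qed

section \<open>Limits in the square norm\<close>

lemma tendsto_0_ennrealI:
  fixes a :: "nat \<Rightarrow> ennreal"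
  assumes "\<And>\<epsilon>. 0 < \<epsilon> \<Longrightarrow> \<forall>\<^sub>F k in sequentially. a k \<le> ennreal \<epsilon>"
  shows "a \<longlonglongrightarrow> 0"
proof (rule order_tendstoI)
  fix c :: ennreal assume "0 < c"
  then obtain \<epsilon> where "0 < \<epsilon>" "ennreal \<epsilon> < c"
    by (metis dense ennreal_cases ennreal_less_zero_iff less_top_ennreal order_less_le_trans top_greatest)
  with eventually_mono[OF assms[of \<epsilon>], of "\<lambda>k. a k < c"] show "\<forall>\<^sub>F k in sequentially. a k < c"
    by auto
qed simp

lemma tendsto_0_ennrealD:
  fixes a :: "nat \<Rightarrow> ennreal"
  assumes "a \<longlonglongrightarrow> 0" "0 < \<epsilon>"
  shows "\<forall>\<^sub>F k in sequentially. a k < ennreal \<epsilon>"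
  using order_tendstoD(2)[OF assms(1), of "ennreal \<epsilon>"] assms(2) by simp

lemma nn_integral_le_of_tendsto:
  fixes F :: "nat \<Rightarrow> 'a \<Rightarrow> ennreal"
  assumes m: "\<And>j. F j \<in> borel_measurable M"
    and lim: "AE x in M. (\<lambda>j. F j x) \<longlonglongrightarrow> G x"
    and le: "\<forall>\<^sub>F j in sequentially. (\<integral>\<^sup>+x. F j x \<partial>M) \<le> c"
  shows "(\<integral>\<^sup>+x. G x \<partial>M) \<le> c"
proof -
  have "(\<integral>\<^sup>+x. G x \<partial>M) = (\<integral>\<^sup>+x. liminf (\<lambda>j. F j x) \<partial>M)"
    by (rule nn_integral_cong_AE) (use lim in \<open>auto elim!: eventually_mono dest: lim_imp_Liminf[rotated]\<close>)
  also have "\<dots> \<le> liminf (\<lambda>j. \<integral>\<^sup>+x. F j x \<partial>M)"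
    using m by (rule nn_integral_liminf)
  also have "\<dots> \<le> liminf (\<lambda>j. c)"
    using le by (rule Liminf_mono)
  finally show ?thesis by (simp add: Liminf_const)
qed

lemma AE_subseq_of_L2:
  fixes f :: "nat \<Rightarrow> 'a \<Rightarrow> real"
  assumes m: "\<And>k. f k \<in> borel_measurable M" "u \<in> borel_measurable M"
    and lim: "(\<lambda>k. \<integral>\<^sup>+x. ennreal ((f k x - u x)\<^sup>2) \<partial>M) \<longlonglongrightarrow> 0"
  obtains r where "strict_mono r" "AE x in M. (\<lambda>k. f (r k) x) \<longlonglongrightarrow> u x"
proof -
  \<comment> \<open>The integrals are known to be finite only from some index on, so the sequence is
    shifted before real-valued integrability is used.\<close>
  obtain N where N: "\<And>k. k \<ge> N \<Longrightarrow> (\<integral>\<^sup>+x. ennreal ((f k x - u x)\<^sup>2) \<partial>M) < ennreal 1"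
    using tendsto_0_ennrealD[OF lim, of 1] by (auto simp: eventually_sequentially)
  define g where "g k x = (f (k + N) x - u x)\<^sup>2" for k x
  have gm: "g k \<in> borel_measurable M" for k using m unfolding g_def by measurable
  have fin: "(\<integral>\<^sup>+x. ennreal (g k x) \<partial>M) < \<infinity>" for k
    using N[of "k + N"] unfolding g_def by (auto intro: less_trans)
  have gi: "integrable M (g k)" for k
    using fin gm by (intro integrableI_nonneg) (auto simp: g_def)
  have "(\<integral>x. norm (g k x) \<partial>M) = enn2real (\<integral>\<^sup>+x. ennreal (norm (g k x)) \<partial>M)" for k
    using gm[of k] by (intro integral_eq_nn_integral) auto
  then have "(\<lambda>k. \<integral>x. norm (g k x) \<partial>M) = (\<lambda>k. enn2real (\<integral>\<^sup>+x. ennreal ((f (k + N) x - u x)\<^sup>2) \<partial>M))"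
    by (simp add: g_def)
  moreover have "(\<lambda>k. \<integral>\<^sup>+x. ennreal ((f (k + N) x - u x)\<^sup>2) \<partial>M) \<longlonglongrightarrow> ennreal 0"
    using LIMSEQ_ignore_initial_segment[OF lim, of N] by simp
  note tendsto_enn2real[OF this]
  ultimately have "(\<lambda>k. \<integral>x. norm (g k x) \<partial>M) \<longlonglongrightarrow> 0" by simp
  from tendsto_L1_AE_subseq[OF gi this]
  obtain r where r: "strict_mono r" "AE x in M. (\<lambda>n. g (r n) x) \<longlonglongrightarrow> 0" by blast
  show thesis
  proof (rule that[of "\<lambda>k. r k + N"])
    show "strict_mono (\<lambda>k. r k + N)" using r(1) by (simp add: strict_mono_def)
    show "AE x in M. (\<lambda>k. f (r k + N) x) \<longlonglongrightarrow> u x"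
      using r(2)
    proof (rule AE_mp, intro AE_I2 impI)
      fix x assume "(\<lambda>n. g (r n) x) \<longlonglongrightarrow> 0"
      then have "(\<lambda>n. sqrt (g (r n) x)) \<longlonglongrightarrow> sqrt 0" by (rule tendsto_real_sqrt)
      then have "(\<lambda>n. \<bar>f (r n + N) x - u x\<bar>) \<longlonglongrightarrow> 0" by (simp add: g_def)
      then show "(\<lambda>k. f (r k + N) x) \<longlonglongrightarrow> u x"
        by (rule LIM_zero_cancel[OF tendsto_rabs_zero_cancel])
    qed
  qed
qed

text \<open>Completeness of L2 for vector-valued functions, phrased by extended-valued integrals of
  differences; it supplies the limit of the gradients.\<close>

lemma Riesz_Fischer:
  fixes g :: "nat \<Rightarrow> 'a \<Rightarrow> 'b::{banach, second_countable_topology}"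
  assumes m: "\<And>k. g k \<in> borel_measurable M"
    and cauchy: "\<And>\<epsilon>. 0 < \<epsilon> \<Longrightarrow> \<exists>N. \<forall>j\<ge>N. \<forall>k\<ge>N. (\<integral>\<^sup>+x. ennreal ((norm (g j x - g k x))\<^sup>2) \<partial>M) \<le> ennreal \<epsilon>"
  obtains G where "G \<in> borel_measurable M"
    "(\<lambda>k. \<integral>\<^sup>+x. ennreal ((norm (g k x - G x))\<^sup>2) \<partial>M) \<longlonglongrightarrow> 0"
proof -
  \<comment> \<open>The rate (1/8)^i leaves room for weights 4^i: the weighted sum of squared
    increments has finite integral, and where the sum is finite the increments are at most a
    multiple of (1/2)^i, hence summable.\<close>
  have "\<forall>i. \<exists>N. \<forall>j\<ge>N. \<forall>k\<ge>N. (\<integral>\<^sup>+x. ennreal ((norm (g j x - g k x))\<^sup>2) \<partial>M) \<le> ennreal ((1/8) ^ i)"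
    using cauchy by simp
  then obtain N where N: "\<And>i j k. j \<ge> N i \<Longrightarrow> k \<ge> N i \<Longrightarrow> (\<integral>\<^sup>+x. ennreal ((norm (g j x - g k x))\<^sup>2) \<partial>M) \<le> ennreal ((1/8) ^ i)"
    by metis
  define r where "r i = (\<Sum>l\<le>i. N l) + i" for i
  have r: "N i \<le> r i" "N i \<le> r (Suc i)" for i
  proof -
    have "N i \<le> (\<Sum>l\<le>i. N l)" by (rule member_le_sum) auto
    then show "N i \<le> r i" "N i \<le> r (Suc i)" by (auto simp: r_def)
  qed
  have r_ge: "i \<le> r i" for i by (simp add: r_def)
  define h where "h i x = (norm (g (r (Suc i)) x - g (r i) x))\<^sup>2" for i x
  have hm: "h i \<in> borel_measurable M" for i using m unfolding h_def by measurable
  have h0: "0 \<le> h i x" for i x by (simp add: h_def)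
  have "(\<integral>\<^sup>+x. (\<Sum>i. ennreal (4 ^ i * h i x)) \<partial>M) = (\<Sum>i. \<integral>\<^sup>+x. ennreal (4 ^ i * h i x) \<partial>M)"
    using hm by (intro nn_integral_suminf) measurable
  also have "\<dots> \<le> (\<Sum>i. ennreal ((1/2) ^ i))"
  proof (rule suminf_le)
    fix i
    have "(\<integral>\<^sup>+x. ennreal (4 ^ i * h i x) \<partial>M) = ennreal (4 ^ i) * (\<integral>\<^sup>+x. ennreal (h i x) \<partial>M)"
      using hm by (subst nn_integral_cmult[symmetric]) (auto simp: ennreal_mult h0)
    also have "\<dots> \<le> ennreal (4 ^ i) * ennreal ((1/8) ^ i)"
      unfolding h_def by (intro mult_left_mono N r) auto
    also have "\<dots> = ennreal ((1/2) ^ i)"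
      by (simp add: ennreal_mult[symmetric] power_mult_distrib[symmetric])
    finally show "(\<integral>\<^sup>+x. ennreal (4 ^ i * h i x) \<partial>M) \<le> ennreal ((1/2) ^ i)" .
  qed auto
  also have "\<dots> = ennreal (\<Sum>i. (1/2) ^ i)"
    by (rule suminf_ennreal2) (auto intro!: summable_geometric)
  also have "\<dots> < \<infinity>" by simp
  finally have "AE x in M. (\<Sum>i. ennreal (4 ^ i * h i x)) \<noteq> \<infinity>"
    using hm by (intro nn_integral_noteq_infinite) (auto simp: less_top[symmetric])
  then have conv: "AE x in M. convergent (\<lambda>i. g (r i) x)"
  proof (rule AE_mp, intro AE_I2 impI)
    fix x assume fin: "(\<Sum>i. ennreal (4 ^ i * h i x)) \<noteq> \<infinity>"
    define C where "C = enn2real (\<Sum>i. ennreal (4 ^ i * h i x))"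
    have C: "4 ^ i * h i x \<le> C" for i
    proof -
      have "ennreal (4 ^ i * h i x) = (\<Sum>j\<in>{i}. ennreal (4 ^ j * h j x))" by simp
      also have "\<dots> \<le> (\<Sum>i. ennreal (4 ^ i * h i x))" by (rule sum_le_suminf) auto
      finally have "ennreal (4 ^ i * h i x) \<le> ennreal C"
        using fin by (simp add: C_def less_top)
      then show ?thesis by (simp add: ennreal_le_iff2 C_def) (auto intro: order_trans)
    qed
    have "norm (g (r (Suc i)) x - g (r i) x) \<le> sqrt C * (1/2) ^ i" for i
    proof -
      have "(2 ^ i * norm (g (r (Suc i)) x - g (r i) x))\<^sup>2 \<le> C"
        using C[of i] by (simp add: h_def power_mult_distrib power_mult[symmetric] mult.commute[of i] power_mult)
      then have "2 ^ i * norm (g (r (Suc i)) x - g (r i) x) \<le> sqrt C"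
        by (rule real_le_rsqrt)
      then show ?thesis by (simp add: field_simps)
    qed
    note dist = this
    have S: "summable (\<lambda>i. sqrt C * (1/2) ^ i)"
      by (rule summable_mult, rule summable_geometric) simp
    have "summable (\<lambda>i. g (r (Suc i)) x - g (r i) x)"
      by (rule summable_comparison_test'[OF S, of 0], rule dist)
    then have "convergent (\<lambda>k. \<Sum>i<k. g (r (Suc i)) x - g (r i) x)"
      by (simp add: summable_iff_convergent)
    then have "convergent (\<lambda>k. g (r k) x - g (r 0) x)"
      by (simp only: sum_lessThan_telescope[of "\<lambda>i. g (r i) x"])
    from convergent_add[OF this convergent_const[of "g (r 0) x"]]
    show "convergent (\<lambda>i. g (r i) x)" by simp
  qed
  define G where "G x = lim (\<lambda>i. g (r i) x)" for x
  have Gm: "G \<in> borel_measurable M" unfolding G_def by (rule borel_measurable_lim_metric[OF m])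
  have lim: "AE x in M. (\<lambda>i. g (r i) x) \<longlonglongrightarrow> G x"
    using conv by eventually_elim (simp add: G_def convergent_LIMSEQ_iff)
  show thesis
  proof (rule that[OF Gm], rule tendsto_0_ennrealI)
    fix \<epsilon> :: real assume "0 < \<epsilon>"
    from cauchy[OF this] obtain L where L: "\<And>j k. j \<ge> L \<Longrightarrow> k \<ge> L \<Longrightarrow> (\<integral>\<^sup>+x. ennreal ((norm (g j x - g k x))\<^sup>2) \<partial>M) \<le> ennreal \<epsilon>"
      by blast
    have "(\<integral>\<^sup>+x. ennreal ((norm (g k x - G x))\<^sup>2) \<partial>M) \<le> ennreal \<epsilon>" if k: "k \<ge> L" for k
    proof (rule nn_integral_le_of_tendsto)
      show "(\<lambda>x. ennreal ((norm (g k x - g (r i) x))\<^sup>2)) \<in> borel_measurable M" for i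
        using m by measurable
      show "AE x in M. (\<lambda>i. ennreal ((norm (g k x - g (r i) x))\<^sup>2)) \<longlonglongrightarrow> ennreal ((norm (g k x - G x))\<^sup>2)"
        using lim by eventually_elim (intro tendsto_intros)
      show "\<forall>\<^sub>F i in sequentially. (\<integral>\<^sup>+x. ennreal ((norm (g k x - g (r i) x))\<^sup>2) \<partial>M) \<le> ennreal \<epsilon>"
        using eventually_ge_at_top[of L] by eventually_elim (intro L k order_trans[OF _ r_ge])
    qed
    then show "\<forall>\<^sub>F k in sequentially. (\<integral>\<^sup>+x. ennreal ((norm (g k x - G x))\<^sup>2) \<partial>M) \<le> ennreal \<epsilon>"
      by (auto simp: eventually_sequentially)
  qed
qed

section \<open>Limits of integrals of products\<close>

lemma nn_integral_Cauchy_Schwarz: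
  fixes f g :: "'a \<Rightarrow> real"
  assumes "f \<in> borel_measurable M" "g \<in> borel_measurable M"
  shows "(\<integral>\<^sup>+x. ennreal \<bar>f x * g x\<bar> \<partial>M)
    \<le> epow (\<integral>\<^sup>+x. ennreal ((f x)\<^sup>2) \<partial>M) (1/2) * epow (\<integral>\<^sup>+x. ennreal ((g x)\<^sup>2) \<partial>M) (1/2)"
proof -
  have "ennreal \<bar>f x * g x\<bar> = epow (ennreal ((f x)\<^sup>2)) (1/2) * epow (ennreal ((g x)\<^sup>2)) (1/2)" for x
    by (simp add: epow_ennreal powr_half_sqrt abs_mult ennreal_mult)
  then show ?thesis
    using nn_integral_Hoelder2[of "\<lambda>x. ennreal ((f x)\<^sup>2)" M "\<lambda>x. ennreal ((g x)\<^sup>2)" "1/2" "1/2"] assms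
    by simp
qed

lemma epow_tendsto_0:
  assumes "a \<longlonglongrightarrow> 0" "0 < r"
  shows "(\<lambda>k. epow (a k) r) \<longlonglongrightarrow> 0"
proof (rule tendsto_0_ennrealI)
  fix \<epsilon> :: real assume e: "0 < \<epsilon>"
  from tendsto_0_ennrealD[OF assms(1), of "\<epsilon> powr (1 / r)"]
  have "\<forall>\<^sub>F k in sequentially. a k < ennreal (\<epsilon> powr (1 / r))" using e by simp
  then show "\<forall>\<^sub>F k in sequentially. epow (a k) r \<le> ennreal \<epsilon>"
  proof eventually_elim
    case (elim k)
    have "epow (a k) r \<le> epow (ennreal (\<epsilon> powr (1 / r))) r"
      using elim assms(2) by (intro epow_mono) auto
    also have "\<dots> = ennreal \<epsilon>" using e assms(2) by (simp add: epow_ennreal powr_powr)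
    finally show ?case .
  qed
qed

lemma ennreal_mult_tendsto_0:
  fixes a :: "nat \<Rightarrow> ennreal"
  assumes "a \<longlonglongrightarrow> 0" "c \<noteq> top"
  shows "(\<lambda>k. a k * c) \<longlonglongrightarrow> 0"
  using tendsto_mult_ennreal[OF assms(1) tendsto_const[of c]] assms(2) by simp

text \<open>By Cauchy-Schwarz an error that tends to 0 in L2, times a fixed function in L2, tends to
  0 in L1. Both sides of the weak gradient identity pass to the limit in this way.\<close>

lemma integral_tendsto_of_L2:
  fixes h :: "nat \<Rightarrow> 'a \<Rightarrow> 'b::{banach, second_countable_topology}"
  assumes h: "\<And>k. integrable M (h k)" and H: "H \<in> borel_measurable M"
    and e: "\<And>k. e k \<in> borel_measurable M" "(\<lambda>k. \<integral>\<^sup>+x. ennreal ((e k x)\<^sup>2) \<partial>M) \<longlonglongrightarrow> 0"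
    and c: "c \<in> borel_measurable M" "(\<integral>\<^sup>+x. ennreal ((c x)\<^sup>2) \<partial>M) < top"
    and le: "\<And>k x. norm (h k x - H x) \<le> \<bar>e k x * c x\<bar>"
  shows "integrable M H" "(\<lambda>k. LINT x|M. h k x) \<longlonglongrightarrow> (LINT x|M. H x)"
proof -
  let ?C = "\<integral>\<^sup>+x. ennreal ((c x)\<^sup>2) \<partial>M"
  have bd: "(\<integral>\<^sup>+x. ennreal (norm (h k x - H x)) \<partial>M) \<le> epow (\<integral>\<^sup>+x. ennreal ((e k x)\<^sup>2) \<partial>M) (1/2) * epow ?C (1/2)" for k
    by (rule order_trans[OF nn_integral_mono nn_integral_Cauchy_Schwarz[OF e(1) c(1)]]) (auto intro: ennreal_leI le)
  have "epow ?C (1/2) \<noteq> top" using c(2) by (auto simp: epow_def)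
  then have "(\<lambda>k. epow (\<integral>\<^sup>+x. ennreal ((e k x)\<^sup>2) \<partial>M) (1/2) * epow ?C (1/2)) \<longlonglongrightarrow> 0"
    by (intro ennreal_mult_tendsto_0 epow_tendsto_0 e) auto
  then have lim: "(\<lambda>k. \<integral>\<^sup>+x. ennreal (norm (h k x - H x)) \<partial>M) \<longlonglongrightarrow> 0"
    by (rule tendsto_sandwich[rotated 3, OF _ _ _ tendsto_const]) (auto intro!: always_eventually bd)
  from tendsto_0_ennrealD[OF this, of 1] obtain k where k: "(\<integral>\<^sup>+x. ennreal (norm (h k x - H x)) \<partial>M) < 1"
    by (auto simp: eventually_sequentially)
  have "integrable M (\<lambda>x. h k x - H x)"
    using h H k by (intro integrableI_bounded) (auto intro: less_trans)
  from Bochner_Integration.integrable_diff[OF h[of k] this] show I: "integrable M H" by simp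
  show "(\<lambda>k. LINT x|M. h k x) \<longlonglongrightarrow> (LINT x|M. H x)"
    by (rule tendsto_L1_int[OF h I lim])
qed

section \<open>Measurability and lower semicontinuity of the Gagliardo seminorm\<close>

lemma lebesgue_id_measurable: "(\<lambda>x::'a::euclidean_space. x) \<in> borel_measurable lebesgue"
  by (rule measurable_completion) simp

lemma gagliardo_pair_measurable:
  fixes v :: "'a::euclidean_space \<Rightarrow> real"
  assumes v: "v \<in> borel_measurable lebesgue"
  shows "(\<lambda>(y, x). ennreal ((v x - v y)\<^sup>2 / norm (x - y) powr q)) \<in> borel_measurable (lebesgue \<Otimes>\<^sub>M lebesgue)"
proof -
  have [measurable]: "(\<lambda>p. v (fst p)) \<in> borel_measurable (lebesgue \<Otimes>\<^sub>M (lebesgue :: 'a measure))"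
      "(\<lambda>p. v (snd p)) \<in> borel_measurable ((lebesgue :: 'a measure) \<Otimes>\<^sub>M lebesgue)"
      "(\<lambda>p. fst p) \<in> borel_measurable (lebesgue \<Otimes>\<^sub>M (lebesgue :: 'a measure))"
      "(\<lambda>p. snd p) \<in> borel_measurable ((lebesgue :: 'a measure) \<Otimes>\<^sub>M lebesgue)"
    by (rule measurable_compose[OF measurable_fst v] measurable_compose[OF measurable_snd v]
        measurable_compose[OF measurable_fst lebesgue_id_measurable]
        measurable_compose[OF measurable_snd lebesgue_id_measurable])+
  show ?thesis unfolding case_prod_beta' by measurable
qed

lemma gagliardo_inner_measurable:
  fixes v :: "'a::euclidean_space \<Rightarrow> real"
  assumes v: "v \<in> borel_measurable lebesgue"
  shows "(\<lambda>x. ennreal ((v x - v y)\<^sup>2 / norm (x - y) powr q)) \<in> borel_measurable lebesgue"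
    and "(\<lambda>y. \<integral>\<^sup>+x. ennreal ((v x - v y)\<^sup>2 / norm (x - y) powr q) \<partial>lebesgue) \<in> borel_measurable lebesgue"
proof -
  note m = gagliardo_pair_measurable[OF v, of q]
  show "(\<lambda>x. ennreal ((v x - v y)\<^sup>2 / norm (x - y) powr q)) \<in> borel_measurable lebesgue"
    using measurable_compose[OF measurable_Pair1' m, of y] by simp
  show "(\<lambda>y. \<integral>\<^sup>+x. ennreal ((v x - v y)\<^sup>2 / norm (x - y) powr q) \<partial>lebesgue) \<in> borel_measurable lebesgue"
    using sigma_finite_measure.borel_measurable_nn_integral[OF sigma_finite_lebesgue m] by simp
qed

text \<open>The seminorm is an iterated integral, so Fatou is applied once in each variable. The
  inner application freezes \<open>y\<close> and needs convergence at that point, which holds for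
  almost every \<open>y\<close>.\<close>

lemma gagliardo_sq_le_of_tendsto:
  fixes v :: "nat \<Rightarrow> 'a::euclidean_space \<Rightarrow> real"
  assumes v: "\<And>j. v j \<in> borel_measurable lebesgue"
    and lim: "AE x in lebesgue. (\<lambda>j. v j x) \<longlonglongrightarrow> w x"
    and le: "\<forall>\<^sub>F j in sequentially. gagliardo_sq s (v j) \<le> c"
  shows "gagliardo_sq s w \<le> c"
proof -
  define q where "q = real DIM('a) + 2 * s"
  define I where "I j y = (\<integral>\<^sup>+x. ennreal ((v j x - v j y)\<^sup>2 / norm (x - y) powr q) \<partial>lebesgue)" for j y
  have Im: "I j \<in> borel_measurable lebesgue" for j
    unfolding I_def using v by (rule gagliardo_inner_measurable)
  have inner: "(\<integral>\<^sup>+x. ennreal ((w x - w y)\<^sup>2 / norm (x - y) powr q) \<partial>lebesgue) \<le> liminf (\<lambda>j. I j y)"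
    if y: "(\<lambda>j. v j y) \<longlonglongrightarrow> w y" for y
  proof -
    have "AE x in lebesgue. (\<lambda>j. ennreal ((v j x - v j y)\<^sup>2 / norm (x - y) powr q)) \<longlonglongrightarrow> ennreal ((w x - w y)\<^sup>2 / norm (x - y) powr q)"
      using lim
    proof eventually_elim
      case (elim x)
      then have "(\<lambda>j. (v j x - v j y)\<^sup>2 * inverse (norm (x - y) powr q)) \<longlonglongrightarrow> (w x - w y)\<^sup>2 * inverse (norm (x - y) powr q)"
        using y by (intro tendsto_intros)
      then show ?case by (intro tendsto_ennrealI) (simp add: divide_inverse)
    qed
    then have "(\<integral>\<^sup>+x. ennreal ((w x - w y)\<^sup>2 / norm (x - y) powr q) \<partial>lebesgue)
        = (\<integral>\<^sup>+x. liminf (\<lambda>j. ennreal ((v j x - v j y)\<^sup>2 / norm (x - y) powr q)) \<partial>lebesgue)"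
      by (intro nn_integral_cong_AE, elim eventually_mono, intro lim_imp_Liminf[symmetric]) simp_all
    also have "\<dots> \<le> liminf (\<lambda>j. I j y)"
      unfolding I_def by (intro nn_integral_liminf gagliardo_inner_measurable v)
    finally show ?thesis .
  qed
  have "gagliardo_sq s w \<le> (\<integral>\<^sup>+y. liminf (\<lambda>j. I j y) \<partial>lebesgue)"
    unfolding gagliardo_sq_def q_def[symmetric]
    by (rule nn_integral_mono_AE) (use lim inner in \<open>auto elim!: eventually_mono\<close>)
  also have "\<dots> \<le> liminf (\<lambda>j. \<integral>\<^sup>+y. I j y \<partial>lebesgue)"
    using Im by (rule nn_integral_liminf)
  also have "\<dots> \<le> liminf (\<lambda>j. c)"
    using le unfolding gagliardo_sq_def q_def[symmetric] I_def[symmetric] by (rule Liminf_mono)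
  finally show ?thesis by (simp add: Liminf_const)
qed

lemma test_nn_integral_finite:
  fixes \<phi> :: "'a::euclidean_space \<Rightarrow> real"
  assumes \<phi>: "\<phi> \<in> test_functions \<Omega>" and p: "0 < p"
  shows "(\<integral>\<^sup>+x. ennreal (\<bar>\<phi> x\<bar> powr p) \<partial>lebesgue) < top"
    "(\<integral>\<^sup>+x. ennreal ((norm (grad \<phi> x))\<^sup>2) \<partial>lebesgue) < top"
proof -
  obtain R where R: "\<And>x. norm x \<ge> R \<Longrightarrow> \<phi> x = 0" "\<And>x. norm x \<ge> R \<Longrightarrow> grad \<phi> x = 0"
    using test_support[OF \<phi>] by metis
  have "integrable lebesgue (\<lambda>x. \<bar>\<phi> x\<bar> powr p)"
  proof (rule integrable_continuous_support(2)[where R=R])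
    show "continuous_on UNIV (\<lambda>x. \<bar>\<phi> x\<bar> powr p)"
      using p by (intro continuous_on_powr' continuous_on_rabs continuous_on_const test_continuous[OF \<phi>]) auto
  qed (use R in auto)
  then show "(\<integral>\<^sup>+x. ennreal (\<bar>\<phi> x\<bar> powr p) \<partial>lebesgue) < top"
    by (simp add: integrable_iff_bounded)
  have "integrable lebesgue (\<lambda>x. (norm (grad \<phi> x))\<^sup>2)"
    by (rule integrable_continuous_support(2)[where R=R])
       (use R in \<open>auto intro!: continuous_intros test_continuous_grad[OF \<phi>]\<close>)
  then show "(\<integral>\<^sup>+x. ennreal ((norm (grad \<phi> x))\<^sup>2) \<partial>lebesgue) < top"
    by (simp add: integrable_iff_bounded)
qed

lemma abs_powr_add_le:
  fixes a b p :: real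
  assumes "0 \<le> p"
  shows "\<bar>a + b\<bar> powr p \<le> 2 powr p * (\<bar>a\<bar> powr p + \<bar>b\<bar> powr p)"
proof -
  have "\<bar>a + b\<bar> powr p \<le> (2 * max \<bar>a\<bar> \<bar>b\<bar>) powr p"
    using assms by (intro powr_mono2) auto
  also have "\<dots> = 2 powr p * (max \<bar>a\<bar> \<bar>b\<bar>) powr p" by (simp add: powr_mult)
  also have "\<dots> \<le> 2 powr p * (\<bar>a\<bar> powr p + \<bar>b\<bar> powr p)"
    by (intro mult_left_mono) (auto simp: max_def)
  finally show ?thesis .
qed

lemma norm_diff_square_le: "(norm (a - b))\<^sup>2 \<le> 2 * (norm a)\<^sup>2 + 2 * (norm b)\<^sup>2"
  for a b :: "'a::real_normed_vector"
proof -
  have "(norm (a - b))\<^sup>2 \<le> (norm a + norm b)\<^sup>2"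
    by (intro power_mono norm_triangle_ineq4) auto
  also have "\<dots> \<le> 2 * (norm a)\<^sup>2 + 2 * (norm b)\<^sup>2"
    using sum_squares_bound[of "norm a" "norm b"] by (simp add: power2_sum)
  finally show ?thesis .
qed

lemma nn_integral_square_limit_finite:
  fixes G :: "'a \<Rightarrow> 'b::{banach, second_countable_topology}"
  assumes m: "\<And>k. g k \<in> borel_measurable M" "G \<in> borel_measurable M"
    and fin: "\<And>k::nat. (\<integral>\<^sup>+x. ennreal ((norm (g k x))\<^sup>2) \<partial>M) < top"
    and lim: "(\<lambda>k. \<integral>\<^sup>+x. ennreal ((norm (g k x - G x))\<^sup>2) \<partial>M) \<longlonglongrightarrow> 0"
  shows "(\<integral>\<^sup>+x. ennreal ((norm (G x))\<^sup>2) \<partial>M) < top"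
proof -
  obtain k where k: "(\<integral>\<^sup>+x. ennreal ((norm (g k x - G x))\<^sup>2) \<partial>M) < 1"
    using tendsto_0_ennrealD[OF lim, of 1] by (auto simp: eventually_sequentially)
  have "(\<integral>\<^sup>+x. ennreal ((norm (G x))\<^sup>2) \<partial>M)
      \<le> (\<integral>\<^sup>+x. 2 * ennreal ((norm (g k x))\<^sup>2) + 2 * ennreal ((norm (g k x - G x))\<^sup>2) \<partial>M)"
  proof (rule nn_integral_mono)
    fix x
    have "ennreal ((norm (G x))\<^sup>2) \<le> ennreal (2 * (norm (g k x))\<^sup>2 + 2 * (norm (g k x - G x))\<^sup>2)"
      using norm_diff_square_le[of "g k x" "g k x - G x"] by (intro ennreal_leI) simp
    then show "ennreal ((norm (G x))\<^sup>2) \<le> 2 * ennreal ((norm (g k x))\<^sup>2) + 2 * ennreal ((norm (g k x - G x))\<^sup>2)"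
      by (simp add: ennreal_mult)
  qed
  also have "\<dots> = 2 * (\<integral>\<^sup>+x. ennreal ((norm (g k x))\<^sup>2) \<partial>M) + 2 * (\<integral>\<^sup>+x. ennreal ((norm (g k x - G x))\<^sup>2) \<partial>M)"
    using m by (simp add: nn_integral_add nn_integral_cmult)
  also have "\<dots> < top"
    using fin[of k] k by (auto simp: ennreal_mult_less_top intro: less_trans)
  finally show ?thesis .
qed

lemma locally_integrable_of_L2:
  fixes g :: "'a::euclidean_space \<Rightarrow> 'b::{banach, second_countable_topology}"
  assumes m: "g \<in> borel_measurable lebesgue" and fin: "(\<integral>\<^sup>+x. ennreal ((norm (g x))\<^sup>2) \<partial>lebesgue) < top"
    and K: "compact K"
  shows "set_integrable lebesgue K g"
  unfolding set_integrable_def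
proof (rule integrableI_bounded)
  have Km: "K \<in> sets lebesgue" using K by (simp add: compact_imp_closed)
  then show "(\<lambda>x. indicat_real K x *\<^sub>R g x) \<in> borel_measurable lebesgue"
    using m by measurable
  have "(\<integral>\<^sup>+x. ennreal (norm (indicat_real K x *\<^sub>R g x)) \<partial>lebesgue)
     \<le> (\<integral>\<^sup>+x. indicator K x + ennreal ((norm (g x))\<^sup>2) \<partial>lebesgue)"
  proof (rule nn_integral_mono)
    fix x
    have "norm (g x) \<le> 1 + (norm (g x))\<^sup>2"
      using sum_squares_bound[of 1 "norm (g x)"] norm_ge_zero[of "g x"]
      unfolding power2_eq_square by linarith
    then have "ennreal (norm (g x)) \<le> 1 + ennreal ((norm (g x))\<^sup>2)"
      by (metis ennreal_1 ennreal_leI ennreal_plus zero_le_one zero_le_power2)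
    then show "ennreal (norm (indicat_real K x *\<^sub>R g x)) \<le> indicator K x + ennreal ((norm (g x))\<^sup>2)"
      by (auto simp: indicator_def)
  qed
  also have "\<dots> = emeasure lebesgue K + (\<integral>\<^sup>+x. ennreal ((norm (g x))\<^sup>2) \<partial>lebesgue)"
    using Km m by (subst nn_integral_add) auto
  also have "\<dots> < \<infinity>"
    using fin emeasure_bounded_finite[of K] K by (simp add: compact_imp_bounded emeasure_completion compact_imp_closed)
  finally show "(\<integral>\<^sup>+x. ennreal (norm (indicat_real K x *\<^sub>R g x)) \<partial>lebesgue) < \<infinity>" .
qed

text \<open>The classical identity holds for every \<open>\<phi> k\<close>, and each side is
  continuous under L2 convergence of the functions and of the gradients respectively.\<close>

lemma has_weak_grad_limit:
  fixes u :: "'a::euclidean_space \<Rightarrow> real"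
  assumes \<phi>: "\<And>k. \<phi> k \<in> test_functions \<Omega>"
    and m: "u \<in> borel_measurable lebesgue" "G \<in> borel_measurable lebesgue"
    and lim: "(\<lambda>k. \<integral>\<^sup>+x. ennreal ((\<phi> k x - u x)\<^sup>2) \<partial>lebesgue) \<longlonglongrightarrow> 0"
      "(\<lambda>k. \<integral>\<^sup>+x. ennreal ((norm (grad (\<phi> k) x - G x))\<^sup>2) \<partial>lebesgue) \<longlonglongrightarrow> 0"
  shows "has_weak_grad u G"
    and "(\<integral>\<^sup>+x. ennreal ((norm (G x))\<^sup>2) \<partial>lebesgue) < top"
proof -
  note tm = test_measurable(3,4)[OF \<phi>]
  have f1: "(\<integral>\<^sup>+x. ennreal ((norm (\<phi> k x))\<^sup>2) \<partial>lebesgue) < top" for k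
    using test_nn_integral_finite(1)[OF \<phi>, of 2 k] by simp
  have u2: "(\<integral>\<^sup>+x. ennreal ((norm (u x))\<^sup>2) \<partial>lebesgue) < top"
    by (rule nn_integral_square_limit_finite[OF tm(1) m(1) f1]) (use lim in simp)
  show G2: "(\<integral>\<^sup>+x. ennreal ((norm (G x))\<^sup>2) \<partial>lebesgue) < top"
    by (rule nn_integral_square_limit_finite[OF tm(2) m(2) _ lim(2)]) (rule test_nn_integral_finite(2)[OF \<phi>, of 1], simp)
  show "has_weak_grad u G"
    unfolding has_weak_grad_def
  proof (intro conjI allI impI ballI)
    show "u absolutely_integrable_on K" "G absolutely_integrable_on K" if "compact K" for K
      using that m u2 G2 by (auto intro: locally_integrable_of_L2)
    fix \<psi> :: "'a \<Rightarrow> real" assume \<psi>: "\<psi> \<in> test_functions UNIV"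
    obtain R where R: "\<And>x. norm x \<ge> R \<Longrightarrow> \<psi> x = 0" "\<And>x. norm x \<ge> R \<Longrightarrow> grad \<psi> x = 0"
      using test_support[OF \<psi>] by metis
    note pm = test_measurable(3,4)[OF \<psi>]
    note c = test_continuous[OF \<psi>] test_continuous_grad[OF \<psi>] test_continuous[OF \<phi>] test_continuous_grad[OF \<phi>]
    have i1: "integrable lebesgue (\<lambda>x. \<phi> k x *\<^sub>R grad \<psi> x)" for k
      by (rule integrable_continuous_support(2)[where R=R]) (use R c in \<open>auto intro!: continuous_intros\<close>)
    have i2: "integrable lebesgue (\<lambda>x. \<psi> x *\<^sub>R grad (\<phi> k) x)" for k
      by (rule integrable_continuous_support(2)[where R=R]) (use R c in \<open>auto intro!: continuous_intros\<close>)
    have l1: "(\<lambda>k. LINT x|lebesgue. \<phi> k x *\<^sub>R grad \<psi> x) \<longlonglongrightarrow> (LINT x|lebesgue. u x *\<^sub>R grad \<psi> x)"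
    proof (rule integral_tendsto_of_L2(2)[where e="\<lambda>k x. \<phi> k x - u x" and c="\<lambda>x. norm (grad \<psi> x)"])
      show "(\<lambda>x. u x *\<^sub>R grad \<psi> x) \<in> borel_measurable lebesgue" using m pm by measurable
      show "(\<lambda>x. \<phi> k x - u x) \<in> borel_measurable lebesgue" for k using m tm by measurable
      show "(\<lambda>x. norm (grad \<psi> x)) \<in> borel_measurable lebesgue" using pm by measurable
      show "(\<integral>\<^sup>+x. ennreal ((norm (grad \<psi> x))\<^sup>2) \<partial>lebesgue) < top"
        by (rule test_nn_integral_finite(2)[OF \<psi>, of 1]) simp
      show "norm (\<phi> k x *\<^sub>R grad \<psi> x - u x *\<^sub>R grad \<psi> x) \<le> \<bar>(\<phi> k x - u x) * norm (grad \<psi> x)\<bar>" for k x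
        by (simp add: scaleR_diff_left[symmetric] abs_mult)
    qed (use i1 lim(1) in auto)
    have l2: "(\<lambda>k. LINT x|lebesgue. \<psi> x *\<^sub>R grad (\<phi> k) x) \<longlonglongrightarrow> (LINT x|lebesgue. \<psi> x *\<^sub>R G x)"
    proof (rule integral_tendsto_of_L2(2)[where e="\<lambda>k x. norm (grad (\<phi> k) x - G x)" and c=\<psi>])
      show "(\<lambda>x. \<psi> x *\<^sub>R G x) \<in> borel_measurable lebesgue" using m pm by measurable
      show "(\<lambda>x. norm (grad (\<phi> k) x - G x)) \<in> borel_measurable lebesgue" for k using m tm by measurable
      show "\<psi> \<in> borel_measurable lebesgue" using pm by simp
      show "(\<integral>\<^sup>+x. ennreal ((\<psi> x)\<^sup>2) \<partial>lebesgue) < top"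
        using test_nn_integral_finite(1)[OF \<psi>, of 2] by simp
      show "norm (\<psi> x *\<^sub>R grad (\<phi> k) x - \<psi> x *\<^sub>R G x) \<le> \<bar>norm (grad (\<phi> k) x - G x) * \<psi> x\<bar>" for k x
        by (simp add: scaleR_diff_right[symmetric] abs_mult mult.commute)
    qed (use i2 lim(2) in auto)
    have e: "(LINT x|lebesgue. \<phi> k x *\<^sub>R grad \<psi> x) = - (LINT x|lebesgue. \<psi> x *\<^sub>R grad (\<phi> k) x)" for k
      using has_weak_grad_test[OF \<phi>[of k]] \<psi> unfolding has_weak_grad_def by blast
    have "(\<lambda>k. LINT x|lebesgue. \<phi> k x *\<^sub>R grad \<psi> x) \<longlonglongrightarrow> - (LINT x|lebesgue. \<psi> x *\<^sub>R G x)"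
      unfolding e by (intro tendsto_minus l2)
    with l1 show "(LINT x|lebesgue. u x *\<^sub>R grad \<psi> x) = - (LINT x|lebesgue. \<psi> x *\<^sub>R G x)"
      by (rule LIMSEQ_unique)
  qed
qed

section \<open>Approximation by test functions\<close>

text \<open>Everything that is used about an element of the completion. Gradients converge by
  completeness of L2. For the seminorm and for the critical norm, the Cauchy estimate between
  \<open>\<phi> j\<close> and \<open>\<phi> k\<close> survives the limit in \<open>j\<close> by
  Fatou, in the second case after the Sobolev inequality for the difference.\<close>

lemma X_space_approx:
  fixes u :: "'a::euclidean_space \<Rightarrow> real"
  assumes n: "3 \<le> DIM('a)" and u: "u \<in> X_space s \<Omega>"
  defines "p \<equiv> two_star DIM('a)"
  obtains \<phi> G where "\<And>k::nat. \<phi> k \<in> test_functions \<Omega>"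
    "G \<in> borel_measurable lebesgue" "has_weak_grad u G"
    "(\<integral>\<^sup>+x. ennreal ((norm (G x))\<^sup>2) \<partial>lebesgue) < top"
    "AE x in lebesgue. (\<lambda>k. \<phi> k x) \<longlonglongrightarrow> u x"
    "(\<lambda>k. \<integral>\<^sup>+x. ennreal ((norm (grad (\<phi> k) x - G x))\<^sup>2) \<partial>lebesgue) \<longlonglongrightarrow> 0"
    "(\<lambda>k. gagliardo_sq s (\<lambda>x. u x - \<phi> k x)) \<longlonglongrightarrow> 0"
    "(\<lambda>k. \<integral>\<^sup>+x. ennreal (\<bar>u x - \<phi> k x\<bar> powr p) \<partial>lebesgue) \<longlonglongrightarrow> 0"
    "(\<integral>\<^sup>+x. ennreal (\<bar>u x\<bar> powr p) \<partial>lebesgue) < top"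
proof -
  define \<gamma> where "\<gamma> = 2 * (real DIM('a) - 1) / (real DIM('a) - 2)"
  have p0: "0 < p" using n by (simp add: p_def two_star_def)
  from u obtain \<phi>0 :: "nat \<Rightarrow> 'a \<Rightarrow> real" where um: "u \<in> borel_measurable lebesgue"
    and t0: "\<And>k. \<phi>0 k \<in> test_functions \<Omega>"
    and c0: "\<And>\<epsilon>. 0 < \<epsilon> \<Longrightarrow> \<exists>N. \<forall>j\<ge>N. \<forall>k\<ge>N. X_norm_sq s (\<lambda>x. \<phi>0 j x - \<phi>0 k x) < ennreal (\<epsilon>\<^sup>2)"
    and l0: "(\<lambda>k. \<integral>\<^sup>+x. ennreal ((\<phi>0 k x - u x)\<^sup>2) \<partial>lebesgue) \<longlonglongrightarrow> 0"
    unfolding X_space_def by blast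
  \<comment> \<open>Fatou needs a pointwise limit; a subsequence of the L2-convergent sequence has
    one and stays Cauchy.\<close>
  obtain r where r: "strict_mono r" "AE x in lebesgue. (\<lambda>k. \<phi>0 (r k) x) \<longlonglongrightarrow> u x"
    using AE_subseq_of_L2[OF test_measurable(3)[OF t0] um l0] by metis
  define \<phi> where "\<phi> k = \<phi>0 (r k)" for k
  have \<phi>: "\<phi> k \<in> test_functions \<Omega>" for k using t0 by (simp add: \<phi>_def)
  note tm = test_measurable(3,4)[OF \<phi>]
  have ae: "AE x in lebesgue. (\<lambda>k. \<phi> k x) \<longlonglongrightarrow> u x" using r(2) by (simp add: \<phi>_def)
  have c: "\<exists>N. \<forall>j\<ge>N. \<forall>k\<ge>N. X_norm_sq s (\<lambda>x. \<phi> j x - \<phi> k x) \<le> ennreal \<epsilon>" if "0 < \<epsilon>" for \<epsilon>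
  proof -
    have "0 < sqrt \<epsilon>" using that by simp
    from c0[OF this] obtain N where N: "\<And>j k. j \<ge> N \<Longrightarrow> k \<ge> N \<Longrightarrow> X_norm_sq s (\<lambda>x. \<phi>0 j x - \<phi>0 k x) < ennreal ((sqrt \<epsilon>)\<^sup>2)"
      by blast
    have "X_norm_sq s (\<lambda>x. \<phi> j x - \<phi> k x) \<le> ennreal \<epsilon>" if "j \<ge> N" "k \<ge> N" for j k
      using N[of "r j" "r k"] that seq_suble[OF r(1), of j] seq_suble[OF r(1), of k] \<open>0 < \<epsilon>\<close>
      by (simp add: \<phi>_def)
    then show ?thesis by blast
  qed
  have gr: "(\<integral>\<^sup>+x. ennreal ((norm (grad (\<phi> j) x - grad (\<phi> k) x))\<^sup>2) \<partial>lebesgue) \<le> X_norm_sq s (\<lambda>x. \<phi> j x - \<phi> k x)"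
    and ga: "gagliardo_sq s (\<lambda>x. \<phi> j x - \<phi> k x) \<le> X_norm_sq s (\<lambda>x. \<phi> j x - \<phi> k x)" for j k
    by (simp_all add: X_norm_sq_def grad_test_diff[OF \<phi> \<phi>])
  have l2: "(\<lambda>k. \<integral>\<^sup>+x. ennreal ((\<phi> k x - u x)\<^sup>2) \<partial>lebesgue) \<longlonglongrightarrow> 0"
    using LIMSEQ_subseq_LIMSEQ[OF l0 r(1)] by (simp add: \<phi>_def o_def)
  obtain G where G: "G \<in> borel_measurable lebesgue"
    "(\<lambda>k. \<integral>\<^sup>+x. ennreal ((norm (grad (\<phi> k) x - G x))\<^sup>2) \<partial>lebesgue) \<longlonglongrightarrow> 0"
  proof (rule Riesz_Fischer[OF tm(2)])
    fix \<epsilon> :: real assume "0 < \<epsilon>"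
    from c[OF this] show "\<exists>N. \<forall>j\<ge>N. \<forall>k\<ge>N. (\<integral>\<^sup>+x. ennreal ((norm (grad (\<phi> j) x - grad (\<phi> k) x))\<^sup>2) \<partial>lebesgue) \<le> ennreal \<epsilon>"
      using order_trans[OF gr] by meson
  qed
  have gag: "(\<lambda>k. gagliardo_sq s (\<lambda>x. u x - \<phi> k x)) \<longlonglongrightarrow> 0"
  proof (rule tendsto_0_ennrealI)
    fix \<epsilon> :: real assume "0 < \<epsilon>"
    from c[OF this] obtain N where N: "\<And>j k. j \<ge> N \<Longrightarrow> k \<ge> N \<Longrightarrow> X_norm_sq s (\<lambda>x. \<phi> j x - \<phi> k x) \<le> ennreal \<epsilon>"
      by blast
    have "gagliardo_sq s (\<lambda>x. u x - \<phi> k x) \<le> ennreal \<epsilon>" if k: "k \<ge> N" for k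
    proof (rule gagliardo_sq_le_of_tendsto[where v="\<lambda>j x. \<phi> j x - \<phi> k x"])
      show "(\<lambda>x. \<phi> j x - \<phi> k x) \<in> borel_measurable lebesgue" for j using tm by measurable
      show "AE x in lebesgue. (\<lambda>j. \<phi> j x - \<phi> k x) \<longlonglongrightarrow> u x - \<phi> k x"
        using ae by eventually_elim (intro tendsto_intros)
      show "\<forall>\<^sub>F j in sequentially. gagliardo_sq s (\<lambda>x. \<phi> j x - \<phi> k x) \<le> ennreal \<epsilon>"
        using eventually_ge_at_top[of N] by eventually_elim (rule order_trans[OF ga N[OF _ k]])
    qed
    then show "\<forall>\<^sub>F k in sequentially. gagliardo_sq s (\<lambda>x. u x - \<phi> k x) \<le> ennreal \<epsilon>"
      by (auto simp: eventually_sequentially)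
  qed
  have sob: "(\<integral>\<^sup>+x. ennreal (\<bar>\<phi> j x - \<phi> k x\<bar> powr p) \<partial>lebesgue)
      \<le> epow (ennreal (\<gamma>\<^sup>2) * X_norm_sq s (\<lambda>x. \<phi> j x - \<phi> k x)) (p / 2)" for j k
  proof -
    let ?J = "\<integral>\<^sup>+x. ennreal (\<bar>\<phi> j x - \<phi> k x\<bar> powr p) \<partial>lebesgue"
    have "epow ?J (2 / p) \<le> ennreal (\<gamma>\<^sup>2) * (\<integral>\<^sup>+x. ennreal ((norm (grad (\<lambda>x. \<phi> j x - \<phi> k x) x))\<^sup>2) \<partial>lebesgue)"
      unfolding p_def \<gamma>_def by (rule Sobolev_test[OF n test_diff[OF \<phi> \<phi>]])
    also have "\<dots> \<le> ennreal (\<gamma>\<^sup>2) * X_norm_sq s (\<lambda>x. \<phi> j x - \<phi> k x)"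
      by (intro mult_left_mono) (auto simp: X_norm_sq_def)
    finally have "epow (epow ?J (2 / p)) (p / 2) \<le> epow (ennreal (\<gamma>\<^sup>2) * X_norm_sq s (\<lambda>x. \<phi> j x - \<phi> k x)) (p / 2)"
      using p0 by (intro epow_mono) auto
    then show ?thesis using p0 by (simp add: epow_epow)
  qed
  have Lp: "(\<lambda>k. \<integral>\<^sup>+x. ennreal (\<bar>u x - \<phi> k x\<bar> powr p) \<partial>lebesgue) \<longlonglongrightarrow> 0"
  proof (rule tendsto_0_ennrealI)
    fix \<epsilon> :: real assume e: "0 < \<epsilon>"
    \<comment> \<open>Dividing by \<open>\<gamma>\<^sup>2 + 1\<close> instead of
      \<open>\<gamma>\<^sup>2\<close> keeps the threshold positive without any case distinction on
      \<open>\<gamma>\<close>.\<close>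
    have g: "0 < \<gamma>\<^sup>2 + 1" by (simp add: add_nonneg_pos)
    then have "0 < \<epsilon> powr (2 / p) / (\<gamma>\<^sup>2 + 1)" using e by simp
    from c[OF this] obtain N where N: "\<And>j k. j \<ge> N \<Longrightarrow> k \<ge> N \<Longrightarrow> X_norm_sq s (\<lambda>x. \<phi> j x - \<phi> k x) \<le> ennreal (\<epsilon> powr (2 / p) / (\<gamma>\<^sup>2 + 1))"
      by blast
    have "(\<integral>\<^sup>+x. ennreal (\<bar>u x - \<phi> k x\<bar> powr p) \<partial>lebesgue) \<le> ennreal \<epsilon>" if k: "k \<ge> N" for k
    proof (rule nn_integral_le_of_tendsto)
      show "(\<lambda>x. ennreal (\<bar>\<phi> j x - \<phi> k x\<bar> powr p)) \<in> borel_measurable lebesgue" for j using tm by measurable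
      show "AE x in lebesgue. (\<lambda>j. ennreal (\<bar>\<phi> j x - \<phi> k x\<bar> powr p)) \<longlonglongrightarrow> ennreal (\<bar>u x - \<phi> k x\<bar> powr p)"
        using ae by eventually_elim (use p0 in \<open>intro tendsto_ennrealI tendsto_powr' tendsto_intros; auto\<close>)
      show "\<forall>\<^sub>F j in sequentially. (\<integral>\<^sup>+x. ennreal (\<bar>\<phi> j x - \<phi> k x\<bar> powr p) \<partial>lebesgue) \<le> ennreal \<epsilon>"
        using eventually_ge_at_top[of N]
      proof eventually_elim
        case (elim j)
        have "ennreal (\<gamma>\<^sup>2) * X_norm_sq s (\<lambda>x. \<phi> j x - \<phi> k x) \<le> ennreal (\<gamma>\<^sup>2) * ennreal (\<epsilon> powr (2 / p) / (\<gamma>\<^sup>2 + 1))"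
          by (intro mult_left_mono N elim k) auto
        also have "\<dots> = ennreal (\<gamma>\<^sup>2 * (\<epsilon> powr (2 / p) / (\<gamma>\<^sup>2 + 1)))"
          using g by (intro ennreal_mult[symmetric]) auto
        also have "\<dots> \<le> ennreal (\<epsilon> powr (2 / p))"
          using g by (intro ennreal_leI) (simp add: field_simps)
        finally have "epow (ennreal (\<gamma>\<^sup>2) * X_norm_sq s (\<lambda>x. \<phi> j x - \<phi> k x)) (p / 2) \<le> epow (ennreal (\<epsilon> powr (2 / p))) (p / 2)"
          using p0 by (intro epow_mono) auto
        also have "\<dots> = ennreal \<epsilon>" using p0 e by (simp add: epow_ennreal powr_powr)
        finally show ?case by (rule order_trans[OF sob])
      qed
    qed
    then show "\<forall>\<^sub>F k in sequentially. (\<integral>\<^sup>+x. ennreal (\<bar>u x - \<phi> k x\<bar> powr p) \<partial>lebesgue) \<le> ennreal \<epsilon>"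
      by (auto simp: eventually_sequentially)
  qed
  have fin: "(\<integral>\<^sup>+x. ennreal (\<bar>u x\<bar> powr p) \<partial>lebesgue) < top"
  proof -
    obtain k where k: "(\<integral>\<^sup>+x. ennreal (\<bar>u x - \<phi> k x\<bar> powr p) \<partial>lebesgue) < 1"
      using tendsto_0_ennrealD[OF Lp, of 1] by (auto simp: eventually_sequentially)
    have "(\<integral>\<^sup>+x. ennreal (\<bar>u x\<bar> powr p) \<partial>lebesgue)
       \<le> (\<integral>\<^sup>+x. ennreal (2 powr p) * (ennreal (\<bar>u x - \<phi> k x\<bar> powr p) + ennreal (\<bar>\<phi> k x\<bar> powr p)) \<partial>lebesgue)"
    proof (rule nn_integral_mono)
      fix x
      show "ennreal (\<bar>u x\<bar> powr p) \<le> ennreal (2 powr p) * (ennreal (\<bar>u x - \<phi> k x\<bar> powr p) + ennreal (\<bar>\<phi> k x\<bar> powr p))"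
        using ennreal_leI[OF abs_powr_add_le[of p "u x - \<phi> k x" "\<phi> k x"]] p0
        by (simp add: ennreal_mult)
    qed
    also have "\<dots> = ennreal (2 powr p) * ((\<integral>\<^sup>+x. ennreal (\<bar>u x - \<phi> k x\<bar> powr p) \<partial>lebesgue) + (\<integral>\<^sup>+x. ennreal (\<bar>\<phi> k x\<bar> powr p) \<partial>lebesgue))"
      using um tm by (simp add: nn_integral_add nn_integral_cmult)
    also have "\<dots> < top"
      using k test_nn_integral_finite(1)[OF \<phi> p0, of k] by (auto simp: ennreal_mult_less_top intro: less_trans)
    finally show ?thesis .
  qed
  show thesis
    by (rule that[OF \<phi> G(1) has_weak_grad_limit[OF \<phi> um G(1) l2 G(2)] ae G(2) gag Lp fin])
qed

lemma test_in_X_space: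
  assumes "\<phi> \<in> test_functions \<Omega>"
  shows "\<phi> \<in> X_space s \<Omega>"
proof -
  have "grad (\<lambda>x::'a. 0::real) = (\<lambda>x. 0)"
    by (rule ext, rule grad_eqI, rule GDERIV_const)
  then have "X_norm_sq s (\<lambda>x. \<phi> x - \<phi> x) = 0"
    by (simp add: X_norm_sq_def gagliardo_sq_def)
  then show ?thesis
    using assms test_measurable(3)[OF assms]
    unfolding X_space_def by (auto intro!: exI[of _ "\<lambda>_. \<phi>"])
qed

section \<open>Smooth truncated powers\<close>

text \<open>The summand \<open>\<epsilon>\<close> keeps the base positive, so that all its real
  powers are smooth at \<open>t = 0\<close> too. The reciprocal is written as
  \<open>powr (- 1)\<close> to be covered by \<open>C_k_powr\<close>.\<close>

definition trunc_sq :: "real \<Rightarrow> real \<Rightarrow> real" where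
  "trunc_sq \<epsilon> t = \<epsilon> + t\<^sup>2 * (1 + \<epsilon> * t\<^sup>2) powr (- 1)"

text \<open>The exponent counts powers of the square: as \<open>\<epsilon>\<close> tends to 0 the
  modulus becomes \<open>\<bar>t\<bar> powr (1 + 2 * r)\<close>, so that half the exponent gives
  growth \<open>1 + r\<close>.\<close>

definition trunc_pow :: "real \<Rightarrow> real \<Rightarrow> real \<Rightarrow> real" where
  "trunc_pow \<epsilon> r t = t * trunc_sq \<epsilon> t powr r"

text \<open>The logarithmic derivative \<open>t H'(t) / H(t)\<close> of \<open>H = trunc_sq \<epsilon>\<close>.\<close>

definition trunc_ratio :: "real \<Rightarrow> real \<Rightarrow> real" where
  "trunc_ratio \<epsilon> t = t * (2 * t / (1 + \<epsilon> * t\<^sup>2)\<^sup>2) / trunc_sq \<epsilon> t"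

context
  fixes \<epsilon> :: real
  assumes e: "0 < \<epsilon>"
begin

lemma trunc_denom_pos: "0 < 1 + \<epsilon> * t\<^sup>2"
  using e by (intro add_pos_nonneg) auto

lemma trunc_sq_alt: "trunc_sq \<epsilon> t = \<epsilon> + t\<^sup>2 / (1 + \<epsilon> * t\<^sup>2)"
  using trunc_denom_pos[of t] by (simp add: trunc_sq_def powr_minus divide_inverse)

lemma trunc_sq_bounds:
  "\<epsilon> \<le> trunc_sq \<epsilon> t" "0 < trunc_sq \<epsilon> t" "trunc_sq \<epsilon> t \<le> \<epsilon> + 1 / \<epsilon>" "trunc_sq \<epsilon> t \<le> \<epsilon> + t\<^sup>2"
proof -
  have d: "0 < 1 + \<epsilon> * t\<^sup>2" by (rule trunc_denom_pos)
  have h: "0 \<le> t\<^sup>2 / (1 + \<epsilon> * t\<^sup>2)" using d by simp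
  then show "\<epsilon> \<le> trunc_sq \<epsilon> t" by (simp add: trunc_sq_alt)
  show "0 < trunc_sq \<epsilon> t" unfolding trunc_sq_alt by (rule add_pos_nonneg[OF e h])
  have "t\<^sup>2 / (1 + \<epsilon> * t\<^sup>2) \<le> 1 / \<epsilon>" using d e by (simp add: field_simps)
  then show "trunc_sq \<epsilon> t \<le> \<epsilon> + 1 / \<epsilon>" by (simp add: trunc_sq_alt)
  have "t\<^sup>2 / (1 + \<epsilon> * t\<^sup>2) \<le> t\<^sup>2 / 1" using e d by (intro divide_left_mono) auto
  then show "trunc_sq \<epsilon> t \<le> \<epsilon> + t\<^sup>2" by (simp add: trunc_sq_alt)
qed

lemma C_k_ident: "C_k k (\<lambda>t::real. t)"
  using C_k_inner[of k "1::real"] by simp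

lemma C_k_trunc_pow: "C_k k (trunc_pow \<epsilon> r)"
proof -
  have sq: "C_k k (\<lambda>t::real. t\<^sup>2)"
    using C_k_mult[OF C_k_ident C_k_ident, of k] by (simp add: power2_eq_square)
  have "C_k k (trunc_sq \<epsilon>)"
    unfolding trunc_sq_def[abs_def]
    by (intro C_k_add C_k_mult C_k_const sq C_k_powr trunc_denom_pos)
  then show ?thesis
    unfolding trunc_pow_def[abs_def]
    by (intro C_k_mult C_k_ident C_k_powr trunc_sq_bounds)
qed

text \<open>For the pure square the logarithmic derivative is exactly 2, and truncation can only
  lower it. All estimates built on this range are uniform in \<open>\<epsilon>\<close>.\<close>

lemma trunc_ratio_bounds: "0 \<le> trunc_ratio \<epsilon> t" "trunc_ratio \<epsilon> t \<le> 2"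
proof -
  have d: "0 < 1 + \<epsilon> * t\<^sup>2" by (rule trunc_denom_pos)
  show "0 \<le> trunc_ratio \<epsilon> t"
    using trunc_sq_bounds(2)[of t] by (simp add: trunc_ratio_def)
  have "t * (2 * t / (1 + \<epsilon> * t\<^sup>2)\<^sup>2) = 2 * (t\<^sup>2 / (1 + \<epsilon> * t\<^sup>2) / (1 + \<epsilon> * t\<^sup>2))"
    using d by (simp add: power2_eq_square)
  also have "\<dots> \<le> 2 * (t\<^sup>2 / (1 + \<epsilon> * t\<^sup>2) / 1)"
    using e d by (intro mult_left_mono divide_left_mono) auto
  also have "\<dots> \<le> 2 * trunc_sq \<epsilon> t" using e by (simp add: trunc_sq_alt)
  finally show "trunc_ratio \<epsilon> t \<le> 2"
    unfolding trunc_ratio_def by (subst pos_divide_le_eq[OF trunc_sq_bounds(2)])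
qed

lemma DERIV_trunc_pow:
  "(trunc_pow \<epsilon> r has_real_derivative trunc_sq \<epsilon> t powr r * (1 + r * trunc_ratio \<epsilon> t)) (at t)"
proof -
  have d: "1 + \<epsilon> * t\<^sup>2 \<noteq> 0" for t using trunc_denom_pos[of t] by simp
  have "((\<lambda>t. \<epsilon> + t\<^sup>2 / (1 + \<epsilon> * t\<^sup>2)) has_real_derivative 2 * t / (1 + \<epsilon> * t\<^sup>2)\<^sup>2) (at t)"
    using d[of t] by (auto intro!: derivative_eq_intros simp: power2_eq_square field_simps)
  then have 1: "(trunc_sq \<epsilon> has_real_derivative 2 * t / (1 + \<epsilon> * t\<^sup>2)\<^sup>2) (at t)"
    by (simp add: trunc_sq_alt[abs_def])
  have 2: "((\<lambda>t. trunc_sq \<epsilon> t powr r) has_real_derivative r * trunc_sq \<epsilon> t powr (r - 1) * (2 * t / (1 + \<epsilon> * t\<^sup>2)\<^sup>2)) (at t)"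
    using DERIV_chain2[OF has_real_derivative_powr[OF trunc_sq_bounds(2)] 1] .
  have "(trunc_pow \<epsilon> r has_real_derivative 1 * trunc_sq \<epsilon> t powr r + r * trunc_sq \<epsilon> t powr (r - 1) * (2 * t / (1 + \<epsilon> * t\<^sup>2)\<^sup>2) * t) (at t)"
    unfolding trunc_pow_def[abs_def] by (rule DERIV_mult[OF DERIV_ident 2])
  also have "1 * trunc_sq \<epsilon> t powr r + r * trunc_sq \<epsilon> t powr (r - 1) * (2 * t / (1 + \<epsilon> * t\<^sup>2)\<^sup>2) * t
      = trunc_sq \<epsilon> t powr r * (1 + r * trunc_ratio \<epsilon> t)"
    using trunc_sq_bounds(2)[of t] by (simp add: trunc_ratio_def powr_diff algebra_simps)
  finally show ?thesis .
qed

lemma trunc_deriv_bounds: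
  assumes r: "0 \<le> r"
  shows "0 \<le> trunc_sq \<epsilon> t powr r * (1 + r * trunc_ratio \<epsilon> t)"
    "trunc_sq \<epsilon> t powr r * (1 + r * trunc_ratio \<epsilon> t) \<le> (\<epsilon> + 1 / \<epsilon>) powr r * (1 + 2 * r)"
proof -
  have w: "0 \<le> r * trunc_ratio \<epsilon> t" "r * trunc_ratio \<epsilon> t \<le> 2 * r"
    using r trunc_ratio_bounds[of t] by (auto intro!: mult_left_mono simp: mult.commute[of 2])
  show "0 \<le> trunc_sq \<epsilon> t powr r * (1 + r * trunc_ratio \<epsilon> t)"
    using w by simp
  show "trunc_sq \<epsilon> t powr r * (1 + r * trunc_ratio \<epsilon> t) \<le> (\<epsilon> + 1 / \<epsilon>) powr r * (1 + 2 * r)"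
    using w r trunc_sq_bounds[of t] by (intro mult_mono powr_mono2) auto
qed

text \<open>With w = \<open>trunc_ratio \<epsilon> t\<close> and the common power of
  \<open>trunc_sq\<close> cancelled, this is
  \<open>(1 + r / 2 * w)\<^sup>2 \<le> (r + 1) * (1 + r * w)\<close>, which follows from
  \<open>w * w \<le> 2 * w\<close>. The factor \<open>r + 1\<close>, free of
  \<open>\<epsilon>\<close>, is the growth factor of the later iteration.\<close>

lemma trunc_half_deriv_square:
  assumes r: "0 \<le> r"
  shows "(trunc_sq \<epsilon> t powr (r / 2) * (1 + r / 2 * trunc_ratio \<epsilon> t))\<^sup>2
    \<le> (r + 1) * (trunc_sq \<epsilon> t powr r * (1 + r * trunc_ratio \<epsilon> t))"
proof -
  define w where "w = trunc_ratio \<epsilon> t"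
  have w: "0 \<le> w" "w \<le> 2" unfolding w_def by (rule trunc_ratio_bounds)+
  have sq: "(trunc_sq \<epsilon> t powr (r / 2))\<^sup>2 = trunc_sq \<epsilon> t powr r"
    by (simp add: power2_eq_square powr_add[symmetric])
  have "r\<^sup>2 * (w * w) \<le> r\<^sup>2 * (2 * w)" using w by (intro mult_left_mono mult_right_mono) auto
  then have "(1 + r / 2 * w)\<^sup>2 \<le> 1 + r * w + r\<^sup>2 * w / 2"
    by (simp add: power2_eq_square algebra_simps)
  also have "\<dots> \<le> (r + 1) * (1 + r * w)"
    using r w by (simp add: power2_eq_square algebra_simps)
  finally have *: "(1 + r / 2 * w)\<^sup>2 \<le> (r + 1) * (1 + r * w)" .
  have "trunc_sq \<epsilon> t powr r * (1 + r / 2 * w)\<^sup>2 \<le> trunc_sq \<epsilon> t powr r * ((r + 1) * (1 + r * w))"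
    by (intro mult_left_mono *) simp
  then show ?thesis
    unfolding power_mult_distrib sq w_def by (simp only: ac_simps)
qed

lemma trunc_pow_le: "0 \<le> r \<Longrightarrow> \<bar>trunc_pow \<epsilon> r t\<bar> \<le> (\<epsilon> + 1 / \<epsilon>) powr r * \<bar>t\<bar>"
  unfolding trunc_pow_def abs_mult using trunc_sq_bounds[of t]
  by (subst mult.commute) (intro mult_mono, auto intro!: powr_mono2)

lemma trunc_pow_half_square: "(trunc_pow \<epsilon> (r / 2) t)\<^sup>2 = t * trunc_pow \<epsilon> r t"
proof -
  have "(trunc_sq \<epsilon> t powr (r / 2))\<^sup>2 = trunc_sq \<epsilon> t powr r"
    by (simp add: power2_eq_square powr_add[symmetric])
  then show ?thesis by (simp add: trunc_pow_def power_mult_distrib power2_eq_square)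
qed

lemma abs_trunc_pow: "\<bar>trunc_pow \<epsilon> r t\<bar> = \<bar>t\<bar> * trunc_sq \<epsilon> t powr r"
  by (simp add: trunc_pow_def abs_mult)

text \<open>Monotonicity and the Lipschitz bound in one datum, the slope \<open>\<theta>\<close> of
  the secant; \<open>nonlocal_integrand_lower\<close> takes it in this form.\<close>

lemma trunc_pow_mono_Lipschitz:
  assumes r: "0 \<le> r"
  obtains \<theta> where "0 \<le> \<theta>" "\<theta> \<le> (\<epsilon> + 1 / \<epsilon>) powr r * (1 + 2 * r)"
    "trunc_pow \<epsilon> r a - trunc_pow \<epsilon> r b = \<theta> * (a - b)"
proof -
  have *: "\<exists>\<theta>. 0 \<le> \<theta> \<and> \<theta> \<le> (\<epsilon> + 1 / \<epsilon>) powr r * (1 + 2 * r) \<and> trunc_pow \<epsilon> r a - trunc_pow \<epsilon> r b = \<theta> * (a - b)"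
    if "b < a" for a b
  proof -
    from MVT2[OF that DERIV_trunc_pow, of r] obtain z where "trunc_pow \<epsilon> r a - trunc_pow \<epsilon> r b = (a - b) * (trunc_sq \<epsilon> z powr r * (1 + r * trunc_ratio \<epsilon> z))"
      by blast
    then show ?thesis using trunc_deriv_bounds[OF r, of z] by (metis mult.commute)
  qed
  consider "b < a" | "a < b" | "a = b" by linarith
  then show thesis
  proof cases
    case 1
    then show ?thesis using *[of b a] that by blast
  next
    case 2
    from *[OF this] obtain \<theta> where t: "0 \<le> \<theta>" "\<theta> \<le> (\<epsilon> + 1 / \<epsilon>) powr r * (1 + 2 * r)"
      "trunc_pow \<epsilon> r b - trunc_pow \<epsilon> r a = \<theta> * (b - a)" by blast
    show ?thesis by (rule that[OF t(1,2)]) (use t(3) in \<open>simp add: algebra_simps\<close>)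
  next
    case 3
    have "0 \<le> (\<epsilon> + 1 / \<epsilon>) powr r * (1 + 2 * r)" using r by simp
    with 3 show ?thesis by (intro that[of 0]) auto
  qed
qed

lemma trunc_pow_continuous: "continuous_on UNIV (trunc_pow \<epsilon> r)"
  using C_k_trunc_pow[of 0 r] by simp

end

section \<open>Testing the equation\<close>

text \<open>The lower bound survives when \<open>f\<close> is not integrable, where the Bochner
  integral is \<open>0\<close>.\<close>

lemma integral_ge_neg_nn_integral:
  fixes f :: "'a \<Rightarrow> real" and q :: "'a \<Rightarrow> ennreal"
  assumes le: "AE x in M. ennreal (- f x) \<le> q x" and fin: "(\<integral>\<^sup>+x. q x \<partial>M) < top"
  shows "- enn2real (\<integral>\<^sup>+x. q x \<partial>M) \<le> (LINT x|M. f x)"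
proof (cases "integrable M f")
  case True
  have "enn2real (\<integral>\<^sup>+x. ennreal (- f x) \<partial>M) \<le> enn2real (\<integral>\<^sup>+x. q x \<partial>M)"
    using fin by (intro enn2real_mono nn_integral_mono_AE le)
  moreover have "(LINT x|M. f x) = enn2real (\<integral>\<^sup>+x. ennreal (f x) \<partial>M) - enn2real (\<integral>\<^sup>+x. ennreal (- f x) \<partial>M)"
    by (rule real_lebesgue_integral_def[OF True])
  ultimately show ?thesis
    using enn2real_nonneg[of "\<integral>\<^sup>+x. ennreal (f x) \<partial>M"] by linarith
next
  case False
  then show ?thesis by (simp add: not_integrable_integral_eq)
qed

lemma has_weak_grad_measurable:
  assumes "has_weak_grad u G"
  shows "G \<in> borel_measurable lebesgue"
proof (rule borel_measurable_LIMSEQ_metric)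
  show "(\<lambda>x. indicat_real (cball 0 (real n)) x *\<^sub>R G x) \<in> borel_measurable lebesgue" for n
  proof (rule borel_measurable_integrable)
    show "integrable lebesgue (\<lambda>x. indicat_real (cball 0 (real n)) x *\<^sub>R G x)"
      using assms by (simp add: has_weak_grad_def set_integrable_def)
  qed
  show "(\<lambda>n. indicat_real (cball 0 (real n)) x *\<^sub>R G x) \<longlonglongrightarrow> G x" for x
  proof (rule tendsto_eventually)
    have "\<forall>\<^sub>F n in sequentially. norm x \<le> real n" by real_asymp
    then show "\<forall>\<^sub>F n in sequentially. indicat_real (cball 0 (real n)) x *\<^sub>R G x = G x"
      by eventually_elim simp
  qed
qed

text \<open>Replaces the weak gradient \<open>D\<close> of \<open>u\<close> by the gradient
  \<open>d\<close> of its approximation: half of the energy is kept and the error is the distance of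
  the two.\<close>

lemma inner_ge_half:
  fixes D d :: "'a::real_inner"
  shows "D \<bullet> d \<ge> (norm d)\<^sup>2 / 2 - (norm (d - D))\<^sup>2 / 2"
proof -
  have "(norm (d - D))\<^sup>2 = (norm d)\<^sup>2 - 2 * (D \<bullet> d) + (norm D)\<^sup>2"
    by (simp add: power2_norm_eq_inner inner_diff inner_commute algebra_simps)
  then show ?thesis using zero_le_power2[of "norm D"] by linarith
qed

text \<open>Here \<open>a\<close> and \<open>b\<close> are the increments of \<open>u\<close> and
  \<open>\<phi>\<close>, and \<open>\<theta> * b\<close> is that of \<open>T(\<phi>)\<close>. The
  product may be negative since \<open>u\<close> and \<open>\<phi>\<close> differ, but
  \<open>- (a * b) \<le> (a - b)\<^sup>2 / 4\<close>. The value \<open>N = 0\<close> covers the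
  diagonal, where division yields 0.\<close>

lemma nonlocal_integrand_lower:
  fixes a b \<theta> L N :: real
  assumes t: "0 \<le> \<theta>" "\<theta> \<le> L" and N: "0 \<le> N"
  shows "- (a * (\<theta> * b) / N) \<le> L / 4 * ((a - b)\<^sup>2 / N)"
proof -
  have "- (a * b) \<le> (a - b)\<^sup>2 / 4"
    using zero_le_power2[of "a + b"] by (simp add: power2_eq_square algebra_simps)
  then have "\<theta> * (- (a * b)) \<le> \<theta> * ((a - b)\<^sup>2 / 4)"
    using t by (intro mult_left_mono) auto
  also have "\<dots> \<le> L * ((a - b)\<^sup>2 / 4)"
    using t by (intro mult_right_mono) auto
  finally have "\<theta> * (- (a * b)) / N \<le> L * ((a - b)\<^sup>2 / 4) / N"
    using N by (rule divide_right_mono)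
  then show ?thesis by (simp add: algebra_simps)
qed

text \<open>Both error terms measure \<open>u - \<phi>\<close> and carry the constant
  \<open>L\<close>, which depends on \<open>\<epsilon>\<close> and \<open>r\<close> but not on
  \<open>\<phi>\<close>; they vanish along the approximating sequence.\<close>

lemma B_form_lower:
  fixes u \<phi> :: "'a::euclidean_space \<Rightarrow> real"
  assumes u: "u \<in> borel_measurable lebesgue" and \<phi>: "\<phi> \<in> test_functions \<Omega>"
    and e: "0 < \<epsilon>" and r: "0 \<le> r"
    and G: "has_weak_grad u G" "(\<integral>\<^sup>+x. ennreal ((norm (G x))\<^sup>2) \<partial>lebesgue) < top"
    and gag: "gagliardo_sq s (\<lambda>x. u x - \<phi> x) < top"
  defines "L \<equiv> (\<epsilon> + 1 / \<epsilon>) powr r * (1 + 2 * r)"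
    and "T' \<equiv> \<lambda>t. trunc_sq \<epsilon> t powr r * (1 + r * trunc_ratio \<epsilon> t)"
  shows "integrable lebesgue (\<lambda>x. T' (\<phi> x) * (norm (grad \<phi> x))\<^sup>2)"
    and "(LINT x|lebesgue. T' (\<phi> x) * (norm (grad \<phi> x))\<^sup>2) / 2
        - L / 2 * enn2real (\<integral>\<^sup>+x. ennreal ((norm (grad \<phi> x - G x))\<^sup>2) \<partial>lebesgue)
        - L / 4 * enn2real (gagliardo_sq s (\<lambda>x. u x - \<phi> x))
      \<le> B_form s u (\<lambda>x. trunc_pow \<epsilon> r (\<phi> x))"
proof -
  define v where "v x = trunc_pow \<epsilon> r (\<phi> x)" for x
  have v: "v \<in> test_functions \<Omega>"
    unfolding v_def[abs_def] by (intro test_compose[OF \<phi>] C_k_trunc_pow[OF e]) (simp add: trunc_pow_def)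
  have gv: "grad v x = T' (\<phi> x) *\<^sub>R grad \<phi> x" for x
    unfolding v_def[abs_def] T'_def by (rule grad_test_compose[OF \<phi> DERIV_trunc_pow[OF e]])
  have T': "0 \<le> T' t" "T' t \<le> L" for t
    unfolding T'_def L_def by (rule trunc_deriv_bounds[OF e r])+
  have L0: "0 \<le> L" using r by (simp add: L_def)
  note m = test_measurable(3,4)[OF \<phi>] test_measurable(3,4)[OF v] has_weak_grad_measurable[OF G(1)]
  have T'm: "(\<lambda>x. T' (\<phi> x)) \<in> borel_measurable lebesgue"
    using m(1) unfolding T'_def trunc_ratio_def trunc_sq_def by measurable
  have d2: "integrable lebesgue (\<lambda>x. (norm (grad \<phi> x))\<^sup>2)"
    using m test_nn_integral_finite(2)[OF \<phi>, of 1] by (intro integrableI_bounded) auto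
  have G2: "integrable lebesgue (\<lambda>x. (norm (G x))\<^sup>2)"
    using m G(2) by (intro integrableI_bounded) auto
  have D2: "integrable lebesgue (\<lambda>x. (norm (grad \<phi> x - G x))\<^sup>2)"
  proof (rule Bochner_Integration.integrable_bound)
    show "integrable lebesgue (\<lambda>x. 2 * (norm (grad \<phi> x))\<^sup>2 + 2 * (norm (G x))\<^sup>2)"
      using d2 G2 by auto
    show "(\<lambda>x. (norm (grad \<phi> x - G x))\<^sup>2) \<in> borel_measurable lebesgue" using m by measurable
    show "AE x in lebesgue. norm ((norm (grad \<phi> x - G x))\<^sup>2) \<le> norm (2 * (norm (grad \<phi> x))\<^sup>2 + 2 * (norm (G x))\<^sup>2)"
      using norm_diff_square_le[of "grad \<phi> _" "G _"] by (intro AE_I2) auto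
  qed
  show TI: "integrable lebesgue (\<lambda>x. T' (\<phi> x) * (norm (grad \<phi> x))\<^sup>2)"
  proof (rule Bochner_Integration.integrable_bound)
    show "integrable lebesgue (\<lambda>x. L * (norm (grad \<phi> x))\<^sup>2)" using d2 by auto
    show "(\<lambda>x. T' (\<phi> x) * (norm (grad \<phi> x))\<^sup>2) \<in> borel_measurable lebesgue" using m T'm by measurable
    show "AE x in lebesgue. norm (T' (\<phi> x) * (norm (grad \<phi> x))\<^sup>2) \<le> norm (L * (norm (grad \<phi> x))\<^sup>2)"
      using T' L0 by (intro AE_I2) (auto simp: abs_mult intro!: mult_right_mono)
  qed
  have Gvi: "integrable lebesgue (\<lambda>x. G x \<bullet> grad v x)"
  proof (rule Bochner_Integration.integrable_bound)
    show "integrable lebesgue (\<lambda>x. (norm (G x))\<^sup>2 + L\<^sup>2 * (norm (grad \<phi> x))\<^sup>2)" using d2 G2 by auto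
    show "(\<lambda>x. G x \<bullet> grad v x) \<in> borel_measurable lebesgue" using m by measurable
    show "AE x in lebesgue. norm (G x \<bullet> grad v x) \<le> norm ((norm (G x))\<^sup>2 + L\<^sup>2 * (norm (grad \<phi> x))\<^sup>2)"
    proof (rule AE_I2)
      fix x
      have "\<bar>G x \<bullet> grad v x\<bar> \<le> norm (G x) * norm (grad v x)" by (rule Cauchy_Schwarz_ineq2)
      also have "\<dots> \<le> norm (G x) * (L * norm (grad \<phi> x))"
        using T'[of "\<phi> x"] by (intro mult_left_mono) (auto simp: gv intro!: mult_right_mono)
      also have "\<dots> \<le> (norm (G x))\<^sup>2 + (L * norm (grad \<phi> x))\<^sup>2"
        using sum_squares_bound[of "norm (G x)" "L * norm (grad \<phi> x)"]
          mult_nonneg_nonneg[OF norm_ge_zero[of "G x"] mult_nonneg_nonneg[OF L0 norm_ge_zero[of "grad \<phi> x"]]]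
        by linarith
      finally show "norm (G x \<bullet> grad v x) \<le> norm ((norm (G x))\<^sup>2 + L\<^sup>2 * (norm (grad \<phi> x))\<^sup>2)"
        by (simp add: power_mult_distrib)
    qed
  qed
  \<comment> \<open>The chosen representatives in \<open>B_form\<close> are exchanged for
    \<open>G\<close> and the classical gradient, off a null set.\<close>
  have "(LINT x|lebesgue. weak_grad u x \<bullet> weak_grad v x) = (LINT x|lebesgue. G x \<bullet> grad v x)"
  proof (rule integral_cong_AE)
    have "has_weak_grad u (weak_grad u)" "has_weak_grad v (weak_grad v)"
      unfolding weak_grad_def
      using someI[where P="has_weak_grad u", OF G(1)] someI[where P="has_weak_grad v", OF has_weak_grad_test[OF v]]
      by auto
    then show "(\<lambda>x. weak_grad u x \<bullet> weak_grad v x) \<in> borel_measurable lebesgue"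
      by (intro borel_measurable_inner has_weak_grad_measurable)
    show "(\<lambda>x. G x \<bullet> grad v x) \<in> borel_measurable lebesgue" using m by measurable
    show "AE x in lebesgue. weak_grad u x \<bullet> weak_grad v x = G x \<bullet> grad v x"
      using weak_grad_AE[OF G(1)] weak_grad_AE[OF has_weak_grad_test[OF v]]
      by eventually_elim simp
  qed
  moreover have "(LINT x|lebesgue. T' (\<phi> x) * (norm (grad \<phi> x))\<^sup>2 / 2 - L / 2 * (norm (grad \<phi> x - G x))\<^sup>2)
      \<le> (LINT x|lebesgue. G x \<bullet> grad v x)"
  proof (rule integral_mono)
    show "integrable lebesgue (\<lambda>x. T' (\<phi> x) * (norm (grad \<phi> x))\<^sup>2 / 2 - L / 2 * (norm (grad \<phi> x - G x))\<^sup>2)"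
      using TI D2 by auto
    show "integrable lebesgue (\<lambda>x. G x \<bullet> grad v x)" by (rule Gvi)
    fix x
    have "T' (\<phi> x) * ((norm (grad \<phi> x))\<^sup>2 / 2 - (norm (grad \<phi> x - G x))\<^sup>2 / 2) \<le> T' (\<phi> x) * (G x \<bullet> grad \<phi> x)"
      by (intro mult_left_mono inner_ge_half T')
    moreover have "T' (\<phi> x) * ((norm (grad \<phi> x - G x))\<^sup>2 / 2) \<le> L * ((norm (grad \<phi> x - G x))\<^sup>2 / 2)"
      by (intro mult_right_mono T') auto
    ultimately show "T' (\<phi> x) * (norm (grad \<phi> x))\<^sup>2 / 2 - L / 2 * (norm (grad \<phi> x - G x))\<^sup>2 \<le> G x \<bullet> grad v x"
      by (simp add: gv algebra_simps)
  qed
  moreover have "(LINT x|lebesgue. T' (\<phi> x) * (norm (grad \<phi> x))\<^sup>2 / 2 - L / 2 * (norm (grad \<phi> x - G x))\<^sup>2)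
      = (LINT x|lebesgue. T' (\<phi> x) * (norm (grad \<phi> x))\<^sup>2) / 2
        - L / 2 * enn2real (\<integral>\<^sup>+x. ennreal ((norm (grad \<phi> x - G x))\<^sup>2) \<partial>lebesgue)"
    using TI D2 m by (simp add: integral_eq_nn_integral[symmetric])
  \<comment> \<open>The double Bochner integral is bounded from below only, in \<open>x\<close> and
    then in \<open>y\<close>, so that its integrability never has to be established.\<close>
  moreover have "- (L / 4 * enn2real (gagliardo_sq s (\<lambda>x. u x - \<phi> x)))
     \<le> (LINT y|lebesgue. LINT x|lebesgue. (u x - u y) * (v x - v y) / norm (x - y) powr (real DIM('a) + 2 * s))"
  proof -
    define q where "q = real DIM('a) + 2 * s"
    define w where "w x = u x - \<phi> x" for x
    have wm: "w \<in> borel_measurable lebesgue" unfolding w_def using u m by measurable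
    define Q where "Q y = (\<integral>\<^sup>+x. ennreal (L / 4 * ((w x - w y)\<^sup>2 / norm (x - y) powr q)) \<partial>lebesgue)" for y
    have Q: "Q y = ennreal (L / 4) * (\<integral>\<^sup>+x. ennreal ((w x - w y)\<^sup>2 / norm (x - y) powr q) \<partial>lebesgue)" for y
    proof -
      have "Q y = (\<integral>\<^sup>+x. ennreal (L / 4) * ennreal ((w x - w y)\<^sup>2 / norm (x - y) powr q) \<partial>lebesgue)"
        unfolding Q_def using L0 by (intro nn_integral_cong ennreal_mult) auto
      also have "\<dots> = ennreal (L / 4) * (\<integral>\<^sup>+x. ennreal ((w x - w y)\<^sup>2 / norm (x - y) powr q) \<partial>lebesgue)"
        by (rule nn_integral_cmult[OF gagliardo_inner_measurable(1)[OF wm]])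
      finally show ?thesis .
    qed
    have Qm: "Q \<in> borel_measurable lebesgue"
      unfolding Q[abs_def] by (intro borel_measurable_times_ennreal borel_measurable_const gagliardo_inner_measurable wm)
    have QI: "(\<integral>\<^sup>+y. Q y \<partial>lebesgue) = ennreal (L / 4) * gagliardo_sq s w"
      unfolding Q gagliardo_sq_def q_def[symmetric]
      by (rule nn_integral_cmult[OF gagliardo_inner_measurable(2)[OF wm]])
    have gw: "gagliardo_sq s w < top" using gag by (simp add: w_def[abs_def])
    have fin: "(\<integral>\<^sup>+y. Q y \<partial>lebesgue) < top"
      unfolding QI using gw by (simp add: ennreal_mult_less_top)
    \<comment> \<open>Where \<open>Q y\<close> is infinite, \<open>enn2real\<close> would turn it
      into 0 and the bound would be lost; such \<open>y\<close> form a null set.\<close>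
    then have "AE y in lebesgue. Q y \<noteq> \<infinity>"
      by (intro nn_integral_noteq_infinite[OF Qm]) auto
    then have inner: "AE y in lebesgue. ennreal (- (LINT x|lebesgue. (u x - u y) * (v x - v y) / norm (x - y) powr q)) \<le> Q y"
    proof eventually_elim
      case (elim y)
      then have Qy: "Q y < top" by (simp add: less_top)
      have "- enn2real (Q y) \<le> (LINT x|lebesgue. (u x - u y) * (v x - v y) / norm (x - y) powr q)"
        unfolding Q_def
      proof (rule integral_ge_neg_nn_integral)
        show "(\<integral>\<^sup>+x. ennreal (L / 4 * ((w x - w y)\<^sup>2 / norm (x - y) powr q)) \<partial>lebesgue) < top"
          using Qy by (simp add: Q_def)
        show "AE x in lebesgue. ennreal (- ((u x - u y) * (v x - v y) / norm (x - y) powr q))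
            \<le> ennreal (L / 4 * ((w x - w y)\<^sup>2 / norm (x - y) powr q))"
        proof (intro AE_I2 ennreal_leI)
          fix x
          obtain \<theta> where t: "0 \<le> \<theta>" "\<theta> \<le> L" "v x - v y = \<theta> * (\<phi> x - \<phi> y)"
            using trunc_pow_mono_Lipschitz[OF e r, of "\<phi> x" "\<phi> y"] unfolding v_def L_def by metis
          have "w x - w y = (u x - u y) - (\<phi> x - \<phi> y)" by (simp add: w_def)
          with nonlocal_integrand_lower[OF t(1,2), of "norm (x - y) powr q" "u x - u y" "\<phi> x - \<phi> y"]
          show "- ((u x - u y) * (v x - v y) / norm (x - y) powr q) \<le> L / 4 * ((w x - w y)\<^sup>2 / norm (x - y) powr q)"
            unfolding t(3) by simp
        qed
      qed
      then have "ennreal (- (LINT x|lebesgue. (u x - u y) * (v x - v y) / norm (x - y) powr q)) \<le> ennreal (enn2real (Q y))"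
        by (intro ennreal_leI) simp
      then show ?case using Qy by simp
    qed
    have "- enn2real (\<integral>\<^sup>+y. Q y \<partial>lebesgue)
        \<le> (LINT y|lebesgue. LINT x|lebesgue. (u x - u y) * (v x - v y) / norm (x - y) powr q)"
      by (rule integral_ge_neg_nn_integral[OF inner fin])
    then show ?thesis
      unfolding QI using L0 by (simp add: enn2real_mult w_def[abs_def] q_def)
  qed
  ultimately show "(LINT x|lebesgue. T' (\<phi> x) * (norm (grad \<phi> x))\<^sup>2) / 2
        - L / 2 * enn2real (\<integral>\<^sup>+x. ennreal ((norm (grad \<phi> x - G x))\<^sup>2) \<partial>lebesgue)
        - L / 4 * enn2real (gagliardo_sq s (\<lambda>x. u x - \<phi> x))
      \<le> B_form s u (\<lambda>x. trunc_pow \<epsilon> r (\<phi> x))"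
    unfolding B_form_def v_def by linarith
qed

lemma nn_integral_Hoelder_real:
  fixes f g :: "'a \<Rightarrow> real"
  assumes "f \<in> borel_measurable M" "g \<in> borel_measurable M" "0 < a" "0 < b" "1 / a + 1 / b = 1"
  shows "(\<integral>\<^sup>+x. ennreal \<bar>f x * g x\<bar> \<partial>M)
    \<le> epow (\<integral>\<^sup>+x. ennreal (\<bar>f x\<bar> powr a) \<partial>M) (1 / a) * epow (\<integral>\<^sup>+x. ennreal (\<bar>g x\<bar> powr b) \<partial>M) (1 / b)"
proof -
  have "ennreal \<bar>f x * g x\<bar> = epow (ennreal (\<bar>f x\<bar> powr a)) (1 / a) * epow (ennreal (\<bar>g x\<bar> powr b)) (1 / b)" for x
    using assms by (simp add: epow_ennreal powr_powr abs_mult ennreal_mult)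
  then show ?thesis
    using nn_integral_Hoelder2[of "\<lambda>x. ennreal (\<bar>f x\<bar> powr a)" M "\<lambda>x. ennreal (\<bar>g x\<bar> powr b)" "1 / a" "1 / b"] assms
    by simp
qed

lemma ennreal_le_of_real_gt:
  assumes "\<And>c. x < c \<Longrightarrow> X \<le> ennreal c" "0 \<le> x"
  shows "X \<le> ennreal x"
proof (cases X)
  case (real y)
  have "y \<le> c" if "x < c" for c
    using assms(1)[OF that] real assms(2) that by (simp add: ennreal_le_iff)
  then have "y \<le> x" by (rule dense_ge)
  then show ?thesis using real by (simp add: ennreal_leI)
next
  case top
  then show ?thesis using assms(1)[of "x + 1"] by (auto simp: top_unique)
qed

text \<open>\<open>F\<close> and \<open>A\<close> stand for the right-hand side and the potential
  term, evaluated at \<open>u\<close>. Two majorants are kept apart: \<open>h\<close> enters the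
  result, while \<open>g\<close> only has to lie in the dual of the critical space and controls
  errors that vanish. This admits an unbounded nonnegative potential, where \<open>A\<close> is not
  dominated by \<open>h\<close> but has a favourable sign against \<open>T(u)\<close>.\<close>

lemma truncated_power_estimate:
  fixes u F A h g :: "'a::euclidean_space \<Rightarrow> real"
  assumes n: "3 \<le> DIM('a)" and \<Omega>: "\<Omega> \<in> sets lebesgue" and u: "u \<in> X_space s \<Omega>"
    and e: "0 < \<epsilon>" and r: "0 \<le> r"
    and weq: "\<And>\<phi>. \<phi> \<in> X_space s \<Omega> \<Longrightarrow>
      B_form s u \<phi> + (LINT x:\<Omega>|lebesgue. A x * \<phi> x) = (LINT x:\<Omega>|lebesgue. F x * \<phi> x)"
    and m: "h \<in> borel_measurable (lebesgue_on \<Omega>)" "g \<in> borel_measurable (lebesgue_on \<Omega>)"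
    and le: "AE x in lebesgue_on \<Omega>. \<bar>F x\<bar> \<le> h x \<and> h x \<le> g x \<and> \<bar>A x\<bar> \<le> g x \<and>
      - (A x * trunc_pow \<epsilon> r (u x)) \<le> h x * \<bar>trunc_pow \<epsilon> r (u x)\<bar>"
  defines "p \<equiv> two_star DIM('a)"
  defines "\<gamma> \<equiv> 2 * (real DIM('a) - 1) / (real DIM('a) - 2)"
  assumes gfin: "(\<integral>\<^sup>+x. ennreal (\<bar>g x\<bar> powr (p / (p - 1))) \<partial>lebesgue_on \<Omega>) < top"
  shows "epow (\<integral>\<^sup>+x. ennreal (\<bar>trunc_pow \<epsilon> (r / 2) (u x)\<bar> powr p) \<partial>lebesgue_on \<Omega>) (2 / p)
      \<le> ennreal (4 * \<gamma>\<^sup>2 * (r + 1)) * (\<integral>\<^sup>+x. ennreal (h x * \<bar>trunc_pow \<epsilon> r (u x)\<bar>) \<partial>lebesgue_on \<Omega>)"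
proof -
  let ?M = "lebesgue_on \<Omega>"
  define T where "T = trunc_pow \<epsilon> r"
  define L where "L = (\<epsilon> + 1 / \<epsilon>) powr r * (1 + 2 * r)"
  define T' where "T' t = trunc_sq \<epsilon> t powr r * (1 + r * trunc_ratio \<epsilon> t)" for t
  have L0: "0 \<le> L" using r by (simp add: L_def)
  have p: "1 < p" "0 < p / (p - 1)" "1 / (p / (p - 1)) + 1 / p = 1"
  proof -
    show "1 < p" using n by (simp add: p_def two_star_def field_simps)
    then show "0 < p / (p - 1)" "1 / (p / (p - 1)) + 1 / p = 1" by (auto simp: field_simps)
  qed
  obtain \<phi> G where \<phi>: "\<And>k::nat. \<phi> k \<in> test_functions \<Omega>"
    and G: "G \<in> borel_measurable lebesgue" "has_weak_grad u G" "(\<integral>\<^sup>+x. ennreal ((norm (G x))\<^sup>2) \<partial>lebesgue) < top"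
    and ae: "AE x in lebesgue. (\<lambda>k. \<phi> k x) \<longlonglongrightarrow> u x"
    and lG: "(\<lambda>k. \<integral>\<^sup>+x. ennreal ((norm (grad (\<phi> k) x - G x))\<^sup>2) \<partial>lebesgue) \<longlonglongrightarrow> 0"
    and lg: "(\<lambda>k. gagliardo_sq s (\<lambda>x. u x - \<phi> k x)) \<longlonglongrightarrow> 0"
    and lp: "(\<lambda>k. \<integral>\<^sup>+x. ennreal (\<bar>u x - \<phi> k x\<bar> powr p) \<partial>lebesgue) \<longlonglongrightarrow> 0"
    and up: "(\<integral>\<^sup>+x. ennreal (\<bar>u x\<bar> powr p) \<partial>lebesgue) < top"
    by (rule X_space_approx[OF n u, folded p_def]) (rule that)
  have um: "u \<in> borel_measurable lebesgue" using u by (simp add: X_space_def)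
  note tm = test_measurable(3,4)[OF \<phi>]
  have uM: "u \<in> borel_measurable ?M" "\<And>k. \<phi> k \<in> borel_measurable ?M"
    using um tm by (auto intro: measurable_restrict_space1)
  have Tb: "T \<in> borel_measurable borel"
    unfolding T_def by (intro borel_measurable_continuous_onI trunc_pow_continuous[OF e])
  have Tm: "(\<lambda>x. T (u x)) \<in> borel_measurable ?M" "\<And>k. (\<lambda>x. T (\<phi> k x)) \<in> borel_measurable ?M"
    using measurable_compose[OF uM(1) Tb] measurable_compose[OF uM(2) Tb] by auto
  have restr: "(\<integral>\<^sup>+x. f x \<partial>?M) \<le> (\<integral>\<^sup>+x. f x \<partial>lebesgue)" for f :: "'a \<Rightarrow> ennreal"
    using \<Omega> by (subst nn_integral_restrict_space) (auto intro!: nn_integral_mono simp: indicator_def)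
  have aeM: "AE x in ?M. (\<lambda>k. \<phi> k x) \<longlonglongrightarrow> u x"
    using ae \<Omega> by (subst AE_restrict_space_iff) (auto elim: eventually_mono)
  have TL: "\<bar>T a - T b\<bar> \<le> L * \<bar>a - b\<bar>" for a b
  proof -
    obtain \<theta> where "0 \<le> \<theta>" "\<theta> \<le> L" "T a - T b = \<theta> * (a - b)"
      using trunc_pow_mono_Lipschitz[OF e r, of a b] unfolding T_def L_def by metis
    then show ?thesis by (simp add: abs_mult mult_right_mono)
  qed
  have T0: "T 0 = 0" by (simp add: T_def trunc_pow_def)
  define gq where "gq = epow (\<integral>\<^sup>+x. ennreal (\<bar>g x\<bar> powr (p / (p - 1))) \<partial>?M) (1 / (p / (p - 1)))"
  have gq: "gq \<noteq> top" using gfin by (auto simp: gq_def epow_def)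
  \<comment> \<open>Used twice: comparison of \<open>u\<close> with 0 shows that \<open>S\<close> is
    finite, comparison of \<open>\<phi> k\<close> with \<open>u\<close> shows that
    \<open>E k\<close> tends to 0.\<close>
  have hoelder: "(\<integral>\<^sup>+x. ennreal (\<bar>g x\<bar> * \<bar>T (a x) - T (b x)\<bar>) \<partial>?M)
      \<le> epow (ennreal (L powr p) * (\<integral>\<^sup>+x. ennreal (\<bar>a x - b x\<bar> powr p) \<partial>lebesgue)) (1 / p) * gq"
    if "a \<in> borel_measurable lebesgue" "b \<in> borel_measurable lebesgue" for a b
  proof -
    have ab: "a \<in> borel_measurable ?M" "b \<in> borel_measurable ?M"
      using that by (auto intro: measurable_restrict_space1)
    have "(\<integral>\<^sup>+x. ennreal (\<bar>g x\<bar> * \<bar>T (a x) - T (b x)\<bar>) \<partial>?M) \<le> (\<integral>\<^sup>+x. ennreal \<bar>g x * (L * \<bar>a x - b x\<bar>)\<bar> \<partial>?M)"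
      using TL L0 by (intro nn_integral_mono ennreal_leI) (auto simp: abs_mult intro!: mult_left_mono)
    also have "\<dots> \<le> gq * epow (\<integral>\<^sup>+x. ennreal (\<bar>L * \<bar>a x - b x\<bar>\<bar> powr p) \<partial>?M) (1 / p)"
      unfolding gq_def using m ab p by (intro nn_integral_Hoelder_real) auto
    also have "(\<integral>\<^sup>+x. ennreal (\<bar>L * \<bar>a x - b x\<bar>\<bar> powr p) \<partial>?M) \<le> (\<integral>\<^sup>+x. ennreal (L powr p) * ennreal (\<bar>a x - b x\<bar> powr p) \<partial>lebesgue)"
      using L0 by (intro order_trans[OF restr] nn_integral_mono) (simp add: abs_mult powr_mult ennreal_mult)
    also have "\<dots> = ennreal (L powr p) * (\<integral>\<^sup>+x. ennreal (\<bar>a x - b x\<bar> powr p) \<partial>lebesgue)"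
      using that by (intro nn_integral_cmult) measurable
    finally show ?thesis using p by (simp add: mult.commute epow_mono mult_left_mono)
  qed
  define S where "S = (\<integral>\<^sup>+x. ennreal (h x * \<bar>T (u x)\<bar>) \<partial>?M)"
  define E where "E k = (\<integral>\<^sup>+x. ennreal (\<bar>g x\<bar> * \<bar>T (\<phi> k x) - T (u x)\<bar>) \<partial>?M)" for k
  have Sfin: "S < top"
  proof -
    have "S \<le> (\<integral>\<^sup>+x. ennreal (\<bar>g x\<bar> * \<bar>T (u x) - T 0\<bar>) \<partial>?M)"
      unfolding S_def
    proof (rule nn_integral_mono_AE)
      show "AE x in ?M. ennreal (h x * \<bar>T (u x)\<bar>) \<le> ennreal (\<bar>g x\<bar> * \<bar>T (u x) - T 0\<bar>)"
        using le by eventually_elim (auto intro!: ennreal_leI mult_right_mono simp: T0)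
    qed
    also have "\<dots> \<le> epow (ennreal (L powr p) * (\<integral>\<^sup>+x. ennreal (\<bar>u x - 0\<bar> powr p) \<partial>lebesgue)) (1 / p) * gq"
      by (rule hoelder[OF um]) simp
    also have "\<dots> < top"
    proof -
      have "ennreal (L powr p) * (\<integral>\<^sup>+x. ennreal (\<bar>u x\<bar> powr p) \<partial>lebesgue) < top"
        using up by (simp add: ennreal_mult_less_top)
      then have "epow (ennreal (L powr p) * (\<integral>\<^sup>+x. ennreal (\<bar>u x\<bar> powr p) \<partial>lebesgue)) (1 / p) < top"
        by (auto simp: epow_def)
      then show ?thesis using gq by (simp add: ennreal_mult_less_top less_top)
    qed
    finally show ?thesis .
  qed
  have E0: "E \<longlonglongrightarrow> 0"
  proof (rule tendsto_sandwich[OF _ _ tendsto_const])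
    show "\<forall>\<^sub>F k in sequentially. 0 \<le> E k" by simp
    have "E k \<le> epow ((\<integral>\<^sup>+x. ennreal (\<bar>u x - \<phi> k x\<bar> powr p) \<partial>lebesgue) * ennreal (L powr p)) (1 / p) * gq" for k
      unfolding E_def using hoelder[OF tm(1) um, of k] by (simp add: abs_minus_commute mult.commute)
    then show "\<forall>\<^sub>F k in sequentially. E k \<le> epow ((\<integral>\<^sup>+x. ennreal (\<bar>u x - \<phi> k x\<bar> powr p) \<partial>lebesgue) * ennreal (L powr p)) (1 / p) * gq"
      by simp
    show "(\<lambda>k. epow ((\<integral>\<^sup>+x. ennreal (\<bar>u x - \<phi> k x\<bar> powr p) \<partial>lebesgue) * ennreal (L powr p)) (1 / p) * gq) \<longlonglongrightarrow> 0"
      using p by (intro ennreal_mult_tendsto_0 epow_tendsto_0 lp gq) auto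
  qed
  \<comment> \<open>Twice the sum of the upper bound for \<open>B_form\<close> and the two errors of
    \<open>B_form_lower\<close>, which retains half of the energy. The upper bound itself is
    \<open>S + E k\<close> once for \<open>F\<close> and once for \<open>A\<close>, whence the
    4.\<close>
  define b where "b k = 4 * enn2real (S + E k)
      + L * enn2real (\<integral>\<^sup>+x. ennreal ((norm (grad (\<phi> k) x - G x))\<^sup>2) \<partial>lebesgue)
      + L / 2 * enn2real (gagliardo_sq s (\<lambda>x. u x - \<phi> k x))" for k
  have upper: "B_form s u (\<lambda>x. T (\<phi> k x)) \<le> 2 * enn2real (S + E k)" if Ek: "E k < top" for k
  proof -
    have "(\<lambda>x. T (\<phi> k x)) \<in> test_functions \<Omega>"
      unfolding T_def by (intro test_compose[OF \<phi>] C_k_trunc_pow[OF e]) (simp add: trunc_pow_def)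
    from weq[OF test_in_X_space[OF this]]
    have B: "B_form s u (\<lambda>x. T (\<phi> k x)) = (LINT x|?M. F x * T (\<phi> k x)) - (LINT x|?M. A x * T (\<phi> k x))"
      using \<Omega> by (simp add: integral_restrict_space set_lebesgue_integral_def)
    define Q where "Q x = ennreal (h x * \<bar>T (u x)\<bar>) + ennreal (\<bar>g x\<bar> * \<bar>T (\<phi> k x) - T (u x)\<bar>)" for x
    have Q: "(\<integral>\<^sup>+x. Q x \<partial>?M) = S + E k"
      unfolding Q_def S_def E_def using m Tm by (intro nn_integral_add) auto
    have fin: "(\<integral>\<^sup>+x. Q x \<partial>?M) < top" unfolding Q using Sfin Ek by simp
    have 1: "AE x in ?M. ennreal (- (- (F x * T (\<phi> k x)))) \<le> Q x"
      using le
    proof eventually_elim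
      case (elim x)
      have "F x * T (\<phi> k x) \<le> \<bar>F x\<bar> * \<bar>T (\<phi> k x)\<bar>" by (metis abs_ge_self abs_mult)
      also have "\<dots> \<le> h x * (\<bar>T (u x)\<bar> + \<bar>T (\<phi> k x) - T (u x)\<bar>)"
        using elim by (intro mult_mono) auto
      also have "\<dots> \<le> h x * \<bar>T (u x)\<bar> + \<bar>g x\<bar> * \<bar>T (\<phi> k x) - T (u x)\<bar>"
        unfolding distrib_left using elim by (intro add_left_mono mult_right_mono) auto
      finally have "ennreal (F x * T (\<phi> k x)) \<le> ennreal (h x * \<bar>T (u x)\<bar> + \<bar>g x\<bar> * \<bar>T (\<phi> k x) - T (u x)\<bar>)"
        by (rule ennreal_leI)
      also have "\<dots> = Q x"
        unfolding Q_def using elim by (intro ennreal_plus mult_nonneg_nonneg) auto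
      finally show ?case by simp
    qed
    have 2: "AE x in ?M. ennreal (- (A x * T (\<phi> k x))) \<le> Q x"
      using le
    proof eventually_elim
      case (elim x)
      have "- (A x * T (\<phi> k x)) = - (A x * T (u x)) - A x * (T (\<phi> k x) - T (u x))" by (simp add: algebra_simps)
      also have "\<dots> \<le> h x * \<bar>T (u x)\<bar> + \<bar>A x\<bar> * \<bar>T (\<phi> k x) - T (u x)\<bar>"
        using elim abs_ge_minus_self[of "A x * (T (\<phi> k x) - T (u x))"] unfolding T_def by (simp add: abs_mult)
      also have "\<dots> \<le> h x * \<bar>T (u x)\<bar> + \<bar>g x\<bar> * \<bar>T (\<phi> k x) - T (u x)\<bar>"
        using elim by (intro add_left_mono mult_right_mono) auto
      finally have "ennreal (- (A x * T (\<phi> k x))) \<le> ennreal (h x * \<bar>T (u x)\<bar> + \<bar>g x\<bar> * \<bar>T (\<phi> k x) - T (u x)\<bar>)"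
        by (rule ennreal_leI)
      also have "\<dots> = Q x"
        unfolding Q_def using elim by (intro ennreal_plus mult_nonneg_nonneg) auto
      finally show ?case .
    qed
    from integral_ge_neg_nn_integral[OF 1 fin] integral_ge_neg_nn_integral[OF 2 fin]
    show ?thesis unfolding B Q by simp
  qed
  define N where "N k = (\<integral>\<^sup>+x. ennreal (\<bar>trunc_pow \<epsilon> (r / 2) (\<phi> k x)\<bar> powr p) \<partial>?M)" for k
  have step: "N k \<le> epow (ennreal (\<gamma>\<^sup>2 * (r + 1) * b k)) (p / 2)"
    if Ek: "E k < top" and gk: "gagliardo_sq s (\<lambda>x. u x - \<phi> k x) < top" for k
  proof -
    note Bl = B_form_lower[OF um \<phi>[of k] e r G(2,3) gk, folded L_def T'_def]
    have le1: "(LINT x|lebesgue. T' (\<phi> k x) * (norm (grad (\<phi> k) x))\<^sup>2) \<le> b k"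
      using Bl(2) upper[OF Ek] unfolding b_def T_def by simp
    have v: "(\<lambda>x. trunc_pow \<epsilon> (r / 2) (\<phi> k x)) \<in> test_functions \<Omega>"
      by (intro test_compose[OF \<phi>] C_k_trunc_pow[OF e]) (simp add: trunc_pow_def)
    have T'0: "0 \<le> T' t" for t unfolding T'_def by (rule trunc_deriv_bounds[OF e r])
    have "epow (\<integral>\<^sup>+x. ennreal (\<bar>trunc_pow \<epsilon> (r / 2) (\<phi> k x)\<bar> powr p) \<partial>lebesgue) (2 / p)
      \<le> ennreal (\<gamma>\<^sup>2) * (\<integral>\<^sup>+x. ennreal ((norm (grad (\<lambda>x. trunc_pow \<epsilon> (r / 2) (\<phi> k x)) x))\<^sup>2) \<partial>lebesgue)"
      unfolding p_def \<gamma>_def by (rule Sobolev_test[OF n v])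
    also have "(\<integral>\<^sup>+x. ennreal ((norm (grad (\<lambda>x. trunc_pow \<epsilon> (r / 2) (\<phi> k x)) x))\<^sup>2) \<partial>lebesgue)
        \<le> (\<integral>\<^sup>+x. ennreal ((r + 1) * (T' (\<phi> k x) * (norm (grad (\<phi> k) x))\<^sup>2)) \<partial>lebesgue)"
    proof (intro nn_integral_mono ennreal_leI)
      fix x
      have "(norm (grad (\<lambda>x. trunc_pow \<epsilon> (r / 2) (\<phi> k x)) x))\<^sup>2
          = (trunc_sq \<epsilon> (\<phi> k x) powr (r / 2) * (1 + r / 2 * trunc_ratio \<epsilon> (\<phi> k x)))\<^sup>2 * (norm (grad (\<phi> k) x))\<^sup>2"
        by (simp add: grad_test_compose[OF \<phi> DERIV_trunc_pow[OF e]] power_mult_distrib)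
      also have "\<dots> \<le> (r + 1) * T' (\<phi> k x) * (norm (grad (\<phi> k) x))\<^sup>2"
        unfolding T'_def by (intro mult_right_mono trunc_half_deriv_square[OF e r]) auto
      finally show "(norm (grad (\<lambda>x. trunc_pow \<epsilon> (r / 2) (\<phi> k x)) x))\<^sup>2
          \<le> (r + 1) * (T' (\<phi> k x) * (norm (grad (\<phi> k) x))\<^sup>2)" by (simp add: mult.assoc)
    qed
    also have "\<dots> = ennreal (LINT x|lebesgue. (r + 1) * (T' (\<phi> k x) * (norm (grad (\<phi> k) x))\<^sup>2))"
      using Bl(1) r T'0 by (intro nn_integral_eq_integral) auto
    also have "\<dots> \<le> ennreal ((r + 1) * b k)"
      using le1 r by (intro ennreal_leI) (simp add: mult_left_mono)
    finally have "epow (\<integral>\<^sup>+x. ennreal (\<bar>trunc_pow \<epsilon> (r / 2) (\<phi> k x)\<bar> powr p) \<partial>lebesgue) (2 / p)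
      \<le> ennreal (\<gamma>\<^sup>2) * ennreal ((r + 1) * b k)"
      by (simp add: mult_left_mono)
    also have "\<dots> = ennreal (\<gamma>\<^sup>2 * (r + 1) * b k)"
      by (simp add: ennreal_mult'[symmetric] mult.assoc)
    finally have "epow (epow (\<integral>\<^sup>+x. ennreal (\<bar>trunc_pow \<epsilon> (r / 2) (\<phi> k x)\<bar> powr p) \<partial>lebesgue) (2 / p)) (p / 2)
        \<le> epow (ennreal (\<gamma>\<^sup>2 * (r + 1) * b k)) (p / 2)"
      using p by (intro epow_mono) auto
    then show ?thesis
      unfolding N_def using p by (intro order_trans[OF restr]) (simp add: epow_epow)
  qed
  have blim: "b \<longlonglongrightarrow> 4 * enn2real S + L * 0 + L / 2 * 0"
  proof -
    have "(\<lambda>k. enn2real (S + E k)) \<longlonglongrightarrow> enn2real S"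
    proof (rule tendsto_enn2real)
      have "(\<lambda>k. S + E k) \<longlonglongrightarrow> S + 0" by (intro tendsto_add E0 tendsto_const)
      then show "(\<lambda>k. S + E k) \<longlonglongrightarrow> ennreal (enn2real S)" using Sfin by simp
    qed simp
    moreover have "(\<lambda>k. enn2real (\<integral>\<^sup>+x. ennreal ((norm (grad (\<phi> k) x - G x))\<^sup>2) \<partial>lebesgue)) \<longlonglongrightarrow> 0"
      by (rule tendsto_enn2real) (use lG in auto)
    moreover have "(\<lambda>k. enn2real (gagliardo_sq s (\<lambda>x. u x - \<phi> k x))) \<longlonglongrightarrow> 0"
      by (rule tendsto_enn2real) (use lg in auto)
    ultimately show ?thesis unfolding b_def by (intro tendsto_add tendsto_mult tendsto_const)
  qed
  have "epow (\<integral>\<^sup>+x. ennreal (\<bar>trunc_pow \<epsilon> (r / 2) (u x)\<bar> powr p) \<partial>?M) (2 / p) \<le> ennreal (4 * \<gamma>\<^sup>2 * (r + 1) * enn2real S)"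
  proof (rule ennreal_le_of_real_gt)
    show "0 \<le> 4 * \<gamma>\<^sup>2 * (r + 1) * enn2real S" using r by simp
    fix c assume c: "4 * \<gamma>\<^sup>2 * (r + 1) * enn2real S < c"
    have "(\<lambda>k. \<gamma>\<^sup>2 * (r + 1) * b k) \<longlonglongrightarrow> \<gamma>\<^sup>2 * (r + 1) * (4 * enn2real S)"
      using blim by (intro tendsto_intros) simp
    then have ev: "\<forall>\<^sub>F k in sequentially. \<gamma>\<^sup>2 * (r + 1) * b k < c"
      using c by (intro order_tendstoD(2)) (auto simp: algebra_simps)
    have "(\<integral>\<^sup>+x. ennreal (\<bar>trunc_pow \<epsilon> (r / 2) (u x)\<bar> powr p) \<partial>?M) \<le> epow (ennreal c) (p / 2)"
    proof (rule nn_integral_le_of_tendsto)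
      have tc: "isCont (trunc_pow \<epsilon> (r / 2)) t" for t
        using trunc_pow_continuous[OF e] by (simp add: continuous_on_eq_continuous_at)
      show "(\<lambda>x. ennreal (\<bar>trunc_pow \<epsilon> (r / 2) (\<phi> k x)\<bar> powr p)) \<in> borel_measurable ?M" for k
        using measurable_compose[OF uM(2) borel_measurable_continuous_onI[OF trunc_pow_continuous[OF e]]]
        by measurable
      show "AE x in ?M. (\<lambda>k. ennreal (\<bar>trunc_pow \<epsilon> (r / 2) (\<phi> k x)\<bar> powr p)) \<longlonglongrightarrow> ennreal (\<bar>trunc_pow \<epsilon> (r / 2) (u x)\<bar> powr p)"
        using aeM
      proof eventually_elim
        case (elim x)
        from isCont_tendsto_compose[OF tc elim]
        have "(\<lambda>k. \<bar>trunc_pow \<epsilon> (r / 2) (\<phi> k x)\<bar>) \<longlonglongrightarrow> \<bar>trunc_pow \<epsilon> (r / 2) (u x)\<bar>" by (rule tendsto_rabs)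
        then show ?case
          using p by (intro tendsto_ennrealI tendsto_powr'[OF _ tendsto_const]) auto
      qed
      show "\<forall>\<^sub>F k in sequentially. (\<integral>\<^sup>+x. ennreal (\<bar>trunc_pow \<epsilon> (r / 2) (\<phi> k x)\<bar> powr p) \<partial>?M) \<le> epow (ennreal c) (p / 2)"
        using ev tendsto_0_ennrealD[OF E0, of 1, simplified] tendsto_0_ennrealD[OF lg, of 1, simplified]
      proof eventually_elim
        case (elim k)
        have "N k \<le> epow (ennreal (\<gamma>\<^sup>2 * (r + 1) * b k)) (p / 2)"
          using elim by (intro step) (auto intro: less_trans)
        also have "\<dots> \<le> epow (ennreal c) (p / 2)"
          using elim p by (intro epow_mono ennreal_leI) auto
        finally show ?case by (simp add: N_def)
      qed
    qed
    then have "epow (\<integral>\<^sup>+x. ennreal (\<bar>trunc_pow \<epsilon> (r / 2) (u x)\<bar> powr p) \<partial>?M) (2 / p) \<le> epow (epow (ennreal c) (p / 2)) (2 / p)"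
      using p by (intro epow_mono) auto
    then show "epow (\<integral>\<^sup>+x. ennreal (\<bar>trunc_pow \<epsilon> (r / 2) (u x)\<bar> powr p) \<partial>?M) (2 / p) \<le> ennreal c"
      using p by (simp add: epow_epow)
  qed
  also have "ennreal (4 * \<gamma>\<^sup>2 * (r + 1) * enn2real S) = ennreal (4 * \<gamma>\<^sup>2 * (r + 1)) * S"
    using r Sfin by (subst ennreal_mult) auto
  finally show ?thesis by (simp add: S_def T_def)
qed

section \<open>Moser iteration\<close>

lemma square_powr: "(y\<^sup>2) powr r = \<bar>y\<bar> powr (2 * r)" for y r :: real
proof -
  have "\<bar>y\<bar> powr 2 = y\<^sup>2" by simp
  then show ?thesis using powr_powr[of "\<bar>y\<bar>" 2 r] by (simp only:)
qed

lemma trunc_sq_tendsto: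
  assumes "\<epsilon> \<longlonglongrightarrow> 0" "\<And>j::nat. 0 < \<epsilon> j"
  shows "(\<lambda>j. trunc_sq (\<epsilon> j) t) \<longlonglongrightarrow> t\<^sup>2"
proof -
  have "(\<lambda>j. \<epsilon> j + t\<^sup>2 / (1 + \<epsilon> j * t\<^sup>2)) \<longlonglongrightarrow> 0 + t\<^sup>2 / (1 + 0 * t\<^sup>2)"
    by (intro tendsto_intros assms) simp
  then show ?thesis using assms(2) by (simp add: trunc_sq_alt)
qed

lemma abs_trunc_pow_tendsto:
  assumes "\<epsilon> \<longlonglongrightarrow> 0" "\<And>j::nat. 0 < \<epsilon> j"
  shows "(\<lambda>j. \<bar>trunc_pow (\<epsilon> j) r t\<bar>) \<longlonglongrightarrow> \<bar>t\<bar> powr (1 + 2 * r)"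
proof (cases "t = 0")
  case True
  then show ?thesis by (simp add: trunc_pow_def)
next
  case False
  have "(\<lambda>j. \<bar>t\<bar> * trunc_sq (\<epsilon> j) t powr r) \<longlonglongrightarrow> \<bar>t\<bar> * (t\<^sup>2) powr r"
    using False by (intro tendsto_intros trunc_sq_tendsto assms) auto
  also have "\<bar>t\<bar> * (t\<^sup>2) powr r = \<bar>t\<bar> powr (1 + 2 * r)"
    using False by (simp add: square_powr powr_add)
  finally show ?thesis using assms(2) by (simp add: trunc_pow_def abs_mult)
qed

lemma powr_le_one_plus_powr: "0 \<le> a \<Longrightarrow> a \<le> b \<Longrightarrow> 0 \<le> x \<Longrightarrow> x powr a \<le> 1 + x powr b"
  for x a b :: real
proof (cases "x \<le> 1")
  case True
  assume "0 \<le> a" "0 \<le> x"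
  then have "x powr a \<le> 1" using True by (simp add: powr_le1)
  then show ?thesis using powr_ge_zero[of x b] by linarith
next
  case False
  assume "a \<le> b"
  then have "x powr a \<le> x powr b" using False by (intro powr_mono) auto
  then show ?thesis by linarith
qed

text \<open>Separates the iteration from the equation: what remains is a finite measure, one finite
  critical moment and the family \<open>key\<close> with a constant independent of
  \<open>\<epsilon>\<close> and \<open>r\<close>.\<close>

locale moser = finite_measure M for M :: "'a measure" +
  fixes u :: "'a \<Rightarrow> real" and p K :: real
  assumes um [measurable]: "u \<in> borel_measurable M" and p2: "2 < p" and K0: "0 < K"
    and up: "(\<integral>\<^sup>+x. ennreal (\<bar>u x\<bar> powr p) \<partial>M) < top"
    and key: "\<And>\<epsilon> r. 0 < \<epsilon> \<Longrightarrow> 0 \<le> r \<Longrightarrow>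
      epow (\<integral>\<^sup>+x. ennreal (\<bar>trunc_pow \<epsilon> (r / 2) (u x)\<bar> powr p) \<partial>M) (2 / p)
      \<le> ennreal (K * (r + 1)) * (\<integral>\<^sup>+x. ennreal ((1 + \<bar>u x\<bar> powr (p - 1)) * \<bar>trunc_pow \<epsilon> r (u x)\<bar>) \<partial>M)"
begin

lemma trunc_measurable:
  assumes "0 < \<epsilon>"
  shows "(\<lambda>x. trunc_pow \<epsilon> r (u x)) \<in> borel_measurable M"
  using measurable_compose[OF um borel_measurable_continuous_onI[OF trunc_pow_continuous[OF assms]]] .

lemma tail_tendsto_0:
  "(\<lambda>j::nat. \<integral>\<^sup>+x. ennreal (indicator {x. real j < \<bar>u x\<bar>} x * \<bar>u x\<bar> powr p) \<partial>M) \<longlonglongrightarrow> 0"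
proof -
  have "(\<lambda>j::nat. \<integral>\<^sup>+x. ennreal (indicator {x. real j < \<bar>u x\<bar>} x * \<bar>u x\<bar> powr p) \<partial>M) \<longlonglongrightarrow> (\<integral>\<^sup>+x. 0 \<partial>M)"
  proof (rule nn_integral_dominated_convergence[where w="\<lambda>x. ennreal (\<bar>u x\<bar> powr p)"])
    have "(\<lambda>x. if real j < \<bar>u x\<bar> then \<bar>u x\<bar> powr p else 0) \<in> borel_measurable M" for j :: nat
      by measurable
    also have "(\<lambda>x. if real j < \<bar>u x\<bar> then \<bar>u x\<bar> powr p else 0) = (\<lambda>x. indicat_real {x. real j < \<bar>u x\<bar>} x * \<bar>u x\<bar> powr p)" for j :: nat
      by (auto simp: fun_eq_iff)
    finally show "(\<lambda>x. ennreal (indicat_real {x. real j < \<bar>u x\<bar>} x * \<bar>u x\<bar> powr p)) \<in> borel_measurable M" for j :: nat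
      by measurable
    show "AE x in M. (\<lambda>j::nat. ennreal (indicat_real {x. real j < \<bar>u x\<bar>} x * \<bar>u x\<bar> powr p)) \<longlonglongrightarrow> 0"
    proof (intro AE_I2 tendsto_eventually)
      fix x
      have "\<forall>\<^sub>F j::nat in sequentially. \<bar>u x\<bar> \<le> real j" by real_asymp
      then show "\<forall>\<^sub>F j::nat in sequentially. ennreal (indicat_real {x. real j < \<bar>u x\<bar>} x * \<bar>u x\<bar> powr p) = 0"
        by eventually_elim simp
    qed
    show "AE x in M. ennreal (indicat_real {x. real j < \<bar>u x\<bar>} x * \<bar>u x\<bar> powr p) \<le> ennreal (\<bar>u x\<bar> powr p)" for j :: nat
      by (intro AE_I2 ennreal_leI) (auto simp: indicator_def)
  qed (use up in auto)
  then show ?thesis by simp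
qed

text \<open>Absorption subtracts half of a norm from both sides, so this norm must be finite
  beforehand. The bound used here depends on \<open>\<epsilon>\<close>, in contrast to the one that
  absorption yields.\<close>

lemma trunc_norm_finite:
  assumes e: "0 < \<epsilon>" and r: "0 \<le> r"
  shows "(\<integral>\<^sup>+x. ennreal (\<bar>trunc_pow \<epsilon> r (u x)\<bar> powr p) \<partial>M) < top"
proof -
  define c where "c = (\<epsilon> + 1 / \<epsilon>) powr r"
  have "(\<integral>\<^sup>+x. ennreal (\<bar>trunc_pow \<epsilon> r (u x)\<bar> powr p) \<partial>M) \<le> (\<integral>\<^sup>+x. ennreal (c powr p) * ennreal (\<bar>u x\<bar> powr p) \<partial>M)"
  proof (rule nn_integral_mono)
    fix x
    have "\<bar>trunc_pow \<epsilon> r (u x)\<bar> powr p \<le> (c * \<bar>u x\<bar>) powr p"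
      using trunc_pow_le[OF e r, of "u x"] p2 unfolding c_def by (intro powr_mono2) auto
    then have "ennreal (\<bar>trunc_pow \<epsilon> r (u x)\<bar> powr p) \<le> ennreal (c powr p * \<bar>u x\<bar> powr p)"
      by (intro ennreal_leI) (simp add: powr_mult c_def)
    then show "ennreal (\<bar>trunc_pow \<epsilon> r (u x)\<bar> powr p) \<le> ennreal (c powr p) * ennreal (\<bar>u x\<bar> powr p)"
      by (simp add: ennreal_mult)
  qed
  also have "\<dots> = ennreal (c powr p) * (\<integral>\<^sup>+x. ennreal (\<bar>u x\<bar> powr p) \<partial>M)"
    by (rule nn_integral_cmult) simp
  also have "\<dots> < top" using up by (simp add: ennreal_mult_less_top)
  finally show ?thesis .
qed

text \<open>Brezis--Kato: on a high superlevel set of \<open>u\<close> the critical power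
  \<open>\<bar>u\<bar> powr (p - 2)\<close> has small norm, so that this part of the right-hand side
  is absorbed on the left, uniformly in the truncation.\<close>

lemma trunc_norm_uniform_bound:
  assumes r: "0 \<le> r"
  obtains B where "\<And>\<epsilon>. 0 < \<epsilon> \<Longrightarrow> \<epsilon> \<le> 1 \<Longrightarrow>
    (\<integral>\<^sup>+x. ennreal (\<bar>trunc_pow \<epsilon> (r / 2) (u x)\<bar> powr p) \<partial>M) \<le> ennreal B"
proof -
  define \<eta> where "\<eta> j = (\<integral>\<^sup>+x. ennreal (indicator {x. real j < \<bar>u x\<bar>} x * \<bar>u x\<bar> powr p) \<partial>M)" for j :: nat
  define c where "c = K * (r + 1)"
  have c0: "0 < c" using K0 r by (simp add: c_def)
  have p': "0 < (p - 2) / p" "0 < p / (p - 2)" "0 < p / 2" "1 / (p / (p - 2)) + 1 / (p / 2) = 1"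
    using p2 by (auto simp: field_simps)
  have "(\<lambda>j. epow (\<eta> j) ((p - 2) / p)) \<longlonglongrightarrow> 0"
    using tail_tendsto_0 p' unfolding \<eta>_def by (intro epow_tendsto_0)
  \<comment> \<open>The threshold cancels \<open>c\<close> and the 2 from \<open>1 + \<bar>u x\<bar>
    powr (p - 1) \<le> 2 * \<bar>u x\<bar> powr (p - 1)\<close>, so that exactly half of
    \<open>X\<close> is left to absorb. That inequality holds above level \<open>j\<close> because
    \<open>j\<close> is chosen at least 1.\<close>
  from tendsto_0_ennrealD[OF this, of "1 / (4 * c)"] c0
  have "\<forall>\<^sub>F j in sequentially. epow (\<eta> j) ((p - 2) / p) < ennreal (1 / (4 * c))" by simp
  then obtain j where j: "1 \<le> j" "epow (\<eta> j) ((p - 2) / p) < ennreal (1 / (4 * c))"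
    using eventually_conj[OF _ eventually_ge_at_top[of "1::nat"]] by (metis (mono_tags, lifting) eventually_sequentially order_refl)
  define R where "R = real j"
  have R1: "1 \<le> R" using j by (simp add: R_def)
  \<comment> \<open>Bounds the integrand where \<open>\<bar>u\<bar> \<le> R\<close>: there
    \<open>trunc_sq\<close> is at most \<open>1 + R\<^sup>2\<close>, uniformly for
    \<open>\<epsilon> \<le> 1\<close>.\<close>
  define C where "C = (1 + R powr (p - 1)) * (R * (1 + R\<^sup>2) powr r)"
  have C0: "0 \<le> C" using R1 by (simp add: C_def)
  define B1 where "B1 = 2 * (c * (C * measure M (space M)))"
  have main: "epow (\<integral>\<^sup>+x. ennreal (\<bar>trunc_pow \<epsilon> (r / 2) (u x)\<bar> powr p) \<partial>M) (2 / p) \<le> ennreal B1"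
    if e: "0 < \<epsilon>" "\<epsilon> \<le> 1" for \<epsilon>
  proof -
    define X where "X = epow (\<integral>\<^sup>+x. ennreal (\<bar>trunc_pow \<epsilon> (r / 2) (u x)\<bar> powr p) \<partial>M) (2 / p)"
    define ind where "ind x = indicat_real {x. R < \<bar>u x\<bar>} x" for x
    note tm = trunc_measurable[OF e(1)]
    have [measurable]: "ind \<in> borel_measurable M"
    proof -
      have "(\<lambda>x. if R < \<bar>u x\<bar> then 1 else 0::real) \<in> borel_measurable M" by measurable
      also have "(\<lambda>x. if R < \<bar>u x\<bar> then 1 else 0::real) = ind" by (auto simp: ind_def fun_eq_iff)
      finally show ?thesis .
    qed
    have Xfin: "X < top"
      using trunc_norm_finite[OF e(1), of "r / 2"] r by (auto simp: X_def epow_def)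
    have pt: "ennreal ((1 + \<bar>u x\<bar> powr (p - 1)) * \<bar>trunc_pow \<epsilon> r (u x)\<bar>)
        \<le> ennreal C + 2 * ennreal \<bar>(ind x * \<bar>u x\<bar> powr (p - 2)) * (trunc_pow \<epsilon> (r / 2) (u x))\<^sup>2\<bar>" for x
    proof (cases "\<bar>u x\<bar> \<le> R")
      case True
      have "trunc_sq \<epsilon> (u x) \<le> 1 + R\<^sup>2"
        using trunc_sq_bounds(4)[OF e(1), of "u x"] e(2) power_mono[OF True, of 2] by simp
      then have "(1 + \<bar>u x\<bar> powr (p - 1)) * \<bar>trunc_pow \<epsilon> r (u x)\<bar> \<le> C"
        unfolding abs_trunc_pow[OF e(1)] C_def
        using True r R1 p2 trunc_sq_bounds(2)[OF e(1), of "u x"]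
        by (intro mult_mono add_left_mono powr_mono2) auto
      then have "ennreal ((1 + \<bar>u x\<bar> powr (p - 1)) * \<bar>trunc_pow \<epsilon> r (u x)\<bar>) \<le> ennreal C" by (rule ennreal_leI)
      then show ?thesis by (meson add_increasing2 order_trans zero_le le_add_same_cancel1 dual_order.refl)
    next
      case False
      then have u1: "1 < \<bar>u x\<bar>" using R1 by simp
      then have "1 \<le> \<bar>u x\<bar> powr (p - 1)" using p2 by (simp add: ge_one_powr_ge_zero)
      then have "(1 + \<bar>u x\<bar> powr (p - 1)) * \<bar>trunc_pow \<epsilon> r (u x)\<bar> \<le> (2 * \<bar>u x\<bar> powr (p - 1)) * \<bar>trunc_pow \<epsilon> r (u x)\<bar>"
        by (intro mult_right_mono) auto
      also have "\<dots> = 2 * (\<bar>u x\<bar> powr (p - 2) * (\<bar>u x\<bar> * \<bar>trunc_pow \<epsilon> r (u x)\<bar>))"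
      proof -
        have "\<bar>u x\<bar> powr (p - 1) = \<bar>u x\<bar> powr (p - 2) * \<bar>u x\<bar>"
          using u1 powr_add[of "\<bar>u x\<bar>" "p - 2" 1] by simp
        then show ?thesis by simp
      qed
      also have "\<bar>u x\<bar> * \<bar>trunc_pow \<epsilon> r (u x)\<bar> = (trunc_pow \<epsilon> (r / 2) (u x))\<^sup>2"
        using trunc_pow_half_square[OF e(1), of r "u x"] by (metis abs_mult abs_power2)
      finally have "ennreal ((1 + \<bar>u x\<bar> powr (p - 1)) * \<bar>trunc_pow \<epsilon> r (u x)\<bar>)
          \<le> ennreal (2 * (\<bar>u x\<bar> powr (p - 2) * (trunc_pow \<epsilon> (r / 2) (u x))\<^sup>2))" by (rule ennreal_leI)
      also have "\<dots> = 2 * ennreal \<bar>(ind x * \<bar>u x\<bar> powr (p - 2)) * (trunc_pow \<epsilon> (r / 2) (u x))\<^sup>2\<bar>"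
        using False by (simp add: ind_def ennreal_mult)
      also have "\<dots> \<le> ennreal C + \<dots>" by simp
      finally show ?thesis .
    qed
    have "(\<integral>\<^sup>+x. ennreal ((1 + \<bar>u x\<bar> powr (p - 1)) * \<bar>trunc_pow \<epsilon> r (u x)\<bar>) \<partial>M)
        \<le> (\<integral>\<^sup>+x. ennreal C + 2 * ennreal \<bar>(ind x * \<bar>u x\<bar> powr (p - 2)) * (trunc_pow \<epsilon> (r / 2) (u x))\<^sup>2\<bar> \<partial>M)"
      by (intro nn_integral_mono pt)
    also have "\<dots> = ennreal C * emeasure M (space M)
        + 2 * (\<integral>\<^sup>+x. ennreal \<bar>(ind x * \<bar>u x\<bar> powr (p - 2)) * (trunc_pow \<epsilon> (r / 2) (u x))\<^sup>2\<bar> \<partial>M)"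
      using tm by (subst nn_integral_add) (auto simp: nn_integral_cmult)
    \<comment> \<open>The conjugate exponents \<open>p / (p - 2)\<close> and \<open>p / 2\<close>
      turn the two factors into the tail of the critical moment and into the left-hand side.\<close>
    also have "(\<integral>\<^sup>+x. ennreal \<bar>(ind x * \<bar>u x\<bar> powr (p - 2)) * (trunc_pow \<epsilon> (r / 2) (u x))\<^sup>2\<bar> \<partial>M)
        \<le> epow (\<integral>\<^sup>+x. ennreal (\<bar>ind x * \<bar>u x\<bar> powr (p - 2)\<bar> powr (p / (p - 2))) \<partial>M) (1 / (p / (p - 2)))
          * epow (\<integral>\<^sup>+x. ennreal (\<bar>(trunc_pow \<epsilon> (r / 2) (u x))\<^sup>2\<bar> powr (p / 2)) \<partial>M) (1 / (p / 2))"
      using tm p' by (intro nn_integral_Hoelder_real) auto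
    also have "(\<integral>\<^sup>+x. ennreal (\<bar>ind x * \<bar>u x\<bar> powr (p - 2)\<bar> powr (p / (p - 2))) \<partial>M) = \<eta> j"
      unfolding \<eta>_def R_def[symmetric] ind_def using p2
      by (intro nn_integral_cong arg_cong[where f=ennreal]) (auto simp: indicator_def powr_powr)
    also have "(\<integral>\<^sup>+x. ennreal (\<bar>(trunc_pow \<epsilon> (r / 2) (u x))\<^sup>2\<bar> powr (p / 2)) \<partial>M)
        = (\<integral>\<^sup>+x. ennreal (\<bar>trunc_pow \<epsilon> (r / 2) (u x)\<bar> powr p) \<partial>M)"
    proof (intro nn_integral_cong arg_cong[where f=ennreal])
      fix x
      show "\<bar>(trunc_pow \<epsilon> (r / 2) (u x))\<^sup>2\<bar> powr (p / 2) = \<bar>trunc_pow \<epsilon> (r / 2) (u x)\<bar> powr p"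
        by (simp add: square_powr)
    qed
    also have "epow (\<eta> j) (1 / (p / (p - 2))) * epow (\<integral>\<^sup>+x. ennreal (\<bar>trunc_pow \<epsilon> (r / 2) (u x)\<bar> powr p) \<partial>M) (1 / (p / 2))
        \<le> ennreal (1 / (4 * c)) * X"
      using j(2) by (intro mult_mono) (auto simp: X_def)
    finally have rhs: "(\<integral>\<^sup>+x. ennreal ((1 + \<bar>u x\<bar> powr (p - 1)) * \<bar>trunc_pow \<epsilon> r (u x)\<bar>) \<partial>M)
        \<le> ennreal C * emeasure M (space M) + 2 * (ennreal (1 / (4 * c)) * X)"
      by (simp add: add_left_mono mult_left_mono)
    define x where "x = enn2real X"
    have x: "X = ennreal x" "0 \<le> x" using Xfin by (auto simp: x_def)
    define a where "a = 1 / (4 * c)"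
    have a: "0 \<le> a" "c * (2 * (a * x)) = x / 2" using c0 by (auto simp: a_def)
    have "X \<le> ennreal c * (ennreal C * emeasure M (space M) + 2 * (ennreal a * X))"
      unfolding X_def c_def
      by (rule order_trans[OF key[OF e(1) r]]) (intro mult_left_mono rhs[folded a_def, unfolded X_def c_def], simp)
    also have "\<dots> = ennreal (c * (C * measure M (space M) + 2 * (a * x)))"
      using c0 C0 x(2) a by (simp add: x(1) emeasure_eq_measure ennreal_mult ennreal_plus)
    finally have "x \<le> c * (C * measure M (space M) + 2 * (a * x))"
      using c0 C0 x a by (simp add: ennreal_le_iff)
    also have "\<dots> = c * (C * measure M (space M)) + x / 2"
      unfolding distrib_left a(2) ..
    finally have "x \<le> B1" by (simp add: B1_def)
    then show ?thesis unfolding X_def[symmetric] x(1) by (rule ennreal_leI)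
  qed
  have B10: "0 \<le> B1" using c0 C0 by (simp add: B1_def)
  show thesis
  proof (rule that[of "B1 powr (p / 2)"])
    fix \<epsilon> :: real assume e: "0 < \<epsilon>" "\<epsilon> \<le> 1"
    have "epow (epow (\<integral>\<^sup>+x. ennreal (\<bar>trunc_pow \<epsilon> (r / 2) (u x)\<bar> powr p) \<partial>M) (2 / p)) (p / 2) \<le> epow (ennreal B1) (p / 2)"
      using main[OF e] p2 by (intro epow_mono) auto
    then show "(\<integral>\<^sup>+x. ennreal (\<bar>trunc_pow \<epsilon> (r / 2) (u x)\<bar> powr p) \<partial>M) \<le> ennreal (B1 powr (p / 2))"
      using p2 B10 by (simp add: epow_epow epow_ennreal)
  qed
qed

lemma half_trunc_powr_tendsto:
  assumes "\<epsilon> \<longlonglongrightarrow> 0" "\<And>j::nat. 0 < \<epsilon> j" "0 \<le> r"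
  shows "(\<lambda>j. ennreal (\<bar>trunc_pow (\<epsilon> j) (r / 2) t\<bar> powr p)) \<longlonglongrightarrow> ennreal (\<bar>t\<bar> powr (p * (1 + r)))"
proof -
  have "(\<lambda>j. \<bar>trunc_pow (\<epsilon> j) (r / 2) t\<bar> powr p) \<longlonglongrightarrow> (\<bar>t\<bar> powr (1 + 2 * (r / 2))) powr p"
    using p2 by (intro tendsto_powr'[OF abs_trunc_pow_tendsto tendsto_const] assms) auto
  then show ?thesis
    by (intro tendsto_ennrealI) (simp add: powr_powr mult.commute)
qed

text \<open>Fatou as the truncation is removed, with \<open>r = t\<close>; the resulting exponent
  \<open>p * (1 + t)\<close> exceeds \<open>t\<close>, and the finite measure allows lowering it.
  This is qualitative: the bound depends on the tail of \<open>u\<close>.\<close>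

lemma moments_finite:
  assumes t: "0 \<le> t"
  shows "integrable M (\<lambda>x. \<bar>u x\<bar> powr t)"
proof -
  define \<epsilon> where "\<epsilon> j = 1 / real (Suc j)" for j
  have e: "0 < \<epsilon> j" "\<epsilon> j \<le> 1" for j by (auto simp: \<epsilon>_def)
  have e0: "\<epsilon> \<longlonglongrightarrow> 0" unfolding \<epsilon>_def by real_asymp
  obtain B where B: "\<And>\<epsilon>. 0 < \<epsilon> \<Longrightarrow> \<epsilon> \<le> 1 \<Longrightarrow> (\<integral>\<^sup>+x. ennreal (\<bar>trunc_pow \<epsilon> (t / 2) (u x)\<bar> powr p) \<partial>M) \<le> ennreal B"
    using trunc_norm_uniform_bound[OF t] by metis
  have "(\<integral>\<^sup>+x. ennreal (\<bar>u x\<bar> powr (p * (1 + t))) \<partial>M) \<le> ennreal B"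
  proof (rule nn_integral_le_of_tendsto)
    show "(\<lambda>x. ennreal (\<bar>trunc_pow (\<epsilon> j) (t / 2) (u x)\<bar> powr p)) \<in> borel_measurable M" for j
      using trunc_measurable[OF e(1)] by measurable
    show "AE x in M. (\<lambda>j. ennreal (\<bar>trunc_pow (\<epsilon> j) (t / 2) (u x)\<bar> powr p)) \<longlonglongrightarrow> ennreal (\<bar>u x\<bar> powr (p * (1 + t)))"
      using t by (intro AE_I2 half_trunc_powr_tendsto e0 e) auto
    show "\<forall>\<^sub>F j in sequentially. (\<integral>\<^sup>+x. ennreal (\<bar>trunc_pow (\<epsilon> j) (t / 2) (u x)\<bar> powr p) \<partial>M) \<le> ennreal B"
      by (intro always_eventually allI B e)
  qed
  then have "(\<integral>\<^sup>+x. ennreal (\<bar>u x\<bar> powr (p * (1 + t))) \<partial>M) < top"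
    by (rule order.strict_trans1) simp
  then have i: "integrable M (\<lambda>x. \<bar>u x\<bar> powr (p * (1 + t)))"
    by (intro integrableI_bounded) auto
  have "t \<le> p * (1 + t)"
  proof -
    have "t \<le> 1 + t" by simp
    also have "\<dots> \<le> p * (1 + t)" using p2 t by (simp add: mult_le_cancel_right1)
    finally show ?thesis .
  qed
  note le = this
  show ?thesis
  proof (rule Bochner_Integration.integrable_bound)
    show "integrable M (\<lambda>x. 1 + \<bar>u x\<bar> powr (p * (1 + t)))" using i by simp
    show "AE x in M. norm (\<bar>u x\<bar> powr t) \<le> norm (1 + \<bar>u x\<bar> powr (p * (1 + t)))"
      using powr_le_one_plus_powr[OF t le abs_ge_zero] by (intro AE_I2) simp
  qed measurable
qed

text \<open>With all moments finite, dominated convergence applies on the right and Fatou on the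
  left, without absorption. Hence the constant depends only on \<open>K\<close>, \<open>r\<close>
  and the total measure. The term 1 in the growth is paid by the measure, through \<open>\<bar>u
  x\<bar> powr (1 + 2 * r) \<le> 1 + \<bar>u x\<bar> powr (p + 2 * r)\<close>.\<close>

lemma moment_step:
  assumes r: "0 \<le> r"
  shows "(LINT x|M. \<bar>u x\<bar> powr (p * (1 + r))) powr (2 / p)
    \<le> K * (r + 1) * (measure M (space M) + 2 * (LINT x|M. \<bar>u x\<bar> powr (p + 2 * r)))"
proof -
  define \<epsilon> where "\<epsilon> j = 1 / real (Suc j)" for j
  have e: "0 < \<epsilon> j" "\<epsilon> j \<le> 1" for j by (auto simp: \<epsilon>_def)
  have e0: "\<epsilon> \<longlonglongrightarrow> 0" unfolding \<epsilon>_def by real_asymp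
  define W where "W j = (\<integral>\<^sup>+x. ennreal ((1 + \<bar>u x\<bar> powr (p - 1)) * \<bar>trunc_pow (\<epsilon> j) r (u x)\<bar>) \<partial>M)" for j
  define W0 where "W0 = (\<integral>\<^sup>+x. ennreal ((1 + \<bar>u x\<bar> powr (p - 1)) * \<bar>u x\<bar> powr (1 + 2 * r)) \<partial>M)"
  have W: "W \<longlonglongrightarrow> W0"
    unfolding W_def W0_def
  proof (rule nn_integral_dominated_convergence[where w="\<lambda>x. ennreal ((1 + \<bar>u x\<bar> powr (p - 1)) * (\<bar>u x\<bar> * (2 powr r * (1 + \<bar>u x\<bar> powr (2 * r)))))"])
    show "(\<lambda>x. ennreal ((1 + \<bar>u x\<bar> powr (p - 1)) * \<bar>trunc_pow (\<epsilon> j) r (u x)\<bar>)) \<in> borel_measurable M" for j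
      using trunc_measurable[OF e(1)] by measurable
    show "AE x in M. (\<lambda>j. ennreal ((1 + \<bar>u x\<bar> powr (p - 1)) * \<bar>trunc_pow (\<epsilon> j) r (u x)\<bar>)) \<longlonglongrightarrow>
        ennreal ((1 + \<bar>u x\<bar> powr (p - 1)) * \<bar>u x\<bar> powr (1 + 2 * r))"
      by (intro AE_I2 tendsto_ennrealI tendsto_mult tendsto_const abs_trunc_pow_tendsto e0 e)
    show "AE x in M. ennreal ((1 + \<bar>u x\<bar> powr (p - 1)) * \<bar>trunc_pow (\<epsilon> j) r (u x)\<bar>)
        \<le> ennreal ((1 + \<bar>u x\<bar> powr (p - 1)) * (\<bar>u x\<bar> * (2 powr r * (1 + \<bar>u x\<bar> powr (2 * r)))))" for j
    proof (intro AE_I2 ennreal_leI mult_left_mono)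
      fix x
      have "trunc_sq (\<epsilon> j) (u x) powr r \<le> \<bar>1 + (u x)\<^sup>2\<bar> powr r"
        using trunc_sq_bounds[OF e(1), of j "u x"] e(2)[of j] r by (intro powr_mono2) auto
      also have "\<dots> \<le> 2 powr r * (\<bar>1\<bar> powr r + \<bar>(u x)\<^sup>2\<bar> powr r)"
        by (rule abs_powr_add_le[OF r])
      also have "\<bar>(u x)\<^sup>2\<bar> powr r = \<bar>u x\<bar> powr (2 * r)"
        by (simp add: square_powr)
      finally show "\<bar>trunc_pow (\<epsilon> j) r (u x)\<bar> \<le> \<bar>u x\<bar> * (2 powr r * (1 + \<bar>u x\<bar> powr (2 * r)))"
        unfolding abs_trunc_pow[OF e(1)] by (intro mult_left_mono) auto
    qed auto
    have "integrable M (\<lambda>x. 2 powr r * (\<bar>u x\<bar> powr 1 + \<bar>u x\<bar> powr (1 + 2 * r) + \<bar>u x\<bar> powr p + \<bar>u x\<bar> powr (p + 2 * r)))"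
      using r p2 by (intro integrable_mult_right Bochner_Integration.integrable_add moments_finite) auto
    moreover have "2 powr r * (\<bar>u x\<bar> powr 1 + \<bar>u x\<bar> powr (1 + 2 * r) + \<bar>u x\<bar> powr p + \<bar>u x\<bar> powr (p + 2 * r))
        = (1 + \<bar>u x\<bar> powr (p - 1)) * (\<bar>u x\<bar> * (2 powr r * (1 + \<bar>u x\<bar> powr (2 * r))))" for x
    proof -
      have "\<bar>u x\<bar> powr (1 + 2 * r) = \<bar>u x\<bar> * \<bar>u x\<bar> powr (2 * r)"
        "\<bar>u x\<bar> powr p = \<bar>u x\<bar> powr (p - 1) * \<bar>u x\<bar>"
        "\<bar>u x\<bar> powr (p + 2 * r) = \<bar>u x\<bar> powr (p - 1) * \<bar>u x\<bar> * \<bar>u x\<bar> powr (2 * r)"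
        using powr_add[of "\<bar>u x\<bar>" 1 "2 * r"] powr_add[of "\<bar>u x\<bar>" "p - 1" 1] powr_add[of "\<bar>u x\<bar>" p "2 * r"] by auto
      then show ?thesis by (simp add: algebra_simps)
    qed
    ultimately have "integrable M (\<lambda>x. (1 + \<bar>u x\<bar> powr (p - 1)) * (\<bar>u x\<bar> * (2 powr r * (1 + \<bar>u x\<bar> powr (2 * r)))))"
      by (simp only:)
    then show "(\<integral>\<^sup>+x. ennreal ((1 + \<bar>u x\<bar> powr (p - 1)) * (\<bar>u x\<bar> * (2 powr r * (1 + \<bar>u x\<bar> powr (2 * r))))) \<partial>M) < \<infinity>"
      by (subst nn_integral_eq_integral) (auto intro!: AE_I2)
  qed measurable
  have W0: "W0 \<le> ennreal (measure M (space M) + 2 * (LINT x|M. \<bar>u x\<bar> powr (p + 2 * r)))"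
  proof -
    have i: "integrable M (\<lambda>x. 1 + 2 * \<bar>u x\<bar> powr (p + 2 * r))"
      using r p2 by (intro Bochner_Integration.integrable_add integrable_mult_right moments_finite) auto
    have "W0 \<le> (\<integral>\<^sup>+x. ennreal (1 + 2 * \<bar>u x\<bar> powr (p + 2 * r)) \<partial>M)"
      unfolding W0_def
    proof (intro nn_integral_mono ennreal_leI)
      fix x
      have "\<bar>u x\<bar> powr (1 + 2 * r) \<le> 1 + \<bar>u x\<bar> powr (p + 2 * r)"
        using r p2 by (intro powr_le_one_plus_powr) auto
      moreover have "\<bar>u x\<bar> powr (p - 1) * \<bar>u x\<bar> powr (1 + 2 * r) = \<bar>u x\<bar> powr (p + 2 * r)"
        by (simp add: powr_add[symmetric])
      ultimately show "(1 + \<bar>u x\<bar> powr (p - 1)) * \<bar>u x\<bar> powr (1 + 2 * r) \<le> 1 + 2 * \<bar>u x\<bar> powr (p + 2 * r)"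
        by (simp add: distrib_right)
    qed
    also have "\<dots> = ennreal (LINT x|M. 1 + 2 * \<bar>u x\<bar> powr (p + 2 * r))"
      using i by (intro nn_integral_eq_integral) auto
    also have "(LINT x|M. 1 + 2 * \<bar>u x\<bar> powr (p + 2 * r)) = measure M (space M) + 2 * (LINT x|M. \<bar>u x\<bar> powr (p + 2 * r))"
      using r p2 moments_finite[of "p + 2 * r"] by simp
    finally show ?thesis .
  qed
  define c where "c = K * (r + 1)"
  have c0: "0 < c" using K0 r by (simp add: c_def)
  define w where "w = enn2real W0"
  have w: "W0 = ennreal w" "0 \<le> w"
    using order.strict_trans1[OF W0 ennreal_less_top] by (auto simp: w_def)
  have "epow (\<integral>\<^sup>+x. ennreal (\<bar>u x\<bar> powr (p * (1 + r))) \<partial>M) (2 / p) \<le> ennreal (c * w)"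
  proof (rule ennreal_le_of_real_gt)
    show "0 \<le> c * w" using c0 w by simp
    fix d assume d: "c * w < d"
    have d0: "0 < d" using d c0 w by (meson less_eq_real_def mult_nonneg_nonneg order_le_less_trans)
    have "(\<lambda>j. ennreal c * W j) \<longlonglongrightarrow> ennreal c * W0"
      using W by (intro tendsto_mult_ennreal tendsto_const) (use c0 w in auto)
    moreover have "ennreal c * W0 < ennreal d"
      unfolding w using c0 w d by (simp add: ennreal_mult[symmetric] ennreal_lessI d0)
    ultimately have ev: "\<forall>\<^sub>F j in sequentially. ennreal c * W j < ennreal d" by (rule order_tendstoD(2))
    have "(\<integral>\<^sup>+x. ennreal (\<bar>u x\<bar> powr (p * (1 + r))) \<partial>M) \<le> epow (ennreal d) (p / 2)"
    proof (rule nn_integral_le_of_tendsto)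
      show "(\<lambda>x. ennreal (\<bar>trunc_pow (\<epsilon> j) (r / 2) (u x)\<bar> powr p)) \<in> borel_measurable M" for j
        using trunc_measurable[OF e(1)] by measurable
      show "AE x in M. (\<lambda>j. ennreal (\<bar>trunc_pow (\<epsilon> j) (r / 2) (u x)\<bar> powr p)) \<longlonglongrightarrow> ennreal (\<bar>u x\<bar> powr (p * (1 + r)))"
        by (intro AE_I2 half_trunc_powr_tendsto e0 e r)
      show "\<forall>\<^sub>F j in sequentially. (\<integral>\<^sup>+x. ennreal (\<bar>trunc_pow (\<epsilon> j) (r / 2) (u x)\<bar> powr p) \<partial>M) \<le> epow (ennreal d) (p / 2)"
        using ev
      proof eventually_elim
        case (elim j)
        have "epow (\<integral>\<^sup>+x. ennreal (\<bar>trunc_pow (\<epsilon> j) (r / 2) (u x)\<bar> powr p) \<partial>M) (2 / p) \<le> ennreal d"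
          using order_trans[OF key[OF e(1) r, folded c_def W_def] less_imp_le[OF elim]] .
        then have "epow (epow (\<integral>\<^sup>+x. ennreal (\<bar>trunc_pow (\<epsilon> j) (r / 2) (u x)\<bar> powr p) \<partial>M) (2 / p)) (p / 2) \<le> epow (ennreal d) (p / 2)"
          using p2 by (intro epow_mono) auto
        then show ?case using p2 by (simp add: epow_epow)
      qed
    qed
    then have "epow (\<integral>\<^sup>+x. ennreal (\<bar>u x\<bar> powr (p * (1 + r))) \<partial>M) (2 / p) \<le> epow (epow (ennreal d) (p / 2)) (2 / p)"
      using p2 by (intro epow_mono) auto
    then show "epow (\<integral>\<^sup>+x. ennreal (\<bar>u x\<bar> powr (p * (1 + r))) \<partial>M) (2 / p) \<le> ennreal d"
      using p2 by (simp add: epow_epow)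
  qed
  also have "(\<integral>\<^sup>+x. ennreal (\<bar>u x\<bar> powr (p * (1 + r))) \<partial>M) = ennreal (LINT x|M. \<bar>u x\<bar> powr (p * (1 + r)))"
    using r p2 by (intro nn_integral_eq_integral moments_finite) auto
  finally have "ennreal ((LINT x|M. \<bar>u x\<bar> powr (p * (1 + r))) powr (2 / p)) \<le> ennreal (c * w)"
    using p2 by (simp add: epow_ennreal)
  then have "(LINT x|M. \<bar>u x\<bar> powr (p * (1 + r))) powr (2 / p) \<le> c * w"
    using c0 w by (simp add: ennreal_le_iff)
  also have "\<dots> \<le> c * (measure M (space M) + 2 * (LINT x|M. \<bar>u x\<bar> powr (p + 2 * r)))"
  proof (rule mult_left_mono)
    have "0 \<le> measure M (space M) + 2 * (LINT x|M. \<bar>u x\<bar> powr (p + 2 * r))"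
      by (intro add_nonneg_nonneg mult_nonneg_nonneg integral_nonneg_AE) auto
    from W0[unfolded w(1)] show "w \<le> measure M (space M) + 2 * (LINT x|M. \<bar>u x\<bar> powr (p + 2 * r))"
      by (simp only: ennreal_le_iff[OF \<open>0 \<le> measure M (space M) + 2 * (LINT x|M. \<bar>u x\<bar> powr (p + 2 * r))\<close>])
  qed (use c0 in simp)
  finally show ?thesis by (simp add: c_def)
qed

end

text \<open>Chebyshev on the set where \<open>\<bar>u\<bar>\<close> exceeds
  \<open>\<Lambda> + \<delta>\<close>: its measure times a fixed positive number is at most
  \<open>(\<Lambda> / (\<Lambda> + \<delta>)) powr t m\<close>, which tends to 0. The mismatch
  \<open>p\<close> between the two exponents is fixed and therefore harmless.\<close>

lemma AE_bound_of_moments: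
  fixes u :: "'a \<Rightarrow> real"
  assumes "finite_measure M" and um [measurable]: "u \<in> borel_measurable M" and L: "0 < \<Lambda>"
    and t: "filterlim t at_top sequentially"
    and i: "\<And>m::nat. integrable M (\<lambda>x. \<bar>u x\<bar> powr (t m + p))" and tp: "\<And>m. 0 \<le> t m + p"
    and le: "\<And>m. (LINT x|M. \<bar>u x\<bar> powr (t m + p)) \<le> \<Lambda> powr t m"
  shows "AE x in M. \<bar>u x\<bar> \<le> \<Lambda>"
proof -
  interpret finite_measure M by fact
  have *: "AE x in M. \<bar>u x\<bar> \<le> \<Lambda> + \<delta>" if d: "0 < \<delta>" for \<delta>
  proof -
    define S where "S = {x \<in> space M. \<Lambda> + \<delta> < \<bar>u x\<bar>}"
    have S [measurable]: "S \<in> sets M" unfolding S_def by measurable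
    have le1: "measure M S * (\<Lambda> + \<delta>) powr (t m + p) \<le> \<Lambda> powr t m" for m
    proof -
      have "measure M S * (\<Lambda> + \<delta>) powr (t m + p) = (LINT x|M. indicator S x * (\<Lambda> + \<delta>) powr (t m + p))"
        using S by simp
      also have "\<dots> \<le> (LINT x|M. \<bar>u x\<bar> powr (t m + p))"
      proof (rule integral_mono[OF _ i])
        show "integrable M (\<lambda>x. indicator S x * (\<Lambda> + \<delta>) powr (t m + p))"
          by (intro integrable_mult_left) (auto simp: emeasure_eq_measure)
        show "indicator S x * (\<Lambda> + \<delta>) powr (t m + p) \<le> \<bar>u x\<bar> powr (t m + p)" for x
          using L d tp[of m] by (auto simp: indicator_def S_def intro!: powr_mono2)
      qed
      finally show ?thesis using le[of m] by linarith
    qed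
    define \<rho> where "\<rho> = \<Lambda> / (\<Lambda> + \<delta>)"
    have rho: "0 < \<rho>" "\<rho> < 1" using L d by (auto simp: \<rho>_def)
    have "measure M S * (\<Lambda> + \<delta>) powr p \<le> \<rho> powr t m" for m
    proof -
      have pos: "0 < (\<Lambda> + \<delta>) powr t m" using L d by simp
      have "measure M S * (\<Lambda> + \<delta>) powr p * (\<Lambda> + \<delta>) powr t m \<le> \<Lambda> powr t m"
        using le1[of m] by (simp add: powr_add mult.assoc mult.commute mult.left_commute)
      then have "measure M S * (\<Lambda> + \<delta>) powr p \<le> \<Lambda> powr t m / (\<Lambda> + \<delta>) powr t m"
        by (simp add: pos_le_divide_eq[OF pos])
      also have "\<dots> = \<rho> powr t m" using L d by (simp add: \<rho>_def powr_divide)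
      finally show ?thesis .
    qed
    moreover have "(\<lambda>m. \<rho> powr t m) \<longlonglongrightarrow> 0"
    proof -
      have "filterlim (\<lambda>m. ln \<rho> * t m) at_bot sequentially"
        using rho by (intro filterlim_tendsto_neg_mult_at_bot[OF tendsto_const _ t]) auto
      then have "(\<lambda>m. exp (ln \<rho> * t m)) \<longlonglongrightarrow> 0"
        by (rule filterlim_compose[OF exp_at_bot])
      then show ?thesis using rho by (simp add: powr_def mult.commute)
    qed
    ultimately have "measure M S * (\<Lambda> + \<delta>) powr p \<le> 0"
      by (intro LIMSEQ_le_const) auto
    moreover have "0 < (\<Lambda> + \<delta>) powr p" using L d by simp
    ultimately have "measure M S = 0"
      by (metis measure_nonneg mult_le_0_iff not_less order_antisym_conv)
    then have "S \<in> null_sets M" using S by (simp add: null_sets_def emeasure_eq_measure)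
    then have "AE x in M. x \<notin> S" by (rule AE_not_in)
    with AE_space show ?thesis by eventually_elim (auto simp: S_def)
  qed
  have "AE x in M. \<forall>j::nat. \<bar>u x\<bar> \<le> \<Lambda> + 1 / real (Suc j)"
    unfolding AE_all_countable by (intro allI *) simp
  then show ?thesis
  proof eventually_elim
    case (elim x)
    have "(\<lambda>j. \<Lambda> + 1 / real (Suc j)) \<longlonglongrightarrow> \<Lambda>" by real_asymp
    then show ?case using elim by (intro LIMSEQ_le_const) auto
  qed
qed

text \<open>The iteration multiplies by \<open>(2 K' (\<kappa> r + 1)) powr (1 / (p r))\<close> at \<open>r = r0 * \<kappa> ^ m\<close>,
  where \<open>\<kappa> = p / 2\<close> and \<open>K' = max 1 (K (\<mu> + 2))\<close>. By \<open>x powr q \<le> exp (2 * sqrt x * q)\<close> the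
  logarithms are dominated by a geometric series of ratio \<open>1 / sqrt \<kappa>\<close>.\<close>

definition moser_const :: "real \<Rightarrow> real \<Rightarrow> real \<Rightarrow> real \<Rightarrow> real" where
  "moser_const p K \<mu> r0 =
     exp (2 * sqrt (2 * max 1 (K * (\<mu> + 2)) * (p / 2 + 1 / r0)) / p / sqrt r0 * (1 / (1 - 1 / sqrt (p / 2))))"

lemma powr_le_exp_sqrt: "0 < x \<Longrightarrow> 0 \<le> q \<Longrightarrow> x powr q \<le> exp (2 * sqrt x * q)" for x q :: real
proof -
  assume x: "0 < x" and q: "0 \<le> q"
  have "ln x = 2 * ln (sqrt x)" using x by (simp add: ln_sqrt)
  also have "\<dots> \<le> 2 * sqrt x" using x ln_bound[of "sqrt x"] by simp
  finally have "q * ln x \<le> q * (2 * sqrt x)" using q by (rule mult_left_mono)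
  then show "x powr q \<le> exp (2 * sqrt x * q)" using x by (simp add: powr_def mult.commute)
qed

context moser
begin

lemma sup_bound:
  assumes r0: "0 < r0"
  shows "AE x in M. \<bar>u x\<bar> \<le> moser_const p K (measure M (space M)) r0 *
    (1 + (LINT x|M. \<bar>u x\<bar> powr (p * (1 + r0)))) powr (1 / (p * r0))"
proof -
  define \<kappa> where "\<kappa> = p / 2"
  have k1: "1 < \<kappa>" and pk: "p = 2 * \<kappa>" using p2 by (auto simp: \<kappa>_def)
  define \<mu> where "\<mu> = measure M (space M)"
  \<comment> \<open>The maximum with 1 ensures \<open>1 \<le> Y m\<close>, so that the summand 1 of
    \<open>J\<close> costs only a factor 2.\<close>
  define K3 where "K3 = max 1 (K * (\<mu> + 2))"
  have K3: "1 \<le> K3" "K * (\<mu> + 2) \<le> K3" by (auto simp: K3_def)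
  define r where "r m = r0 * \<kappa> ^ m" for m :: nat
  have r: "0 < r m" "r0 \<le> r m" for m
    using r0 k1 by (auto simp: r_def mult_le_cancel_left1 intro: one_le_power)
  have rS: "r (Suc m) = \<kappa> * r m" for m by (simp add: r_def)
  define I where "I m = (LINT x|M. \<bar>u x\<bar> powr (p * (1 + r m)))" for m
  have I0: "0 \<le> I m" for m unfolding I_def by (intro integral_nonneg_AE) auto
  define J where "J m = 1 + I m" for m
  have J1: "1 \<le> J m" for m using I0[of m] by (simp add: J_def)
  define Y where "Y m = K3 * (r (Suc m) + 1) * J m" for m
  have Y1: "1 \<le> Y m" for m
  proof -
    have "1 * 1 * 1 \<le> K3 * (r (Suc m) + 1) * J m"
      using K3 J1[of m] r(1)[of "Suc m"] by (intro mult_mono) auto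
    then show ?thesis by (simp add: Y_def)
  qed
  have Istep: "I (Suc m) \<le> Y m powr \<kappa>" for m
  proof -
    \<comment> \<open>The reason for the ratio \<open>\<kappa> = p / 2\<close>: the moment on the
      right of \<open>moment_step\<close> at \<open>r (Suc m)\<close> is the one that the previous
      step has bounded.\<close>
    have ex: "p + 2 * r (Suc m) = p * (1 + r m)" by (simp add: rS pk algebra_simps)
    have "I (Suc m) powr (2 / p) \<le> K * (r (Suc m) + 1) * (\<mu> + 2 * I m)"
      using moment_step[of "r (Suc m)"] r(1)[of "Suc m"] unfolding I_def \<mu>_def ex by simp
    also have "\<dots> \<le> K * (r (Suc m) + 1) * ((\<mu> + 2) * J m)"
      using K0 r(1)[of "Suc m"] I0[of m] by (intro mult_left_mono) (auto simp: J_def algebra_simps \<mu>_def)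
    also have "\<dots> = (K * (\<mu> + 2)) * ((r (Suc m) + 1) * J m)" by (simp add: algebra_simps)
    also have "\<dots> \<le> K3 * ((r (Suc m) + 1) * J m)"
      using K3 r(1)[of "Suc m"] J1[of m] by (intro mult_right_mono mult_nonneg_nonneg) auto
    also have "\<dots> = Y m" by (simp add: Y_def)
    finally have "(I (Suc m) powr (2 / p)) powr \<kappa> \<le> Y m powr \<kappa>"
      using k1 by (intro powr_mono2) auto
    then show ?thesis using I0[of "Suc m"] k1 by (simp add: powr_powr pk)
  qed
  have Jstep: "J (Suc m) \<le> (2 * Y m) powr \<kappa>" for m
  proof -
    have "1 \<le> Y m powr \<kappa>" using Y1[of m] k1 by (intro ge_one_powr_ge_zero) auto
    then have "J (Suc m) \<le> 2 * Y m powr \<kappa>" using Istep[of m] by (simp add: J_def)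
    also have "\<dots> \<le> 2 powr \<kappa> * Y m powr \<kappa>"
      using k1 powr_mono[of 1 \<kappa> "2::real"] by (intro mult_right_mono) auto
    also have "\<dots> = (2 * Y m) powr \<kappa>" using Y1[of m] by (simp add: powr_mult)
    finally show ?thesis .
  qed
  \<comment> \<open>The normalising exponent is \<open>1 / (p * r m)\<close>, not
    \<open>1 / (p * (1 + r m))\<close>: then the power \<open>\<kappa>\<close> cancels exactly and
    \<open>A (Suc m)\<close> is at most a factor times \<open>A m\<close>. At \<open>m = 0\<close>
    this produces the exponent \<open>1 / (p * r0)\<close> of the final estimate.\<close>
  define A where "A m = J m powr (1 / (p * r m))" for m
  define c1 where "c1 = 2 * sqrt (2 * K3 * (\<kappa> + 1 / r0)) / p"
  define \<rho> where "\<rho> = 1 / sqrt \<kappa>"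
  have rho: "0 < \<rho>" "\<rho> < 1" using k1 by (auto simp: \<rho>_def)
  have c1: "0 \<le> c1" using K3 k1 r0 pk by (auto simp: c1_def)
  have Astep: "A (Suc m) \<le> A m * exp (c1 / sqrt r0 * \<rho> ^ m)" for m
  proof -
    define q where "q = 1 / (p * r m)"
    have q: "0 < q" "\<kappa> * (1 / (p * r (Suc m))) = q" using r[of m] p2 k1 by (auto simp: q_def rS)
    have "A (Suc m) \<le> ((2 * Y m) powr \<kappa>) powr (1 / (p * r (Suc m)))"
      unfolding A_def using Jstep[of m] J1[of "Suc m"] r(1)[of "Suc m"] p2 by (intro powr_mono2) auto
    also have "\<dots> = (2 * Y m) powr q" by (simp only: powr_powr q(2))
    also have "2 * Y m = (2 * K3 * (r (Suc m) + 1)) * J m" by (simp add: Y_def)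
    also have "\<dots> powr q = (2 * K3 * (r (Suc m) + 1)) powr q * A m"
      using K3 r(1)[of "Suc m"] J1[of m] by (subst powr_mult) (auto simp: A_def q_def)
    also have "(2 * K3 * (r (Suc m) + 1)) powr q \<le> exp (2 * sqrt (2 * K3 * (r (Suc m) + 1)) * q)"
      using K3 r(1)[of "Suc m"] q by (intro powr_le_exp_sqrt) auto
    also have "2 * sqrt (2 * K3 * (r (Suc m) + 1)) * q \<le> 2 * sqrt (2 * K3 * (\<kappa> + 1 / r0) * r m) * q"
    proof -
      \<comment> \<open>The summand 1 is absorbed into \<open>r m / r0\<close>, the source of the
        term \<open>1 / r0\<close> in \<open>moser_const\<close>.\<close>
      have "1 \<le> 1 / r0 * r m" using r(2)[of m] r0 by simp
      then have "r (Suc m) + 1 \<le> (\<kappa> + 1 / r0) * r m" by (simp add: rS distrib_right)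
      then have "2 * K3 * (r (Suc m) + 1) \<le> 2 * K3 * ((\<kappa> + 1 / r0) * r m)"
        using K3 by (intro mult_left_mono) auto
      then show ?thesis using q by (intro mult_right_mono mult_left_mono real_sqrt_le_mono) (auto simp: mult.assoc)
    qed
    also have "2 * sqrt (2 * K3 * (\<kappa> + 1 / r0) * r m) * q = c1 * (sqrt (r m) / r m)"
      by (simp add: c1_def q_def real_sqrt_mult)
    also have "sqrt (r m) / r m = 1 / sqrt (r m)"
      using r(1)[of m] by (simp add: field_simps)
    also have "c1 * (1 / sqrt (r m)) = c1 / sqrt r0 * \<rho> ^ m"
      by (simp add: r_def real_sqrt_mult real_sqrt_power \<rho>_def power_one_over)
    finally have "A (Suc m) \<le> exp (c1 / sqrt r0 * \<rho> ^ m) * A m"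
      by (simp add: mult_right_mono A_def)
    then show ?thesis by (simp add: mult.commute)
  qed
  have Abound: "A m \<le> A 0 * exp (c1 / sqrt r0 * (\<Sum>i<m. \<rho> ^ i))" for m
  proof (induction m)
    case 0 show ?case by simp
  next
    case (Suc m)
    have "A (Suc m) \<le> A m * exp (c1 / sqrt r0 * \<rho> ^ m)" by (rule Astep)
    also have "\<dots> \<le> (A 0 * exp (c1 / sqrt r0 * (\<Sum>i<m. \<rho> ^ i))) * exp (c1 / sqrt r0 * \<rho> ^ m)"
      by (intro mult_right_mono Suc.IH) simp
    also have "\<dots> = A 0 * exp (c1 / sqrt r0 * (\<Sum>i<Suc m. \<rho> ^ i))"
      by (simp add: exp_add[symmetric] distrib_left mult.assoc)
    finally show ?case .
  qed
  define C where "C = exp (c1 / sqrt r0 * (1 / (1 - \<rho>)))"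
  define \<Lambda> where "\<Lambda> = C * A 0"
  have A0: "0 < A m" for m using J1[of m] by (simp add: A_def)
  have AL: "A m \<le> \<Lambda>" for m
  proof -
    have "(\<Sum>i<m. \<rho> ^ i) = (1 - \<rho> ^ m) / (1 - \<rho>)"
      using rho by (subst sum_gp_strict) auto
    also have "\<dots> \<le> 1 / (1 - \<rho>)" using rho by (intro divide_right_mono) auto
    finally have "exp (c1 / sqrt r0 * (\<Sum>i<m. \<rho> ^ i)) \<le> C"
      unfolding C_def exp_le_cancel_iff using c1 r0 by (intro mult_left_mono) auto
    then have "A 0 * exp (c1 / sqrt r0 * (\<Sum>i<m. \<rho> ^ i)) \<le> A 0 * C"
      using A0[of 0] by (intro mult_left_mono) auto
    then show ?thesis using Abound[of m] by (simp add: \<Lambda>_def mult.commute)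
  qed
  have "AE x in M. \<bar>u x\<bar> \<le> \<Lambda>"
  proof (rule AE_bound_of_moments[where t="\<lambda>m. p * r m" and p=p])
    show "finite_measure M" by (rule finite_measure_axioms)
    show "0 < \<Lambda>" using A0 by (simp add: \<Lambda>_def C_def)
    have "filterlim (\<lambda>m. \<kappa> ^ m) at_top sequentially"
      using k1 by real_asymp
    then show "filterlim (\<lambda>m. p * r m) at_top sequentially"
      unfolding r_def using p2 r0
      by (intro filterlim_tendsto_pos_mult_at_top[OF tendsto_const]) auto
    show "0 \<le> p * r m + p" for m using p2 r(1)[of m] by simp
    show "integrable M (\<lambda>x. \<bar>u x\<bar> powr (p * r m + p))" for m
      using p2 r(1)[of m] by (intro moments_finite) simp
    show "(LINT x|M. \<bar>u x\<bar> powr (p * r m + p)) \<le> \<Lambda> powr (p * r m)" for m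
    proof -
      have pr: "0 < p * r m" using p2 r(1)[of m] by simp
      have "(LINT x|M. \<bar>u x\<bar> powr (p * r m + p)) = I m" by (simp add: I_def algebra_simps)
      also have "\<dots> \<le> J m" by (simp add: J_def)
      also have "\<dots> = A m powr (p * r m)" using less_imp_neq[OF pr] J1[of m] by (simp add: A_def powr_powr)
      also have "\<dots> \<le> \<Lambda> powr (p * r m)" using AL[of m] A0[of m] pr by (intro powr_mono2) auto
      finally show ?thesis .
    qed
  qed (rule um)
  moreover have "C = moser_const p K \<mu> r0"
    by (simp add: C_def moser_const_def c1_def K3_def \<rho>_def \<kappa>_def)
  moreover have "A 0 = (1 + (LINT x|M. \<bar>u x\<bar> powr (p * (1 + r0)))) powr (1 / (p * r0))"
    by (simp add: A_def J_def I_def r_def)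
  ultimately show ?thesis by (simp add: \<Lambda>_def \<mu>_def)
qed

end

section \<open>The regularity theorem\<close>

text \<open>The exponents satisfy (p-1)/p = 2/n + 1/p, so a factor in L^(n/2) times one in L^p lies
  in the dual of L^p. For a nonnegative potential this places \<open>a * u\<close> in that dual
  space. The auxiliary \<open>\<alpha>\<close> and \<open>\<beta>\<close> are \<open>n / 2\<close>
  and \<open>p\<close> divided by the dual exponent.\<close>

lemma Young_dual_critical:
  fixes x y n :: real
  assumes n: "2 < n" and xy: "0 \<le> x" "0 \<le> y"
  defines "p \<equiv> 2 * n / (n - 2)"
  shows "(x * y) powr (p / (p - 1)) \<le> x powr (n / 2) + y powr p"
proof -
  define p' where "p' = 2 * n / (n + 2)"
  define \<alpha> where "\<alpha> = (n + 2) / 4"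
  define \<beta> where "\<beta> = (n + 2) / (n - 2)"
  have p': "p / (p - 1) = p'"
  proof -
    have "p - 1 = (n + 2) / (n - 2)" using n by (simp add: p_def field_simps)
    then show ?thesis using n by (simp add: p_def p'_def)
  qed
  have ab: "1 < \<alpha>" "1 < \<beta>" "1 / \<alpha> + 1 / \<beta> = 1"
  proof -
    show "1 < \<alpha>" "1 < \<beta>" using n by (auto simp: \<alpha>_def \<beta>_def)
    have "1 / \<alpha> = 4 / (n + 2)" "1 / \<beta> = (n - 2) / (n + 2)" by (simp_all add: \<alpha>_def \<beta>_def)
    then have "1 / \<alpha> + 1 / \<beta> = (4 + (n - 2)) / (n + 2)" by (simp only: add_divide_distrib)
    then show "1 / \<alpha> + 1 / \<beta> = 1" using n by simp
  qed
  have ex: "p' * \<alpha> = n / 2" "p' * \<beta> = p"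
    using n by (simp_all add: p'_def \<alpha>_def \<beta>_def p_def)
  have "(x * y) powr p' = x powr p' * y powr p'" using xy by (simp add: powr_mult)
  also have "\<dots> \<le> (x powr p') powr \<alpha> / \<alpha> + (y powr p') powr \<beta> / \<beta>"
    by (rule Youngs_inequality[OF ab]) auto
  also have "\<dots> = x powr (n / 2) / \<alpha> + y powr p / \<beta>" by (simp only: powr_powr ex)
  also have "\<dots> \<le> x powr (n / 2) / 1 + y powr p / 1"
    using ab by (intro add_mono divide_left_mono) auto
  finally show ?thesis by (simp add: p')
qed

lemma X_space_critical_norm_finite:
  fixes u :: "'a::euclidean_space \<Rightarrow> real"
  assumes "3 \<le> DIM('a)" "u \<in> X_space s \<Omega>" "S \<in> sets lebesgue"
  shows "(\<integral>\<^sup>+x. ennreal (\<bar>u x\<bar> powr two_star DIM('a)) \<partial>lebesgue_on S) < top"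
proof -
  have "(\<integral>\<^sup>+x. ennreal (\<bar>u x\<bar> powr two_star DIM('a)) \<partial>lebesgue) < top"
    by (rule X_space_approx[OF assms(1,2)])
  moreover have "(\<integral>\<^sup>+x. ennreal (\<bar>u x\<bar> powr two_star DIM('a)) \<partial>lebesgue_on S)
      \<le> (\<integral>\<^sup>+x. ennreal (\<bar>u x\<bar> powr two_star DIM('a)) \<partial>lebesgue)"
    using assms(3) by (subst nn_integral_restrict_space) (auto intro!: nn_integral_mono simp: indicator_def)
  ultimately show ?thesis by (rule order.strict_trans1[rotated])
qed

text \<open>Common core of both cases, with \<open>A\<close> in place of \<open>a * u\<close>. Since
  \<open>trunc_pow\<close> has the sign of its argument, the clause over all \<open>T\<close> with
  \<open>0 \<le> u x * T\<close> covers every truncation at once; it is met either by a sign or by a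
  size condition on the potential.\<close>

lemma Linf_estimate_of_weak_form:
  fixes u F A g :: "'a::euclidean_space \<Rightarrow> real"
  assumes n: "3 \<le> DIM('a)" and \<Omega>: "open \<Omega>" "bounded \<Omega>" and u: "u \<in> X_space s \<Omega>"
    and weq: "\<forall>\<phi>\<in>X_space s \<Omega>.
      B_form s u \<phi> + (LINT x:\<Omega>|lebesgue. A x * \<phi> x) = (LINT x:\<Omega>|lebesgue. F x * \<phi> x)"
    and k: "0 < k" and g: "g \<in> borel_measurable (lebesgue_on \<Omega>)" and r0: "0 < r0"
  defines "p \<equiv> two_star DIM('a)"
  defines "\<gamma> \<equiv> 2 * (real DIM('a) - 1) / (real DIM('a) - 2)"
  assumes le: "AE x in lebesgue_on \<Omega>. \<bar>F x\<bar> \<le> k * (1 + \<bar>u x\<bar> powr (p - 1)) \<and>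
      k * (1 + \<bar>u x\<bar> powr (p - 1)) \<le> g x \<and> \<bar>A x\<bar> \<le> g x \<and>
      (\<forall>T. 0 \<le> u x * T \<longrightarrow> - (A x * T) \<le> k * (1 + \<bar>u x\<bar> powr (p - 1)) * \<bar>T\<bar>)"
    and gfin: "(\<integral>\<^sup>+x. ennreal (\<bar>g x\<bar> powr (p / (p - 1))) \<partial>lebesgue_on \<Omega>) < top"
  shows "in_Linf \<Omega> u"
    and "Linf_bound \<Omega> (moser_const p (4 * \<gamma>\<^sup>2 * k) (measure lebesgue \<Omega>) r0) (1 + r0) u"
proof -
  let ?M = "lebesgue_on \<Omega>"
  have \<Omega>m: "\<Omega> \<in> sets lebesgue" "\<Omega> \<in> lmeasurable"
    using \<Omega> by (auto intro: lmeasurable_open)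
  have um: "u \<in> borel_measurable ?M"
    using u by (auto simp: X_space_def intro: measurable_restrict_space1)
  have p2: "2 < p" using n by (simp add: p_def two_star_def field_simps)
  have g0: "0 < \<gamma>" using n by (simp add: \<gamma>_def)
  have up: "(\<integral>\<^sup>+x. ennreal (\<bar>u x\<bar> powr p) \<partial>?M) < top"
    using X_space_critical_norm_finite[OF n u \<Omega>m(1)] by (simp add: p_def)
  have fm: "finite_measure ?M"
    using \<Omega>m by (intro finite_measure_lebesgue_on) auto
  have "moser ?M u p (4 * \<gamma>\<^sup>2 * k)"
  proof (intro moser.intro fm moser_axioms.intro um p2 up)
    show "0 < 4 * \<gamma>\<^sup>2 * k" using g0 k by simp
    fix \<epsilon> r :: real assume e: "0 < \<epsilon>" and r: "0 \<le> r"
    define h where "h x = k * (1 + \<bar>u x\<bar> powr (p - 1))" for x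
    have "epow (\<integral>\<^sup>+x. ennreal (\<bar>trunc_pow \<epsilon> (r / 2) (u x)\<bar> powr p) \<partial>?M) (2 / p)
        \<le> ennreal (4 * \<gamma>\<^sup>2 * (r + 1)) * (\<integral>\<^sup>+x. ennreal (h x * \<bar>trunc_pow \<epsilon> r (u x)\<bar>) \<partial>?M)"
      unfolding p_def \<gamma>_def
    proof (rule truncated_power_estimate[OF n \<Omega>m(1) u e r weq[rule_format] _ g _ gfin[unfolded p_def]])
      show "h \<in> borel_measurable ?M" unfolding h_def using um by measurable
      show "AE x in ?M. \<bar>F x\<bar> \<le> h x \<and> h x \<le> g x \<and> \<bar>A x\<bar> \<le> g x \<and>
          - (A x * trunc_pow \<epsilon> r (u x)) \<le> h x * \<bar>trunc_pow \<epsilon> r (u x)\<bar>"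
        using le
      proof eventually_elim
        case (elim x)
        have "0 \<le> u x * trunc_pow \<epsilon> r (u x)"
          unfolding trunc_pow_half_square[OF e, symmetric] by simp
        with elim show ?case unfolding h_def by blast
      qed
    qed auto
    also have "(\<integral>\<^sup>+x. ennreal (h x * \<bar>trunc_pow \<epsilon> r (u x)\<bar>) \<partial>?M)
        = (\<integral>\<^sup>+x. ennreal k * ennreal ((1 + \<bar>u x\<bar> powr (p - 1)) * \<bar>trunc_pow \<epsilon> r (u x)\<bar>) \<partial>?M)"
      using k by (intro nn_integral_cong) (simp add: h_def ennreal_mult'[symmetric] mult.assoc)
    also have "\<dots> = ennreal k * (\<integral>\<^sup>+x. ennreal ((1 + \<bar>u x\<bar> powr (p - 1)) * \<bar>trunc_pow \<epsilon> r (u x)\<bar>) \<partial>?M)"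
    proof (rule nn_integral_cmult)
      have "(\<lambda>x. trunc_pow \<epsilon> r (u x)) \<in> borel_measurable ?M"
        using measurable_compose[OF um borel_measurable_continuous_onI[OF trunc_pow_continuous[OF e]]] .
      then show "(\<lambda>x. ennreal ((1 + \<bar>u x\<bar> powr (p - 1)) * \<bar>trunc_pow \<epsilon> r (u x)\<bar>)) \<in> borel_measurable ?M"
        using um by measurable
    qed
    also have "ennreal (4 * \<gamma>\<^sup>2 * (r + 1)) * (ennreal k * (\<integral>\<^sup>+x. ennreal ((1 + \<bar>u x\<bar> powr (p - 1)) * \<bar>trunc_pow \<epsilon> r (u x)\<bar>) \<partial>?M))
        = ennreal (4 * \<gamma>\<^sup>2 * k * (r + 1)) * (\<integral>\<^sup>+x. ennreal ((1 + \<bar>u x\<bar> powr (p - 1)) * \<bar>trunc_pow \<epsilon> r (u x)\<bar>) \<partial>?M)"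
      using r k by (simp add: mult.assoc[symmetric] ennreal_mult[symmetric]) (simp add: ac_simps)
    finally show "epow (\<integral>\<^sup>+x. ennreal (\<bar>trunc_pow \<epsilon> (r / 2) (u x)\<bar> powr p) \<partial>?M) (2 / p)
        \<le> ennreal (4 * \<gamma>\<^sup>2 * k * (r + 1)) * (\<integral>\<^sup>+x. ennreal ((1 + \<bar>u x\<bar> powr (p - 1)) * \<bar>trunc_pow \<epsilon> r (u x)\<bar>) \<partial>?M)" .
  qed
  then interpret moser ?M u p "4 * \<gamma>\<^sup>2 * k" .
  have mu: "measure ?M (space ?M) = measure lebesgue \<Omega>"
    using \<Omega>m by (simp add: measure_restrict_space)
  define B where "B = moser_const p (4 * \<gamma>\<^sup>2 * k) (measure lebesgue \<Omega>) r0 *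
    (1 + (LINT x:\<Omega>|lebesgue. \<bar>u x\<bar> powr (p * (1 + r0)))) powr (1 / (p * r0))"
  have "(LINT x|?M. \<bar>u x\<bar> powr (p * (1 + r0))) = (LINT x:\<Omega>|lebesgue. \<bar>u x\<bar> powr (p * (1 + r0)))"
    using \<Omega>m by (simp add: integral_restrict_space set_lebesgue_integral_def)
  then have "AE x in ?M. \<bar>u x\<bar> \<le> B"
    using sup_bound[OF r0] unfolding mu B_def by simp
  then have "AE x in ?M. ennreal \<bar>u x\<bar> \<le> ennreal B"
    by eventually_elim (rule ennreal_leI)
  then have bound: "Linf_norm \<Omega> u \<le> ennreal B"
    unfolding Linf_norm_def by (intro esssup_I) (use um in measurable)
  then show "in_Linf \<Omega> u"
    unfolding in_Linf_def using um by (auto intro: order.strict_trans1)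
  show "Linf_bound \<Omega> (moser_const p (4 * \<gamma>\<^sup>2 * k) (measure lebesgue \<Omega>) r0) (1 + r0) u"
    using bound unfolding Linf_bound_def B_def p_def by simp
qed

text \<open>The power \<open>p - 1\<close> is the largest admissible one: the dual exponent
  \<open>p / (p - 1)\<close> turns it into the critical moment.\<close>

lemma critical_growth_dual:
  fixes u :: "'a \<Rightarrow> real"
  assumes "finite_measure M" "u \<in> borel_measurable M" and p: "1 < p" and k: "0 \<le> k"
    and up: "(\<integral>\<^sup>+x. ennreal (\<bar>u x\<bar> powr p) \<partial>M) < top"
  shows "(\<integral>\<^sup>+x. ennreal (\<bar>k * (1 + \<bar>u x\<bar> powr (p - 1))\<bar> powr (p / (p - 1))) \<partial>M) < top"
proof -
  interpret finite_measure M by fact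
  define c where "c = k powr (p / (p - 1)) * 2 powr (p / (p - 1))"
  have "(\<integral>\<^sup>+x. ennreal (\<bar>k * (1 + \<bar>u x\<bar> powr (p - 1))\<bar> powr (p / (p - 1))) \<partial>M)
      \<le> (\<integral>\<^sup>+x. ennreal c * (1 + ennreal (\<bar>u x\<bar> powr p)) \<partial>M)"
  proof (rule nn_integral_mono)
    fix x
    have "\<bar>k * (1 + \<bar>u x\<bar> powr (p - 1))\<bar> powr (p / (p - 1)) = k powr (p / (p - 1)) * \<bar>1 + \<bar>u x\<bar> powr (p - 1)\<bar> powr (p / (p - 1))"
      using k by (simp add: abs_mult powr_mult)
    also have "\<dots> \<le> k powr (p / (p - 1)) * (2 powr (p / (p - 1)) * (\<bar>1\<bar> powr (p / (p - 1)) + \<bar>\<bar>u x\<bar> powr (p - 1)\<bar> powr (p / (p - 1))))"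
      using p by (intro mult_left_mono abs_powr_add_le) auto
    also have "\<dots> = c * (1 + \<bar>u x\<bar> powr p)"
      using p by (simp add: c_def powr_powr)
    finally have "ennreal (\<bar>k * (1 + \<bar>u x\<bar> powr (p - 1))\<bar> powr (p / (p - 1))) \<le> ennreal (c * (1 + \<bar>u x\<bar> powr p))"
      by (rule ennreal_leI)
    also have "\<dots> = ennreal c * (1 + ennreal (\<bar>u x\<bar> powr p))"
      by (simp add: ennreal_mult c_def)
    finally show "ennreal (\<bar>k * (1 + \<bar>u x\<bar> powr (p - 1))\<bar> powr (p / (p - 1))) \<le> ennreal c * (1 + ennreal (\<bar>u x\<bar> powr p))" .
  qed
  also have "\<dots> = ennreal c * (emeasure M (space M) + (\<integral>\<^sup>+x. ennreal (\<bar>u x\<bar> powr p) \<partial>M))"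
    using assms(2) by (simp add: nn_integral_cmult nn_integral_add)
  also have "\<dots> < top"
    using up by (simp add: ennreal_mult_less_top emeasure_eq_measure)
  finally show ?thesis .
qed

text \<open>The dependence of the constants is expressed by the order of quantifiers:
  \<open>C1\<close> and the function \<open>C2\<close> are fixed before \<open>s\<close>,
  \<open>q\<close>, \<open>a\<close>, \<open>f\<close> and \<open>u\<close>.\<close>

theorem theorem1p3:
  fixes \<Omega> :: "(real ^ 'n) set" and c_f :: real
  assumes "CARD('n) \<ge> 3"
    and "open \<Omega>" and "connected \<Omega>" and "\<Omega> \<noteq> {}" and "bounded \<Omega>"
    and "c_f > 0"
  shows "\<exists>(C1::real) (C2::real \<Rightarrow> real). C1 > 0 \<and> (\<forall>M\<ge>0. C2 M > 0) \<and>
    (\<forall>(s::real) (q::real) (a :: real ^ 'n \<Rightarrow> real) (f :: real ^ 'n \<Rightarrow> real \<Rightarrow> real)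
        (u :: real ^ 'n \<Rightarrow> real).
       0 < s \<longrightarrow> s < 1 \<longrightarrow>
       2 \<le> q \<longrightarrow> q \<le> two_star CARD('n) \<longrightarrow>
       caratheodory \<Omega> f \<longrightarrow>
       (AE x in lebesgue_on \<Omega>. \<forall>t. \<bar>f x t\<bar> \<le> c_f * (1 + \<bar>t\<bar> powr (q - 1))) \<longrightarrow>
       weak_solution s \<Omega> a f u \<longrightarrow>
       ((AE x in lebesgue_on \<Omega>. 0 \<le> a x) \<and> (\<exists>l\<ge>real CARD('n). in_Lp \<Omega> (l / 2) a) \<longrightarrow>
          in_Linf \<Omega> u \<and> Linf_bound \<Omega> C1 ((two_star CARD('n) + 1) / 2) u) \<and>
       (in_Linf \<Omega> a \<longrightarrow>
          in_Linf \<Omega> u \<and>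
          Linf_bound \<Omega> (C2 (enn2real (Linf_norm \<Omega> a))) (two_star CARD('n) / 2) u))"
proof -
  define p where "p = two_star DIM(real ^ 'n)"
  define \<gamma> where "\<gamma> = 2 * (real DIM(real ^ 'n) - 1) / (real DIM(real ^ 'n) - 2)"
  define \<mu> where "\<mu> = measure lebesgue \<Omega>"
  \<comment> \<open>The starting exponent is \<open>\<beta> - 1\<close> for the prescribed
    \<open>\<beta>\<close>. The factor 2 of \<open>c_f\<close> comes from passing to critical
    growth, and a bounded potential adds its norm to the growth constant.\<close>
  define C1 where "C1 = moser_const p (4 * \<gamma>\<^sup>2 * (2 * c_f)) \<mu> ((p - 1) / 2)"
  define C2 where "C2 m = moser_const p (4 * \<gamma>\<^sup>2 * (2 * c_f + m)) \<mu> (p / 2 - 1)" for m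
  have n: "3 \<le> DIM(real ^ 'n)" using assms(1) by simp
  have p2: "2 < p" using assms(1) by (simp add: p_def two_star_def field_simps)
  have \<Omega>m: "\<Omega> \<in> sets lebesgue" "\<Omega> \<in> lmeasurable"
    using assms by (auto intro: lmeasurable_open)
  have fm: "finite_measure (lebesgue_on \<Omega>)"
    using \<Omega>m by (intro finite_measure_lebesgue_on) auto
  have "(AE x in lebesgue_on \<Omega>. 0 \<le> a x) \<and> (\<exists>l\<ge>real CARD('n). in_Lp \<Omega> (l / 2) a) \<longrightarrow>
      in_Linf \<Omega> u \<and> Linf_bound \<Omega> C1 ((p + 1) / 2) u"
    and "in_Linf \<Omega> a \<longrightarrow> in_Linf \<Omega> u \<and> Linf_bound \<Omega> (C2 (enn2real (Linf_norm \<Omega> a))) (p / 2) u"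
    if q: "2 \<le> q" "q \<le> p"
      and f: "AE x in lebesgue_on \<Omega>. \<forall>t. \<bar>f x t\<bar> \<le> c_f * (1 + \<bar>t\<bar> powr (q - 1))"
      and sol: "weak_solution s \<Omega> a f u"
    for s q and a :: "real ^ 'n \<Rightarrow> real" and f and u :: "real ^ 'n \<Rightarrow> real"
  proof -
    have u: "u \<in> X_space s \<Omega>"
      and weq: "\<forall>\<phi>\<in>X_space s \<Omega>.
        B_form s u \<phi> + (LINT x:\<Omega>|lebesgue. a x * u x * \<phi> x) = (LINT x:\<Omega>|lebesgue. f x (u x) * \<phi> x)"
      using sol by (auto simp: weak_solution_def)
    have um: "u \<in> borel_measurable (lebesgue_on \<Omega>)"
      using u by (auto simp: X_space_def intro: measurable_restrict_space1)
    have up: "(\<integral>\<^sup>+x. ennreal (\<bar>u x\<bar> powr p) \<partial>lebesgue_on \<Omega>) < top"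
      using X_space_critical_norm_finite[OF n u \<Omega>m(1)] by (simp add: p_def)
    \<comment> \<open>Growth of order \<open>q - 1\<close> is replaced by critical growth at the
      cost of a factor 2, so \<open>q\<close> disappears from all further estimates.\<close>
    have fu: "\<bar>f x t\<bar> \<le> 2 * c_f * (1 + \<bar>t\<bar> powr (p - 1))" if "\<bar>f x t\<bar> \<le> c_f * (1 + \<bar>t\<bar> powr (q - 1))" for x t
    proof -
      have le: "\<bar>t\<bar> powr (q - 1) \<le> 1 + \<bar>t\<bar> powr (p - 1)" using q by (intro powr_le_one_plus_powr) auto
      have "Q \<le> 1 + P \<Longrightarrow> 0 \<le> P \<Longrightarrow> 1 + Q \<le> 2 * (1 + P)" for P Q :: real by simp
      from this[OF le powr_ge_zero] have "1 + \<bar>t\<bar> powr (q - 1) \<le> 2 * (1 + \<bar>t\<bar> powr (p - 1))" .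
      then have "c_f * (1 + \<bar>t\<bar> powr (q - 1)) \<le> c_f * (2 * (1 + \<bar>t\<bar> powr (p - 1)))"
        using assms(6) by (intro mult_left_mono) auto
      also have "c_f * (2 * (1 + \<bar>t\<bar> powr (p - 1))) = 2 * c_f * (1 + \<bar>t\<bar> powr (p - 1))" by simp
      finally show ?thesis using that by (rule order_trans[rotated])
    qed
    show "(AE x in lebesgue_on \<Omega>. 0 \<le> a x) \<and> (\<exists>l\<ge>real CARD('n). in_Lp \<Omega> (l / 2) a) \<longrightarrow>
      in_Linf \<Omega> u \<and> Linf_bound \<Omega> C1 ((p + 1) / 2) u"
    proof (intro impI, elim conjE exE)
      fix l assume a0: "AE x in lebesgue_on \<Omega>. 0 \<le> a x" and l: "real CARD('n) \<le> l" "in_Lp \<Omega> (l / 2) a"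
      have am: "a \<in> borel_measurable (lebesgue_on \<Omega>)" using l by (simp add: in_Lp_def)
      define h where "h x = 2 * c_f * (1 + \<bar>u x\<bar> powr (p - 1))" for x
      \<comment> \<open>The product \<open>a x * u x\<close> need not be dominated by
        \<open>h\<close>; it enters only the majorant \<open>g\<close>, for which membership in the
        dual space suffices.\<close>
      define g where "g x = h x + \<bar>a x * u x\<bar>" for x
      have h0: "0 \<le> h x" for x using assms(6) by (simp add: h_def)
      have hm: "h \<in> borel_measurable (lebesgue_on \<Omega>)" unfolding h_def using um by measurable
      have gm: "g \<in> borel_measurable (lebesgue_on \<Omega>)" unfolding g_def using um hm am by measurable
      have gfin: "(\<integral>\<^sup>+x. ennreal (\<bar>g x\<bar> powr (p / (p - 1))) \<partial>lebesgue_on \<Omega>) < top"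
      proof -
        define c where "c = 2 powr (p / (p - 1))"
        have "(\<integral>\<^sup>+x. ennreal (\<bar>g x\<bar> powr (p / (p - 1))) \<partial>lebesgue_on \<Omega>)
          \<le> (\<integral>\<^sup>+x. ennreal c * (ennreal (\<bar>h x\<bar> powr (p / (p - 1))) + (1 + ennreal (\<bar>a x\<bar> powr (l / 2)) + ennreal (\<bar>u x\<bar> powr p))) \<partial>lebesgue_on \<Omega>)"
        proof (rule nn_integral_mono)
          fix x
          have "\<bar>g x\<bar> powr (p / (p - 1)) \<le> c * (\<bar>h x\<bar> powr (p / (p - 1)) + \<bar>\<bar>a x * u x\<bar>\<bar> powr (p / (p - 1)))"
            unfolding g_def c_def using p2 by (intro abs_powr_add_le) auto
          also have "\<bar>\<bar>a x * u x\<bar>\<bar> powr (p / (p - 1)) \<le> \<bar>a x\<bar> powr (real CARD('n) / 2) + \<bar>u x\<bar> powr p"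
            using Young_dual_critical[of "real CARD('n)" "\<bar>a x\<bar>" "\<bar>u x\<bar>"] assms(1)
            by (simp add: p_def two_star_def abs_mult)
          \<comment> \<open>Lowers the exponent from \<open>l / 2\<close> to n/2; the extra 1 is
            integrable because the domain has finite measure.\<close>
          also have "\<bar>a x\<bar> powr (real CARD('n) / 2) \<le> 1 + \<bar>a x\<bar> powr (l / 2)"
            using l by (intro powr_le_one_plus_powr) auto
          finally have "\<bar>g x\<bar> powr (p / (p - 1)) \<le> c * (\<bar>h x\<bar> powr (p / (p - 1)) + (1 + \<bar>a x\<bar> powr (l / 2) + \<bar>u x\<bar> powr p))"
            by (simp add: c_def mult_left_mono add_left_mono)
          then have "ennreal (\<bar>g x\<bar> powr (p / (p - 1))) \<le> ennreal (c * (\<bar>h x\<bar> powr (p / (p - 1)) + (1 + \<bar>a x\<bar> powr (l / 2) + \<bar>u x\<bar> powr p)))"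
            by (rule ennreal_leI)
          then show "ennreal (\<bar>g x\<bar> powr (p / (p - 1))) \<le> ennreal c * (ennreal (\<bar>h x\<bar> powr (p / (p - 1))) + (1 + ennreal (\<bar>a x\<bar> powr (l / 2)) + ennreal (\<bar>u x\<bar> powr p)))"
            by (simp add: ennreal_mult c_def)
        qed
        also have "\<dots> = ennreal c * ((\<integral>\<^sup>+x. ennreal (\<bar>h x\<bar> powr (p / (p - 1))) \<partial>lebesgue_on \<Omega>)
            + (emeasure (lebesgue_on \<Omega>) \<Omega> + (\<integral>\<^sup>+x. ennreal (\<bar>a x\<bar> powr (l / 2)) \<partial>lebesgue_on \<Omega>)
            + (\<integral>\<^sup>+x. ennreal (\<bar>u x\<bar> powr p) \<partial>lebesgue_on \<Omega>)))"
          using um am hm by (simp add: nn_integral_cmult nn_integral_add)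
        also have "\<dots> < top"
        proof -
          have "(\<integral>\<^sup>+x. ennreal (\<bar>h x\<bar> powr (p / (p - 1))) \<partial>lebesgue_on \<Omega>) < top"
            unfolding h_def using critical_growth_dual[OF fm um _ _ up, of "2 * c_f"] p2 assms(6) by simp
          moreover have "emeasure (lebesgue_on \<Omega>) \<Omega> < top"
            using finite_measure.emeasure_finite[OF fm, of \<Omega>] by (simp add: less_top)
          moreover have "(\<integral>\<^sup>+x. ennreal (\<bar>a x\<bar> powr (l / 2)) \<partial>lebesgue_on \<Omega>) < top"
            using l(2) by (simp add: in_Lp_def integrable_iff_bounded)
          ultimately show ?thesis using up by (simp add: ennreal_mult_less_top)
        qed
        finally show ?thesis .
      qed
      have le: "AE x in lebesgue_on \<Omega>. \<bar>f x (u x)\<bar> \<le> 2 * c_f * (1 + \<bar>u x\<bar> powr (p - 1)) \<and>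
        2 * c_f * (1 + \<bar>u x\<bar> powr (p - 1)) \<le> g x \<and> \<bar>a x * u x\<bar> \<le> g x \<and>
        (\<forall>T. 0 \<le> u x * T \<longrightarrow> - (a x * u x * T) \<le> 2 * c_f * (1 + \<bar>u x\<bar> powr (p - 1)) * \<bar>T\<bar>)"
        using f a0
      proof eventually_elim
        case (elim x)
        \<comment> \<open>The left-hand side is nonpositive, since \<open>a\<close> is nonnegative
          and \<open>T\<close> has the sign of \<open>u\<close>; the size of \<open>a\<close> thus
          never reaches the constant.\<close>
        have "- (a x * u x * T) \<le> h x * \<bar>T\<bar>" if "0 \<le> u x * T" for T
        proof -
          have "0 \<le> a x * (u x * T)" using elim that by simp
          moreover have "0 \<le> h x * \<bar>T\<bar>" using h0[of x] by simp
          ultimately show ?thesis by (simp add: mult.assoc)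
        qed
        then show ?case
          using fu[OF elim(1)[rule_format, of "u x"]] h0[of x] unfolding g_def h_def by auto
      qed
      have r0: "0 < (p - 1) / 2" using p2 by simp
      have k: "0 < 2 * c_f" using assms(6) by simp
      have eq: "1 + (p - 1) / 2 = (p + 1) / 2" by (simp add: field_simps)
      show "in_Linf \<Omega> u \<and> Linf_bound \<Omega> C1 ((p + 1) / 2) u"
        unfolding eq[symmetric] C1_def
        using Linf_estimate_of_weak_form[OF n assms(2,5) u weq k gm r0, folded p_def \<gamma>_def \<mu>_def, OF le gfin] by blast
    qed
    show "in_Linf \<Omega> a \<longrightarrow> in_Linf \<Omega> u \<and> Linf_bound \<Omega> (C2 (enn2real (Linf_norm \<Omega> a))) (p / 2) u"
    proof
      assume a: "in_Linf \<Omega> a"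
      define m where "m = enn2real (Linf_norm \<Omega> a)"
      have m0: "0 \<le> m" by (simp add: m_def)
      have ab: "AE x in lebesgue_on \<Omega>. \<bar>a x\<bar> \<le> m"
        using esssup_AE[of "\<lambda>x. ennreal \<bar>a x\<bar>" "lebesgue_on \<Omega>"]
      proof eventually_elim
        case (elim x)
        then have "ennreal \<bar>a x\<bar> \<le> ennreal m"
          using a by (simp add: m_def Linf_norm_def in_Linf_def)
        then show ?case using m0 by (simp add: ennreal_le_iff)
      qed
      define k where "k = 2 * c_f + m"
      have k: "0 < k" using assms(6) m0 by (simp add: k_def)
      define g where "g x = k * (1 + \<bar>u x\<bar> powr (p - 1))" for x
      have gm: "g \<in> borel_measurable (lebesgue_on \<Omega>)" unfolding g_def using um by measurable
      have gfin: "(\<integral>\<^sup>+x. ennreal (\<bar>g x\<bar> powr (p / (p - 1))) \<partial>lebesgue_on \<Omega>) < top"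
        unfolding g_def using critical_growth_dual[OF fm um _ _ up, of k] p2 k by simp
      have le: "AE x in lebesgue_on \<Omega>. \<bar>f x (u x)\<bar> \<le> k * (1 + \<bar>u x\<bar> powr (p - 1)) \<and>
        k * (1 + \<bar>u x\<bar> powr (p - 1)) \<le> g x \<and> \<bar>a x * u x\<bar> \<le> g x \<and>
        (\<forall>T. 0 \<le> u x * T \<longrightarrow> - (a x * u x * T) \<le> k * (1 + \<bar>u x\<bar> powr (p - 1)) * \<bar>T\<bar>)"
        using f ab
      proof eventually_elim
        case (elim x)
        have w: "0 \<le> 1 + \<bar>u x\<bar> powr (p - 1)" by simp
        have "2 * c_f * (1 + \<bar>u x\<bar> powr (p - 1)) \<le> g x"
          unfolding g_def using m0 by (intro mult_right_mono w) (simp add: k_def)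
        then have 1: "\<bar>f x (u x)\<bar> \<le> g x"
          using fu[OF elim(1)[rule_format, of "u x"]] by (rule order_trans[rotated])
        \<comment> \<open>Because \<open>p - 1 \<ge> 1\<close>, a bounded potential times
          \<open>u\<close> is of the same growth as the right-hand side, and its norm is simply
          added to the growth constant.\<close>
        have "\<bar>u x\<bar> powr 1 \<le> 1 + \<bar>u x\<bar> powr (p - 1)" using p2 by (intro powr_le_one_plus_powr) auto
        then have "\<bar>a x\<bar> * \<bar>u x\<bar> \<le> k * (1 + \<bar>u x\<bar> powr (p - 1))"
          using elim(2) assms(6) k by (intro mult_mono) (auto simp: k_def)
        then have 2: "\<bar>a x * u x\<bar> \<le> g x" by (simp add: abs_mult g_def)
        have 3: "- (a x * u x * T) \<le> g x * \<bar>T\<bar>" for T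
        proof -
          have "- (a x * u x * T) \<le> \<bar>a x * u x\<bar> * \<bar>T\<bar>" by (metis abs_ge_minus_self abs_mult)
          also have "\<dots> \<le> g x * \<bar>T\<bar>" by (intro mult_right_mono 2) simp
          finally show ?thesis .
        qed
        from 1 2 3 show ?case by (simp add: g_def)
      qed
      have r0: "0 < p / 2 - 1" using p2 by simp
      have eq: "1 + (p / 2 - 1) = p / 2" by simp
      show "in_Linf \<Omega> u \<and> Linf_bound \<Omega> (C2 (enn2real (Linf_norm \<Omega> a))) (p / 2) u"
        unfolding m_def[symmetric] C2_def k_def[symmetric]
        using Linf_estimate_of_weak_form[OF n assms(2,5) u weq k gm r0, folded p_def \<gamma>_def \<mu>_def, OF le gfin]
        unfolding eq by blast
    qed
  qed
  moreover have "0 < C1" "\<And>m. 0 < C2 m" by (simp_all add: C1_def C2_def moser_const_def)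
  moreover have "two_star CARD('n) = p" by (simp add: p_def)
  ultimately show ?thesis
    by (intro exI[of _ C1] exI[of _ C2]) blast
qed

end
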